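(* Let $\mathfrak{g}$ be a finite-dimensional simple Lie algebra over $\mathbb{C}$ with a $\mathbb{Z}_n$-grading, and let $\mathfrak{h}_0,\mathfrak{b}_0,\Delta_0,\Sigma_+,\preccurlyeq_0$ be as in the context. An antichain $\mathcal{A}\subseteq\Sigma_+$ (with respect to $\preccurlyeq_0$) is a $k$-nilpotent positively-graded $\mathfrak{b}_0$-module subalgebra antichain if and only if the following three properties hold: (i) For any $(\mu_1,j_1),\dots,(\mu_{k+1},j_{k+1})\in\mathcal{A}$, $(\mu_1,j_1)+\dots+(\mu_{k+1},j_{k+1})\not\preccurlyeq_0(\lambda,j_1+\dots+j_{k+1})$ for any highest weight $\lambda$ of $\mathfrak{g}_{j_1+\dots+j_{k+1}}$. (ii) For any $(\mu_1,j_1),\dots,(\mu_m,j_m)\in\mathcal{A}$ with $j_1+\dots+j_m\equiv 0$, $(\mu_1,j_1)+\dots+(\mu_m,j_m)\not\preccurlyeq_0(\theta,0)$ for any highest root $\theta$ of $\mathfrak{g}_0$. (iii) If $(\mu_1,j_1),(\mu_2,j_2)\in\mathcal{A}$ and $(\mu_1,j_1)+(\mu_2,j_2)\preccurlyeq_0(\nu,j_1+j_2)$ for some $(\nu,j_1+j_2)\in\Sigma_+$, then there exists $(\alpha,j_1+j_2)\in\mathcal{A}$ with $(\alpha,j_1+j_2)\preccurlyeq_0(\nu,j_1+j_2)$.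
   Context: $\mathfrak{g}=\bigoplus_{i\in\mathbb{Z}_n}\mathfrak{g}_i$; $\mathfrak{h}$ is a Cartan subalgebra of $\mathfrak{g}$ with $\mathfrak{h}_0=\mathfrak{h}\cap\mathfrak{g}_0$ a Cartan subalgebra of the reductive algebra $\mathfrak{g}_0$; $\mathfrak{b}_0\supseteq\mathfrak{h}_0$ is a Borel subalgebra of $\mathfrak{g}_0$ with corresponding simple roots $\Delta_0$; $Q_0^+$ is the $\mathbb{Z}_{\ge0}$-span of $\Delta_0$. $P_0$ is the integral weight lattice of $\mathfrak{h}_0$, $\mathcal{P}_0=P_0\times\mathbb{Z}_n$ with componentwise addition and partial order $(\mu_1,j_1)\preccurlyeq_0(\mu_2,j_2)$ iff $j_1=j_2$ and $\mu_2-\mu_1\in Q_0^+$; an antichain is a set of pairwise incomparable elements. For $j\ne0$, $R_j$ is the set of $\mathfrak{h}_0$-weights of $\mathfrak{g}_j$, and $\Sigma_+=\{(\mu,j):j\not\equiv0,\ \mu\in R_j,\ \mu\ne0\}$. Highest weights of $\mathfrak{g}_j$ are the highest weights (w.r.t. $\mathfrak{b}_0$) of the irreducible $\mathfrak{g}_0$-submodules of $\mathfrak{g}_j$; highest roots of $\mathfrak{g}_0$ are the highest roots of its simple ideals. $\mathfrak{g}_+=\bigoplus_{i\ne0}\mathfrak{g}_i$. A $k$-nilpotent positively-graded $\mathfrak{b}_0$-module subalgebra is a subset $\mathfrak{i}\subseteq\mathfrak{g}_+$ with $[\mathfrak{i},\mathfrak{i}]\subseteq\mathfrak{i}$, $[\mathfrak{b}_0,\mathfrak{i}]\subseteq\mathfrak{i}$,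 $(\operatorname{ad}\mathfrak{i})^k(\mathfrak{i})=0$, and $\mathfrak{i}=\bigoplus_{j\ne0}(\mathfrak{i}\cap\mathfrak{g}_j)$. Its set of graded $\mathfrak{h}_0$-weights is $\operatorname{grwt}(\mathfrak{i})=\{(\mu,j)\in\mathcal{P}_0:\mu\text{ is an }\mathfrak{h}_0\text{-weight of }\mathfrak{i}\cap\mathfrak{g}_j\}$, and $\mathcal{A}_{\mathfrak{i}}$ is the set of $\preccurlyeq_0$-minimal elements of $\operatorname{grwt}(\mathfrak{i})$. An antichain $\mathcal{A}\subseteq\Sigma_+$ is a $k$-nilpotent positively-graded $\mathfrak{b}_0$-module subalgebra antichain if $\mathcal{A}=\mathcal{A}_{\mathfrak{i}}$ for some $k$-nilpotent positively-graded $\mathfrak{b}_0$-module subalgebra $\mathfrak{i}$ (necessarily with $\operatorname{grwt}(\mathfrak{i})\subseteq\Sigma_+$). Nonzero-weight spaces of each $\mathfrak{g}_j$, $j\ne0$, are one-dimensional. *)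

theory Defs
  imports Complex_Main "HOL-Library.Function_Algebras"
begin

definition lie_algebra :: "(complex \<Rightarrow> 'a \<Rightarrow> 'a) \<Rightarrow> ('a \<Rightarrow> 'a \<Rightarrow> 'a::ab_group_add) \<Rightarrow> bool" where
  "lie_algebra scale br \<longleftrightarrow> vector_space scale
     \<and> (\<forall>x y z. br (x + y) z = br x z + br y z)
     \<and> (\<forall>x y z. br x (y + z) = br x y + br x z)
     \<and> (\<forall>c x y. br (scale c x) y = scale c (br x y))
     \<and> (\<forall>c x y. br x (scale c y) = scale c (br x y))
     \<and> (\<forall>x. br x x = 0)
     \<and> (\<forall>x y z. br x (br y z) + br y (br z x) + br z (br x y) = 0)"

definition finite_dim :: "(complex \<Rightarrow> 'a \<Rightarrow> 'a::ab_group_add) \<Rightarrow> bool" where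
  "finite_dim scale \<longleftrightarrow> (\<exists>B. finite B \<and> module.span scale B = UNIV)"

definition lie_subalg :: "(complex \<Rightarrow> 'a \<Rightarrow> 'a) \<Rightarrow> ('a \<Rightarrow> 'a \<Rightarrow> 'a::ab_group_add) \<Rightarrow> 'a set \<Rightarrow> bool" where
  "lie_subalg scale br L \<longleftrightarrow> module.subspace scale L \<and> (\<forall>x\<in>L. \<forall>y\<in>L. br x y \<in> L)"

definition lie_ideal :: "(complex \<Rightarrow> 'a \<Rightarrow> 'a) \<Rightarrow> ('a \<Rightarrow> 'a \<Rightarrow> 'a::ab_group_add) \<Rightarrow> 'a set \<Rightarrow> 'a set \<Rightarrow> bool" where
  "lie_ideal scale br L I \<longleftrightarrow> module.subspace scale I \<and> I \<subseteq> L \<and> (\<forall>x\<in>L. \<forall>y\<in>I. br x y \<in> I)"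

definition simple_lie :: "(complex \<Rightarrow> 'a \<Rightarrow> 'a) \<Rightarrow> ('a \<Rightarrow> 'a \<Rightarrow> 'a::ab_group_add) \<Rightarrow> 'a set \<Rightarrow> bool" where
  "simple_lie scale br L \<longleftrightarrow> lie_subalg scale br L \<and> (\<exists>x\<in>L. \<exists>y\<in>L. br x y \<noteq> 0)
     \<and> (\<forall>I. lie_ideal scale br L I \<longrightarrow> I = {0} \<or> I = L)"

fun itbr :: "('a \<Rightarrow> 'a \<Rightarrow> 'a) \<Rightarrow> 'a list \<Rightarrow> 'a \<Rightarrow> 'a" where
  "itbr br [] y = y"
| "itbr br (x # xs) y = br x (itbr br xs y)"

definition nilpotent_lie :: "(complex \<Rightarrow> 'a \<Rightarrow> 'a) \<Rightarrow> ('a \<Rightarrow> 'a \<Rightarrow> 'a::ab_group_add) \<Rightarrow> 'a set \<Rightarrow> bool" where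
  "nilpotent_lie scale br H \<longleftrightarrow> lie_subalg scale br H \<and>
     (\<exists>m. \<forall>xs y. length xs = m \<and> set xs \<subseteq> H \<and> y \<in> H \<longrightarrow> itbr br xs y = 0)"

fun derived :: "(complex \<Rightarrow> 'a \<Rightarrow> 'a) \<Rightarrow> ('a \<Rightarrow> 'a \<Rightarrow> 'a::ab_group_add) \<Rightarrow> 'a set \<Rightarrow> nat \<Rightarrow> 'a set" where
  "derived scale br H 0 = H"
| "derived scale br H (Suc m) = module.span scale {br x y | x y. x \<in> derived scale br H m \<and> y \<in> derived scale br H m}"

definition solvable_lie :: "(complex \<Rightarrow> 'a \<Rightarrow> 'a) \<Rightarrow> ('a \<Rightarrow> 'a \<Rightarrow> 'a::ab_group_add) \<Rightarrow> 'a set \<Rightarrow> bool" where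
  "solvable_lie scale br H \<longleftrightarrow> lie_subalg scale br H \<and> (\<exists>m. derived scale br H m = {0})"

definition cartan_subalg :: "(complex \<Rightarrow> 'a \<Rightarrow> 'a) \<Rightarrow> ('a \<Rightarrow> 'a \<Rightarrow> 'a::ab_group_add) \<Rightarrow> 'a set \<Rightarrow> 'a set \<Rightarrow> bool" where
  "cartan_subalg scale br L H \<longleftrightarrow> H \<subseteq> L \<and> nilpotent_lie scale br H
     \<and> {x \<in> L. \<forall>y\<in>H. br x y \<in> H} = H"

definition borel_subalg :: "(complex \<Rightarrow> 'a \<Rightarrow> 'a) \<Rightarrow> ('a \<Rightarrow> 'a \<Rightarrow> 'a::ab_group_add) \<Rightarrow> 'a set \<Rightarrow> 'a set \<Rightarrow> bool" where
  "borel_subalg scale br L B \<longleftrightarrow> B \<subseteq> L \<and> solvable_lie scale br B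
     \<and> (\<forall>C. B \<subseteq> C \<and> C \<subseteq> L \<and> solvable_lie scale br C \<longrightarrow> C = B)"

definition zn_grading :: "(complex \<Rightarrow> 'a \<Rightarrow> 'a) \<Rightarrow> ('a \<Rightarrow> 'a \<Rightarrow> 'a::ab_group_add) \<Rightarrow> nat \<Rightarrow> (nat \<Rightarrow> 'a set) \<Rightarrow> bool" where
  "zn_grading scale br n gr \<longleftrightarrow> 0 < n
     \<and> (\<forall>j<n. module.subspace scale (gr j))
     \<and> (\<forall>x. \<exists>!f. (\<forall>j<n. f j \<in> gr j) \<and> (\<forall>j\<ge>n. f j = 0) \<and> x = (\<Sum>j<n. f j))
     \<and> (\<forall>i<n. \<forall>j<n. \<forall>x\<in>gr i. \<forall>y\<in>gr j. br x y \<in> gr ((i + j) mod n))"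

text \<open>mu is an h0-weight of the set M (an h0-stable subspace): it has a nonzero
  weight vector in M. Weights are functionals normalised to vanish outside h0.\<close>
definition is_weight :: "(complex \<Rightarrow> 'a \<Rightarrow> 'a) \<Rightarrow> ('a \<Rightarrow> 'a \<Rightarrow> 'a::ab_group_add) \<Rightarrow> 'a set \<Rightarrow> 'a set \<Rightarrow> ('a \<Rightarrow> complex) \<Rightarrow> bool" where
  "is_weight scale br h0 M \<mu> \<longleftrightarrow> (\<forall>x. x \<notin> h0 \<longrightarrow> \<mu> x = 0)
     \<and> (\<exists>v\<in>M. v \<noteq> 0 \<and> (\<forall>x\<in>h0. br x v = scale (\<mu> x) v))"

definition pos_roots0 :: "(complex \<Rightarrow> 'a \<Rightarrow> 'a) \<Rightarrow> ('a \<Rightarrow> 'a \<Rightarrow> 'a::ab_group_add) \<Rightarrow> (nat \<Rightarrow> 'a set) \<Rightarrow> 'a set \<Rightarrow> 'a set \<Rightarrow> ('a \<Rightarrow> complex) set" where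
  "pos_roots0 scale br gr h0 b0 = {\<alpha>. \<alpha> \<noteq> 0 \<and> is_weight scale br h0 (gr 0) \<alpha>
     \<and> (\<forall>v\<in>gr 0. (\<forall>x\<in>h0. br x v = scale (\<alpha> x) v) \<longrightarrow> v \<in> b0)}"

definition simple_roots0 :: "(complex \<Rightarrow> 'a \<Rightarrow> 'a) \<Rightarrow> ('a \<Rightarrow> 'a \<Rightarrow> 'a::ab_group_add) \<Rightarrow> (nat \<Rightarrow> 'a set) \<Rightarrow> 'a set \<Rightarrow> 'a set \<Rightarrow> ('a \<Rightarrow> complex) set" where
  "simple_roots0 scale br gr h0 b0 = {\<alpha> \<in> pos_roots0 scale br gr h0 b0.
     \<not> (\<exists>\<beta>\<in>pos_roots0 scale br gr h0 b0. \<exists>\<gamma>\<in>pos_roots0 scale br gr h0 b0. \<alpha> = \<beta> + \<gamma>)}"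

inductive_set qplus :: "'b::comm_monoid_add set \<Rightarrow> 'b set" for D where
  qplus_zero: "0 \<in> qplus D"
| qplus_add: "\<alpha> \<in> D \<Longrightarrow> q \<in> qplus D \<Longrightarrow> \<alpha> + q \<in> qplus D"

text \<open>The partial order on P_0 x Z_n (Z_n represented by naturals below n).\<close>
definition preceq0 :: "('b::ab_group_add) set \<Rightarrow> 'b \<times> nat \<Rightarrow> 'b \<times> nat \<Rightarrow> bool" where
  "preceq0 D p q \<longleftrightarrow> snd p = snd q \<and> fst q - fst p \<in> qplus D"

definition antichain :: "('b::ab_group_add) set \<Rightarrow> ('b \<times> nat) set \<Rightarrow> bool" where
  "antichain D A \<longleftrightarrow> (\<forall>p\<in>A. \<forall>q\<in>A. preceq0 D p q \<longrightarrow> p = q)"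

definition psum :: "nat \<Rightarrow> ('b::comm_monoid_add \<times> nat) list \<Rightarrow> 'b \<times> nat" where
  "psum n xs = (sum_list (map fst xs), sum_list (map snd xs) mod n)"

definition Sigma_plus :: "(complex \<Rightarrow> 'a \<Rightarrow> 'a) \<Rightarrow> ('a \<Rightarrow> 'a \<Rightarrow> 'a::ab_group_add) \<Rightarrow> nat \<Rightarrow> (nat \<Rightarrow> 'a set) \<Rightarrow> 'a set \<Rightarrow> (('a \<Rightarrow> complex) \<times> nat) set" where
  "Sigma_plus scale br n gr h0 = {(\<mu>, j). 0 < j \<and> j < n \<and> is_weight scale br h0 (gr j) \<mu> \<and> \<mu> \<noteq> 0}"

definition highest_weight :: "(complex \<Rightarrow> 'a \<Rightarrow> 'a) \<Rightarrow> ('a \<Rightarrow> 'a \<Rightarrow> 'a::ab_group_add) \<Rightarrow> (nat \<Rightarrow> 'a set) \<Rightarrow> 'a set \<Rightarrow> 'a set \<Rightarrow> nat \<Rightarrow> ('a \<Rightarrow> complex) \<Rightarrow> bool" where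
  "highest_weight scale br gr h0 b0 j lam \<longleftrightarrow> (\<exists>M. M \<subseteq> gr j \<and> module.subspace scale M
     \<and> (\<forall>x\<in>gr 0. \<forall>v\<in>M. br x v \<in> M) \<and> M \<noteq> {0}
     \<and> (\<forall>N. module.subspace scale N \<and> N \<subseteq> M \<and> (\<forall>x\<in>gr 0. \<forall>v\<in>N. br x v \<in> N) \<longrightarrow> N = {0} \<or> N = M)
     \<and> is_weight scale br h0 M lam
     \<and> (\<forall>\<mu>. is_weight scale br h0 M \<mu> \<longrightarrow> lam - \<mu> \<in> qplus (simple_roots0 scale br gr h0 b0)))"

definition highest_root :: "(complex \<Rightarrow> 'a \<Rightarrow> 'a) \<Rightarrow> ('a \<Rightarrow> 'a \<Rightarrow> 'a::ab_group_add) \<Rightarrow> (nat \<Rightarrow> 'a set) \<Rightarrow> 'a set \<Rightarrow> 'a set \<Rightarrow> ('a \<Rightarrow> complex) \<Rightarrow> bool" where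
  "highest_root scale br gr h0 b0 \<theta> \<longleftrightarrow> (\<exists>s. lie_ideal scale br (gr 0) s \<and> simple_lie scale br s
     \<and> \<theta> \<noteq> 0 \<and> is_weight scale br h0 s \<theta>
     \<and> (\<forall>\<alpha>. \<alpha> \<noteq> 0 \<and> is_weight scale br h0 s \<alpha> \<longrightarrow> \<theta> - \<alpha> \<in> qplus (simple_roots0 scale br gr h0 b0)))"

definition kn_pg_b0_subalg :: "(complex \<Rightarrow> 'a \<Rightarrow> 'a) \<Rightarrow> ('a \<Rightarrow> 'a \<Rightarrow> 'a::ab_group_add) \<Rightarrow> nat \<Rightarrow> (nat \<Rightarrow> 'a set) \<Rightarrow> 'a set \<Rightarrow> nat \<Rightarrow> 'a set \<Rightarrow> bool" where
  "kn_pg_b0_subalg scale br n gr b0 k I \<longleftrightarrow> lie_subalg scale br I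
     \<and> (\<forall>x\<in>b0. \<forall>y\<in>I. br x y \<in> I)
     \<and> (\<forall>xs y. length xs = k \<and> set xs \<subseteq> I \<and> y \<in> I \<longrightarrow> itbr br xs y = 0)
     \<and> (\<forall>x\<in>I. \<exists>f. (\<forall>j\<in>{1..<n}. f j \<in> I \<inter> gr j) \<and> x = (\<Sum>j\<in>{1..<n}. f j))"

definition grwt :: "(complex \<Rightarrow> 'a \<Rightarrow> 'a) \<Rightarrow> ('a \<Rightarrow> 'a \<Rightarrow> 'a::ab_group_add) \<Rightarrow> nat \<Rightarrow> (nat \<Rightarrow> 'a set) \<Rightarrow> 'a set \<Rightarrow> 'a set \<Rightarrow> (('a \<Rightarrow> complex) \<times> nat) set" where
  "grwt scale br n gr h0 I = {(\<mu>, j). j < n \<and> is_weight scale br h0 (I \<inter> gr j) \<mu>}"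

definition minimal_elems :: "('b::ab_group_add) set \<Rightarrow> ('b \<times> nat) set \<Rightarrow> ('b \<times> nat) set" where
  "minimal_elems D S = {p \<in> S. \<forall>q\<in>S. preceq0 D q p \<longrightarrow> q = p}"

definition kn_antichain :: "(complex \<Rightarrow> 'a \<Rightarrow> 'a) \<Rightarrow> ('a \<Rightarrow> 'a \<Rightarrow> 'a::ab_group_add) \<Rightarrow> nat \<Rightarrow> (nat \<Rightarrow> 'a set) \<Rightarrow> 'a set \<Rightarrow> 'a set \<Rightarrow> nat \<Rightarrow> (('a \<Rightarrow> complex) \<times> nat) set \<Rightarrow> bool" where
  "kn_antichain scale br n gr h0 b0 k A \<longleftrightarrow> (\<exists>I. kn_pg_b0_subalg scale br n gr b0 k I
     \<and> A = minimal_elems (simple_roots0 scale br gr h0 b0) (grwt scale br n gr h0 I))"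

end

theory Submission
  imports Defs "HOL-Computational_Algebra.Fundamental_Theorem_Algebra"
begin

text \<open>
  Killing's trace argument shows that the Killing form \<open>kf\<close> is nondegenerate and that \<open>h\<close> acts
  diagonalizably, so \<open>g\<close> splits into spaces \<open>wsp (\<mu>, j)\<close>, and \<open>kf\<close> pairs \<open>(\<mu>, j)\<close> with
  \<open>(- \<mu>, - j)\<close>. Hence every weight vector of nonzero weight lies in an \<open>sl\<^sub>2\<close>-triple with coroot in
  \<open>h0\<close>, nonzero weights have multiplicity one, and the form induced on the real span of the weights
  is positive definite.

  For a nilpotent subalgebra \<open>I\<close>, no nonzero weights of \<open>I\<close> sum to zero, since two opposite weights
  would generate a nonzero element of \<open>I \<inter> gr 0\<close>. If weights of \<open>I\<close> sum to something below a weight of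
  \<open>g\<close>, positive definiteness allows one to raise the summands or lower the target by positive roots
  until equality holds, and then a suitably ordered iterated bracket is nonzero. This gives the three conditions.

  Conversely, the weight spaces above \<open>A\<close> span a subalgebra. The conditions mention only highest
  weights and highest roots, so every weight must lie below one: a vector of maximal
  weight generates an irreducible module, because another maximal vector of nonzero weight is
  excluded by multiplicity one, and an invariant vector by a Casimir-type form. Two opposite weights
  above \<open>A\<close> cannot occur: alternating sums of their minorants in \<open>A\<close> stay below weights of \<open>g\<close>.
\<close>

subsection \<open>Linear algebra and the trace\<close>

text \<open>A Cartan subalgebra is given only as nilpotent and self-normalizing, so at first a
  weight is an arbitrary function and even its additivity has to be extracted from traces;
  commutativity and diagonalizability come afterwards. Once weights of \<open>h0\<close> are
  available, nearly every nonvanishing statement about brackets is reduced to one criterion,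
  \<open>ef_nonzero\<close>: if the coroot value of a vector is not a natural number, raising and
  then lowering it gives a nonzero vector. The obstacle specific to the grading is that weights are
  pairs of a functional and a degree. Opposite functionals need not have opposite degrees, and their
  bracket then has functional 0 in some nonzero degree, where multiplicity one and positive
  definiteness give no information. The remedy is to bracket twice: the functionals run through
  \<open>- \<mu>\<close>, 0, \<open>\<mu>\<close>, while the degree moves by the sum of the two
  original degrees. Modulo \<open>n\<close>, \<open>n - 1\<close> such shifts reach the exactly
  opposite degree. For the converse the same chain supplies the weights lying above balanced sums of
  \<open>k + 1\<close> elements of \<open>A\<close>.\<close>

locale fd_space = finite_dimensional_vector_space scale Basis
  for scale :: "complex \<Rightarrow> 'b \<Rightarrow> 'b::ab_group_add" (infixr "*s" 75) and Basis
begin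

definition lin :: "('b \<Rightarrow> 'b) \<Rightarrow> bool" where
  lin_iff: "lin f \<longleftrightarrow> (\<forall>x y. f (x + y) = f x + f y) \<and> (\<forall>c x. f (c *s x) = c *s f x)"

lemma linI: "(\<And>x y. f (x + y) = f x + f y) \<Longrightarrow> (\<And>c x. f (c *s x) = c *s f x) \<Longrightarrow> lin f"
  by (simp add: lin_iff)

lemma lin_add: "lin f \<Longrightarrow> f (x + y) = f x + f y"
  and lin_scale: "lin f \<Longrightarrow> f (c *s x) = c *s f x"
  by (simp_all add: lin_iff)

lemma lin_0: "lin f \<Longrightarrow> f 0 = 0"
  using lin_scale[of f 0 0] by simp

lemma lin_minus: "lin f \<Longrightarrow> f (- x) = - f x"
  using lin_scale[of f "- 1" x] by simp

lemma lin_diff: "lin f \<Longrightarrow> f (x - y) = f x - f y"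
  using lin_add[of f x "- y"] lin_minus[of f y] by simp

lemma lin_sum: "lin f \<Longrightarrow> f (\<Sum>i\<in>I. g i) = (\<Sum>i\<in>I. f (g i))"
  by (induction I rule: infinite_finite_induct) (simp_all add: lin_0 lin_add)

lemma lin_fun_comp: "lin f \<Longrightarrow> lin g \<Longrightarrow> lin (\<lambda>x. f (g x))"
  by (simp add: lin_iff)

lemma lin_fun_add: "lin f \<Longrightarrow> lin g \<Longrightarrow> lin (\<lambda>x. f x + g x)"
  by (simp add: lin_iff scale_right_distrib algebra_simps)

lemma lin_fun_diff: "lin f \<Longrightarrow> lin g \<Longrightarrow> lin (\<lambda>x. f x - g x)"
  by (simp add: lin_iff scale_right_diff_distrib algebra_simps)

lemma lin_fun_scale: "lin f \<Longrightarrow> lin (\<lambda>x. c *s f x)"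
  by (simp add: lin_iff scale_right_distrib mult.commute)

lemma lin_id: "lin (\<lambda>x. x)"
  by (simp add: lin_iff)

lemma lin_fun_sum: "(\<And>i. i \<in> I \<Longrightarrow> lin (f i)) \<Longrightarrow> lin (\<lambda>x. \<Sum>i\<in>I. f i x)"
  by (simp add: lin_iff sum.distrib scale_sum_right)

lemma lin_funpow: "lin f \<Longrightarrow> lin (f ^^ n)"
  by (induction n) (simp_all add: lin_iff)

lemma lin_subspace_vimage: "lin f \<Longrightarrow> subspace U \<Longrightarrow> subspace {x. f x \<in> U}"
  by (simp add: subspace_def lin_0 lin_add lin_scale)

lemma lin_subspace_image: "lin f \<Longrightarrow> subspace U \<Longrightarrow> subspace (f ` U)"
  unfolding subspace_def
  by (smt (verit, ccfv_threshold) image_iff lin_0 lin_add lin_scale)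

lemma lin_eq_on_span:
  assumes "lin f" "lin g" "\<And>x. x \<in> S \<Longrightarrow> f x = g x" "x \<in> span S"
  shows "f x = g x"
  using assms(4) by (induction rule: span_induct_alt) (simp_all add: assms lin_0 lin_add lin_scale)

text \<open>Extend a basis \<open>B\<close> of \<open>U\<close> to a basis of the whole space and
  keep only the coordinates along \<open>B\<close>.\<close>

lemma exists_projection:
  assumes "subspace U"
  shows "\<exists>Q. lin Q \<and> (\<forall>x. Q x \<in> U) \<and> (\<forall>x\<in>U. Q x = x)"
proof -
  obtain B where B: "B \<subseteq> U" "independent B" "U \<subseteq> span B"
    using basis_exists[of U] by metis
  let ?C = "extend_basis B"
  have C: "B \<subseteq> ?C" "independent ?C" "span ?C = UNIV"
    using B by (auto simp: extend_basis_superset independent_extend_basis span_extend_basis)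
  let ?Q = "\<lambda>x. \<Sum>b\<in>{b. representation ?C x b \<noteq> 0} \<inter> B. representation ?C x b *s b"
  \<comment> \<open>The support of the coordinates depends on \<open>x\<close>; summing over any
    finite superset lets additivity be checked over one index set.\<close>
  have eq: "?Q x = (\<Sum>b\<in>F \<inter> B. representation ?C x b *s b)"
    if "finite F" "{b. representation ?C x b \<noteq> 0} \<subseteq> F" for F x
    by (rule sum.mono_neutral_left) (use that in auto)
  have fin: "finite {b. representation ?C x b \<noteq> 0}" for x
    by (rule finite_representation)
  have "?Q (x + y) = ?Q x + ?Q y" for x y
  proof -
    let ?F = "{b. representation ?C x b \<noteq> 0} \<union> {b. representation ?C y b \<noteq> 0} \<union> {b. representation ?C (x+y) b \<noteq> 0}"
    have "?Q (x + y) = (\<Sum>b\<in>?F \<inter> B. representation ?C (x + y) b *s b)"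
      by (rule eq) (auto simp: fin)
    also have "\<dots> = (\<Sum>b\<in>?F \<inter> B. representation ?C x b *s b) + (\<Sum>b\<in>?F \<inter> B. representation ?C y b *s b)"
      by (simp add: representation_add C scale_left_distrib sum.distrib)
    also have "(\<Sum>b\<in>?F \<inter> B. representation ?C x b *s b) = ?Q x"
      by (rule eq[symmetric]) (auto simp: fin)
    also have "(\<Sum>b\<in>?F \<inter> B. representation ?C y b *s b) = ?Q y"
      by (rule eq[symmetric]) (auto simp: fin)
    finally show ?thesis .
  qed
  moreover have "?Q (c *s x) = c *s ?Q x" for c x
  proof -
    have "?Q (c *s x) = (\<Sum>b\<in>{b. representation ?C x b \<noteq> 0} \<inter> B. representation ?C (c *s x) b *s b)"
      by (rule eq) (auto simp: fin representation_scale C)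
    thus ?thesis by (simp add: representation_scale C scale_sum_right)
  qed
  ultimately have lin: "lin ?Q" by (rule linI)
  moreover have "?Q x \<in> U" for x
    by (rule subspace_sum[OF assms]) (use B assms in \<open>auto intro: subspace_scale\<close>)
  moreover have "?Q x = x" if "x \<in> U" for x
  proof (rule lin_eq_on_span[OF lin lin_id, of B])
    show "x \<in> span B" using that B by auto
    show "?Q b = b" if "b \<in> B" for b
    proof -
      have "representation ?C b = (\<lambda>v. if v = b then 1 else 0)"
        by (rule representation_basis) (use C that in auto)
      moreover have "{v. (if v = b then 1 else (0::complex)) \<noteq> 0} \<inter> B = {b}" using that by auto
      ultimately show ?thesis by simp
    qed
  qed
  ultimately show ?thesis by blast
qed

definition tr :: "('b \<Rightarrow> 'b) \<Rightarrow> complex" where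
  "tr f = (\<Sum>b\<in>Basis. representation Basis (f b) b)"

lemma rep_sum: "(\<Sum>b\<in>Basis. representation Basis x b *s b) = x"
  by (rule sum_representation_eq) (auto simp: independent_Basis span_Basis finite_Basis)

lemma rep_add: "representation Basis (x + y) b = representation Basis x b + representation Basis y b"
  and rep_scale: "representation Basis (c *s x) b = c * representation Basis x b"
  by (simp_all add: representation_add representation_scale independent_Basis span_Basis)

lemma rep_of_sum: "representation Basis (\<Sum>i\<in>I. g i) b = (\<Sum>i\<in>I. representation Basis (g i) b)"
  by (induction I rule: infinite_finite_induct) (simp_all add: rep_add representation_zero)

lemma tr_add: "tr (\<lambda>x. f x + g x) = tr f + tr g"
  by (simp add: tr_def rep_add sum.distrib)

lemma tr_scale: "tr (\<lambda>x. c *s f x) = c * tr f"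
  by (simp add: tr_def rep_scale sum_distrib_left)

lemma tr_diff: "tr (\<lambda>x. f x - g x) = tr f - tr g"
proof -
  have "tr f = tr (\<lambda>x. (f x - g x) + g x)" by simp
  also have "\<dots> = tr (\<lambda>x. f x - g x) + tr g" by (rule tr_add)
  finally show ?thesis by simp
qed

lemma tr_0: "tr (\<lambda>x. 0) = 0"
  by (simp add: tr_def representation_zero)

lemma tr_sum: "tr (\<lambda>x. \<Sum>i\<in>I. f i x) = (\<Sum>i\<in>I. tr (f i))"
  by (induction I rule: infinite_finite_induct) (simp_all add: tr_add tr_0)

lemma tr_comm:
  assumes "lin f" "lin g"
  shows "tr (\<lambda>x. f (g x)) = tr (\<lambda>x. g (f x))"
proof -
  have *: "tr (\<lambda>x. f (g x)) = (\<Sum>b\<in>Basis. \<Sum>c\<in>Basis. representation Basis (g b) c * representation Basis (f c) b)"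
    if "lin f" for f g
  proof -
    have "representation Basis (f (g b)) b = (\<Sum>c\<in>Basis. representation Basis (g b) c * representation Basis (f c) b)" for b
    proof -
      have "f (g b) = f (\<Sum>c\<in>Basis. representation Basis (g b) c *s c)" by (simp only: rep_sum)
      thus ?thesis by (simp add: lin_sum that lin_scale rep_of_sum rep_scale)
    qed
    thus ?thesis by (simp add: tr_def)
  qed
  show ?thesis
    unfolding *[OF assms(1)] *[OF assms(2)]
    by (subst sum.swap) (simp add: mult.commute)
qed

text \<open>Expanding \<open>u\<close> in \<open>Basis\<close> turns the diagonal entries of this
  rank-one map into the expansion of \<open>p u\<close>.\<close>

lemma tr_rank1:
  assumes "\<And>x y. p (x + y) = p x + p y" "\<And>c x. p (c *s x) = c * p x"
  shows "tr (\<lambda>x. p x *s u) = p u"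
proof -
  have p0: "p 0 = 0" using assms(2)[of 0 0] by simp
  have ps: "p (\<Sum>b\<in>B. g b) = (\<Sum>b\<in>B. p (g b))" for B and g :: "'b \<Rightarrow> 'b"
    by (induction B rule: infinite_finite_induct) (simp_all add: assms p0)
  have "p u = p (\<Sum>b\<in>Basis. representation Basis u b *s b)" by (simp only: rep_sum)
  thus ?thesis by (simp add: tr_def rep_scale ps assms mult.commute)
qed

text \<open>In a basis \<open>B\<close> of its range a projection is a sum of rank-one maps, one for
  each coordinate, and each of them has trace 1 by \<open>tr_rank1\<close>.\<close>

lemma tr_projection:
  assumes "lin P" "\<And>x. P (P x) = P x"
  shows "tr P = of_nat (dim (range P))"
proof -
  have sub: "subspace (range P)" using lin_subspace_image[OF assms(1)] by simp
  obtain B where B: "B \<subseteq> range P" "independent B" "range P \<subseteq> span B" "card B = dim (range P)"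
    using basis_exists[of "range P"] by metis
  have finB: "finite B" using B finiteI_independent by auto
  have inB: "P x \<in> span B" for x using B by auto
  have "P = (\<lambda>x. \<Sum>b\<in>B. representation B (P x) b *s b)"
    using sum_representation_eq[OF B(2) inB finB] by auto
  hence "tr P = tr (\<lambda>x. \<Sum>b\<in>B. representation B (P x) b *s b)" by simp
  also have "\<dots> = (\<Sum>b\<in>B. tr (\<lambda>x. representation B (P x) b *s b))"
    by (rule tr_sum)
  also have "\<dots> = (\<Sum>b\<in>B. 1)"
  proof (rule sum.cong)
    fix b assume b: "b \<in> B"
    have "tr (\<lambda>x. representation B (P x) b *s b) = representation B (P b) b"
      by (rule tr_rank1)
        (simp_all add: lin_add lin_scale assms representation_add representation_scale B inB)
    moreover have "P b = b" using b B(1) assms(2) by auto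
    ultimately show "tr (\<lambda>x. representation B (P x) b *s b) = 1"
      using b by (simp add: representation_basis B)
  qed simp
  finally show ?thesis by (simp add: B)
qed

text \<open>The exponent is lowered by passing to the range: for a projection \<open>Q\<close> onto
  \<open>range f\<close>, cyclicity shows that \<open>f\<close> and \<open>f\<close> after
  \<open>Q\<close> have the same trace, and on \<open>range f\<close> one power fewer
  suffices.\<close>

lemma tr_nilpotent:
  assumes "lin f" "\<And>x. (f ^^ N) x = 0"
  shows "tr f = 0"
  using assms
proof (induction N arbitrary: f)
  case 0
  hence "f = (\<lambda>x. 0)" by (metis funpow_0)
  thus ?case by (simp add: tr_0)
next
  case (Suc N)
  show ?case
  \<comment> \<open>The power identity \<open>pow\<close> below holds only for positive exponents;
    for exponent 0 it would compare \<open>x\<close> with \<open>Q x\<close>.\<close>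
  proof (cases N)
    case 0
    hence "f = (\<lambda>x. 0)" using Suc.prems(2) by auto
    thus ?thesis by (simp add: tr_0)
  next
    case (Suc M)
    obtain Q where Q: "lin Q" "\<And>x. Q x \<in> range f" "\<And>x. x \<in> range f \<Longrightarrow> Q x = x"
      using exists_projection[OF lin_subspace_image[OF Suc.prems(1)], of UNIV] by auto
    have pow: "((\<lambda>x. f (Q x)) ^^ Suc k) x = (f ^^ Suc k) (Q x)" for k x
      by (induction k) (simp_all add: Q(3))
    have "tr f = tr (\<lambda>x. Q (f x))" using Q(3) by simp
    also have "\<dots> = tr (\<lambda>x. f (Q x))" by (rule tr_comm[OF Q(1) Suc.prems(1)])
    also have "\<dots> = 0"
    proof (rule Suc.IH)
      show "lin (\<lambda>x. f (Q x))" by (rule lin_fun_comp[OF Suc.prems(1) Q(1)])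
      show "((\<lambda>x. f (Q x)) ^^ N) x = 0" for x
      proof -
        obtain y where "Q x = f y" using Q(2)[of x] by auto
        hence "((\<lambda>x. f (Q x)) ^^ N) x = (f ^^ Suc N) y"
          using pow[of M x] Suc by (simp add: funpow_swap1)
        thus ?thesis using Suc.prems(2) by simp
      qed
    qed
    finally show ?thesis .
  qed
qed

subsection \<open>Generalized eigenspaces\<close>

definition shift :: "('b \<Rightarrow> 'b) \<Rightarrow> complex \<Rightarrow> 'b \<Rightarrow> 'b" where
  "shift f a = (\<lambda>u. f u - a *s u)"

definition geig :: "('b \<Rightarrow> 'b) \<Rightarrow> complex \<Rightarrow> 'b set" where
  "geig f a = {v. \<exists>m. (shift f a ^^ m) v = 0}"

lemma lin_shift: "lin f \<Longrightarrow> lin (shift f a)"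
  unfolding shift_def by (intro lin_fun_diff lin_fun_scale lin_id)

lemma funpow_zero_mono:
  assumes "lin f" "(f ^^ m) v = 0" "m \<le> k"
  shows "(f ^^ k) v = 0"
proof -
  have "(f ^^ k) v = (f ^^ (k - m)) ((f ^^ m) v)"
    using assms(3) by (metis comp_apply funpow_add le_add_diff_inverse2)
  thus ?thesis using assms by (simp add: lin_0 lin_funpow)
qed

lemma subspace_geig:
  assumes "lin f"
  shows "subspace (geig f a)"
proof (rule subspaceI)
  note lin = lin_funpow[OF lin_shift[OF assms]]
  show "0 \<in> geig f a" by (auto simp: geig_def intro!: exI[of _ 0])
  show "x + y \<in> geig f a" if "x \<in> geig f a" "y \<in> geig f a" for x y
  proof -
    obtain m where "(shift f a ^^ m) x = 0" using \<open>x \<in> _\<close> by (auto simp: geig_def)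
    moreover obtain k where "(shift f a ^^ k) y = 0" using \<open>y \<in> _\<close> by (auto simp: geig_def)
    ultimately have "(shift f a ^^ (max m k)) x = 0" "(shift f a ^^ (max m k)) y = 0"
      by (auto intro: funpow_zero_mono[OF lin_shift[OF assms]])
    thus ?thesis by (auto simp: geig_def lin_add[OF lin] intro!: exI[of _ "max m k"])
  qed
  show "c *s x \<in> geig f a" if "x \<in> geig f a" for c x
    using that by (auto simp: geig_def lin_scale[OF lin])
qed

lemma shift_commute:
  assumes "lin f"
  shows "shift f a (shift f b v) = shift f b (shift f a v)"
  using assms by (simp add: shift_def lin_diff lin_scale scale_right_diff_distrib mult.commute algebra_simps)

text \<open>\<open>v\<close> is a true eigenvector for \<open>a\<close>, so each application of
  \<open>shift f b\<close> multiplies it by the nonzero scalar \<open>a - b\<close>.\<close>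

lemma shift_inj_geig:
  assumes "lin f" "v \<in> geig f b" "shift f a v = 0" "a \<noteq> b"
  shows "v = 0"
proof -
  obtain m where "(shift f b ^^ m) v = 0" using assms(2) by (auto simp: geig_def)
  moreover have "f v = a *s v" using assms(3) by (simp add: shift_def)
  hence "(shift f b ^^ m) v = (a - b) ^ m *s v" for m
    by (induction m) (simp_all add: shift_def assms(1) lin_scale scale_left_diff_distrib algebra_simps)
  ultimately show ?thesis using assms(4) by simp
qed

text \<open>The last nonzero iterate of \<open>v\<close> under \<open>shift f a\<close> is a true
  eigenvector for \<open>a\<close>, and it remains in \<open>geig f b\<close> because shifts
  commute.\<close>

lemma geig_Int:
  assumes "lin f" "v \<in> geig f a" "v \<in> geig f b" "a \<noteq> b"
  shows "v = 0"
proof (rule ccontr)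
  assume "v \<noteq> 0"
  obtain m where "(shift f a ^^ m) v = 0" using assms(2) by (auto simp: geig_def)
  hence ex: "\<exists>m. (shift f a ^^ m) v = 0" by blast
  define m where "m = (LEAST m. (shift f a ^^ m) v = 0)"
  have m: "(shift f a ^^ m) v = 0" unfolding m_def by (rule LeastI_ex[OF ex])
  have "m \<noteq> 0" using m \<open>v \<noteq> 0\<close> by (cases m) auto
  then obtain k where k: "m = Suc k" by (cases m) auto
  let ?w = "(shift f a ^^ k) v"
  have "?w \<noteq> 0" using not_less_Least[of k "\<lambda>m. (shift f a ^^ m) v = 0"] k unfolding m_def by auto
  moreover have "shift f a ?w = 0" using m k by simp
  moreover have "?w \<in> geig f b"
  proof -
    obtain l where l: "(shift f b ^^ l) v = 0" using assms(3) by (auto simp: geig_def)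
    have c: "shift f b ((shift f a ^^ j) u) = (shift f a ^^ j) (shift f b u)" for j u
      by (induction j) (simp_all add: shift_commute[OF assms(1)])
    have "(shift f b ^^ i) ((shift f a ^^ j) u) = (shift f a ^^ j) ((shift f b ^^ i) u)" for i j u
      by (induction i) (simp_all add: c)
    thus ?thesis using l by (auto simp: geig_def lin_0[OF lin_funpow[OF lin_shift[OF assms(1)]]] intro!: exI[of _ l])
  qed
  ultimately show False using shift_inj_geig[OF assms(1)] assms(4) by blast
qed

text \<open>On the generalized eigenspace for \<open>b\<close>, \<open>shift f a\<close> is the
  nonzero scalar \<open>b - a\<close> plus the nilpotent map \<open>shift f b\<close>; recursion on
  the nilpotency exponent builds its inverse.\<close>

lemma shift_surj_geig:
  assumes "lin f" "subspace W" "\<And>x. x \<in> W \<Longrightarrow> f x \<in> W" "a \<noteq> b"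
    and "(shift f b ^^ m) u = 0" "u \<in> W"
  shows "\<exists>u'\<in>W. (shift f b ^^ m) u' = 0 \<and> shift f a u' = u"
  using assms(5,6)
proof (induction m arbitrary: u)
  case 0
  thus ?case using assms(2) lin_0[OF lin_shift[OF assms(1)]] by (auto intro!: bexI[of _ 0] subspace_0)
next
  case (Suc m)
  have lin: "lin (shift f b ^^ k)" for k by (intro lin_funpow lin_shift assms)
  have sW: "shift f b x \<in> W" if "x \<in> W" for x
    unfolding shift_def using that assms by (auto intro: subspace_diff subspace_scale)
  have "(shift f b ^^ m) (shift f b u) = 0" using Suc.prems by (simp add: funpow_swap1)
  then obtain u' where u': "u' \<in> W" "(shift f b ^^ m) u' = 0" "shift f a u' = shift f b u"
    using Suc.IH[of "shift f b u"] sW Suc.prems by blast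
  \<comment> \<open>Since \<open>u'\<close> absorbs the nilpotent part of the image of
    \<open>u\<close>, the difference \<open>u - u'\<close> is mapped to
    \<open>(b - a) *s u\<close>.\<close>
  let ?u = "(1 / (b - a)) *s (u - u')"
  have "shift f a u = shift f b u + (b - a) *s u"
    by (simp add: shift_def scale_left_diff_distrib)
  hence "shift f a (u - u') = (b - a) *s u"
    using u'(3) lin_diff[OF lin_shift[OF assms(1)], of a u u'] by simp
  hence "shift f a ?u = u" using lin_scale[OF lin_shift[OF assms(1)]] assms(4) by simp
  moreover have "?u \<in> W" using Suc.prems u' assms(2) by (auto intro: subspace_scale subspace_diff)
  moreover have "(shift f b ^^ Suc m) u' = 0" using u'(2) lin_0[OF lin_shift[OF assms(1)]] by simp
  hence "(shift f b ^^ Suc m) ?u = 0"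
    using Suc.prems(1) lin[of "Suc m"] by (simp add: lin_scale lin_diff del: funpow.simps)
  ultimately show ?case by blast
qed

section \<open>Polynomials in an endomorphism and the generalized eigenspace decomposition\<close>

lemma exists_relation:
  fixes g :: "nat \<Rightarrow> 'b"
  shows "\<exists>m c. g m = (\<Sum>i<m. c i *s g i)"
proof -
  have coeffs: "\<exists>c. x = (\<Sum>i<m. c i *s g i)" if "x \<in> span (g ` {..<m})" for x m
    using that
  proof (induction m arbitrary: x)
    case (Suc m)
    from Suc.prems obtain k where "x - k *s g m \<in> span (g ` {..<m})"
      by (auto simp: lessThan_Suc span_breakdown_eq)
    then obtain c where "x - k *s g m = (\<Sum>i<m. c i *s g i)" using Suc.IH by blast
    hence "x = (\<Sum>i<m. c i *s g i) + k *s g m" by (metis diff_add_cancel)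
    hence "x = (\<Sum>i<Suc m. (c(m := k)) i *s g i)" by simp
    thus ?case by blast
  qed auto
  have "\<exists>m. g m \<in> span (g ` {..<m})"
  proof (rule ccontr)
    assume "\<not> ?thesis"
    hence n: "g m \<notin> span (g ` {..<m})" for m by blast
    have "independent (g ` {..<m}) \<and> card (g ` {..<m}) = m" for m
    proof (induction m)
      case 0
      show ?case by (simp add: independent_empty)
    next
      case (Suc m)
      have "g m \<notin> g ` {..<m}"
      proof
        assume "g m \<in> g ` {..<m}"
        from span_base[OF this] show False using n[of m] by contradiction
      qed
      moreover have "independent (insert (g m) (g ` {..<m}))"
        by (rule independent_insertI) (use n[of m] Suc in auto)
      ultimately show ?case using Suc by (simp add: lessThan_Suc)
    qed
    from this[of "Suc (dim UNIV)"] show False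
      using independent_card_le_dim[of "g ` {..<Suc (dim UNIV)}" UNIV] by simp
  qed
  thus ?thesis using coeffs by blast
qed

definition peval :: "('b \<Rightarrow> 'b) \<Rightarrow> complex poly \<Rightarrow> 'b \<Rightarrow> 'b" where
  "peval f p v = (\<Sum>i\<le>degree p. coeff p i *s (f ^^ i) v)"

lemma peval_bound: "degree p \<le> N \<Longrightarrow> peval f p v = (\<Sum>i\<le>N. coeff p i *s (f ^^ i) v)"
  unfolding peval_def by (rule sum.mono_neutral_left) (auto simp: coeff_eq_0)

lemma peval_add: "peval f (p + q) v = peval f p v + peval f q v"
proof -
  let ?N = "max (degree p) (degree q)"
  have "degree (p + q) \<le> ?N" by (rule degree_add_le_max)
  thus ?thesis
    by (simp add: peval_bound[of _ ?N] scale_left_distrib sum.distrib)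
qed

lemma peval_smult: "peval f (smult c p) v = c *s peval f p v"
  by (simp add: peval_bound[of "smult c p" "degree p"] peval_def scale_sum_right)

lemma peval_pCons0:
  assumes "lin f"
  shows "peval f (pCons 0 p) v = f (peval f p v)"
proof -
  have "peval f (pCons 0 p) v = (\<Sum>i\<le>Suc (degree p). coeff (pCons 0 p) i *s (f ^^ i) v)"
    by (rule peval_bound) (simp add: degree_pCons_le)
  also have "\<dots> = (\<Sum>i\<le>degree p. coeff p i *s f ((f ^^ i) v))"
    by (subst sum.atMost_Suc_shift) simp
  finally show ?thesis by (simp add: peval_def lin_sum lin_scale assms)
qed

lemma peval_linear_factor:
  assumes "lin f"
  shows "peval f ([:- a, 1:] * p) v = shift f a (peval f p v)"
proof -
  have "[:- a, 1:] * p = smult (- a) p + pCons 0 p" by simp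
  thus ?thesis by (simp only: peval_add peval_smult peval_pCons0[OF assms]) (simp add: shift_def)
qed

text \<open>A linear dependence among the iterates of \<open>v\<close>, read as a monic polynomial;
  monicity makes it nonzero.\<close>

lemma exists_annihilator: "\<exists>p. p \<noteq> 0 \<and> peval f p v = 0"
proof -
  obtain m c where mc: "(f ^^ m) v = (\<Sum>i<m. c i *s (f ^^ i) v)"
    using exists_relation[of "\<lambda>i. (f ^^ i) v"] by blast
  let ?p = "monom 1 m - (\<Sum>i<m. monom (c i) i) :: complex poly"
  have co: "coeff ?p k = (if k = m then 1 else if k < m then - c k else 0)" for k
    by (auto simp: coeff_sum)
  have "degree ?p \<le> m" by (rule degree_le) (simp only: co, simp)
  hence "peval f ?p v = (\<Sum>i\<le>m. (if i = m then 1 else if i < m then - c i else 0) *s (f ^^ i) v)"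
    by (simp only: peval_bound co)
  also have "\<dots> = (f ^^ m) v + (\<Sum>i<m. - (c i *s (f ^^ i) v))"
    by (simp add: lessThan_Suc_atMost[symmetric] add.commute)
  also have "\<dots> = 0" using mc by (simp add: sum_negf)
  finally have "peval f ?p v = 0" .
  moreover have "?p \<noteq> 0" using co[of m] by (metis coeff_0 zero_neq_one)
  ultimately show ?thesis by blast
qed

lemma peval_in:
  assumes "subspace W" "\<And>x. x \<in> W \<Longrightarrow> f x \<in> W" "v \<in> W"
  shows "peval f p v \<in> W"
proof -
  have "(f ^^ i) v \<in> W" for i by (induction i) (auto simp: assms)
  thus ?thesis unfolding peval_def by (intro subspace_sum subspace_scale assms) auto
qed

text \<open>Strip linear factors off an annihilating polynomial of \<open>v\<close>. This works
  because, for \<open>w\<close> in \<open>W\<close>, \<open>shift f a w\<close> lies in the span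
  \<open>?U\<close> only if \<open>w\<close> does.\<close>

theorem generalized_eigenspaces_span:
  assumes "lin f" "subspace W" "\<And>x. x \<in> W \<Longrightarrow> f x \<in> W" "v \<in> W"
  shows "v \<in> span (\<Union>a. W \<inter> geig f a)"
proof -
  let ?U = "span (\<Union>a. W \<inter> geig f a)"
  have UW: "?U \<subseteq> W" by (rule span_minimal) (use assms in auto)
  have geigU: "u \<in> ?U" if "u \<in> W" "u \<in> geig f a" for u a
    using that by (auto intro: span_base)
  \<comment> \<open>Modulo \<open>geig f a\<close>, every vector of \<open>?U\<close> is an image
    under \<open>shift f a\<close>: the other generalized eigenspaces are mapped onto themselves,
    and on \<open>geig f a\<close> itself the preimage 0 will do.\<close>
  have corr: "\<exists>u'\<in>?U. u - shift f a u' \<in> W \<inter> geig f a" if "u \<in> ?U" for u a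
    using that
  proof (induction rule: span_induct_alt)
    case base
    show ?case using lin_0[OF lin_shift[OF assms(1)], of a] subspace_0[OF subspace_geig[OF assms(1)]]
        subspace_0[OF assms(2)] by (auto intro!: bexI[of _ 0] span_zero)
  next
    case (step c x y)
    obtain y' where y': "y' \<in> ?U" "y - shift f a y' \<in> W \<inter> geig f a" using step by blast
    obtain b where b: "x \<in> W" "x \<in> geig f b" using step by blast
    have sub: "subspace (W \<inter> geig f a)"
      by (intro subspace_inter assms subspace_geig)
    have "\<exists>x'\<in>?U. x - shift f a x' \<in> W \<inter> geig f a"
    proof (cases "a = b")
      case True
      thus ?thesis using b lin_0[OF lin_shift[OF assms(1)], of a] by (auto intro!: bexI[of _ 0] span_zero)
    next
      case False
      obtain m where "(shift f b ^^ m) x = 0" using b by (auto simp: geig_def)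
      then obtain x' where x': "x' \<in> W" "(shift f b ^^ m) x' = 0" "shift f a x' = x"
        using shift_surj_geig[OF assms(1-3) False] b by blast
      hence "x' \<in> ?U" using geigU[of x' b] by (auto simp: geig_def)
      thus ?thesis using x' subspace_0[OF sub] by (intro bexI[of _ x']) auto
    qed
    then obtain x' where x': "x' \<in> ?U" "x - shift f a x' \<in> W \<inter> geig f a" by blast
    have "c *s x + y - shift f a (c *s x' + y') = c *s (x - shift f a x') + (y - shift f a y')"
      by (simp add: lin_add[OF lin_shift[OF assms(1)]] lin_scale[OF lin_shift[OF assms(1)]]
          scale_right_diff_distrib)
    also have "\<dots> \<in> W \<inter> geig f a" using x' y' by (intro subspace_add[OF sub] subspace_scale[OF sub])
    finally show ?case using x' y' by (intro bexI[of _ "c *s x' + y'"]) (auto intro: span_add span_scale)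
  qed
  have key: "w \<in> ?U" if w: "w \<in> W" "shift f a w \<in> ?U" for w a
  proof -
    obtain u' where u': "u' \<in> ?U" "shift f a w - shift f a u' \<in> W \<inter> geig f a"
      using corr[OF w(2)] by blast
    hence "shift f a (w - u') \<in> geig f a" by (simp add: lin_diff[OF lin_shift[OF assms(1)]])
    then obtain m where "(shift f a ^^ m) (shift f a (w - u')) = 0" by (auto simp: geig_def)
    hence "(shift f a ^^ Suc m) (w - u') = 0" by (simp only: funpow_Suc_right comp_apply)
    hence "w - u' \<in> geig f a" unfolding geig_def by blast
    moreover have "w - u' \<in> W" using w u' UW assms by (auto intro: subspace_diff)
    ultimately have "w - u' \<in> ?U" by (rule geigU[rotated])
    thus ?thesis using u'(1) span_add by fastforce
  qed
  \<comment> \<open>Membership in \<open>?U\<close>, rather than vanishing, is the hypothesis that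
    survives the removal of a factor.\<close>
  have "v \<in> ?U" if "p \<noteq> 0" "peval f p v \<in> ?U" for p
    using that
  proof (induction "degree p" arbitrary: p)
    case 0
    then obtain c where p: "p = [:c:]" by (metis degree_eq_zeroE)
    hence "c *s v \<in> ?U" "c \<noteq> 0" using 0 by (auto simp: peval_def)
    hence "(1 / c) *s (c *s v) \<in> ?U" by (metis span_scale)
    thus ?case using \<open>c \<noteq> 0\<close> by simp
  next
    case (Suc k)
    have "\<not> constant (poly p)" using Suc.hyps(2) by (simp add: constant_degree)
    then obtain a where "poly p a = 0" using fundamental_theorem_of_algebra by blast
    then obtain q where q: "p = [:- a, 1:] * q" by (metis poly_eq_0_iff_dvd dvdE)
    hence "q \<noteq> 0" using Suc.prems by auto
    have "degree q = k" using Suc.hyps(2) q \<open>q \<noteq> 0\<close> by (subst (asm) q, subst (asm) degree_mult_eq) auto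
    have "shift f a (peval f q v) \<in> ?U" using Suc.prems(2) q peval_linear_factor[OF assms(1)] by metis
    moreover have "peval f q v \<in> W" using peval_in[of W f v q] assms(2-4) by blast
    ultimately have "peval f q v \<in> ?U" using key by blast
    thus ?case using Suc.hyps(1)[of q] \<open>q \<noteq> 0\<close> \<open>degree q = k\<close> by blast
  qed
  moreover obtain p where "p \<noteq> 0" "peval f p v = 0" using exists_annihilator by blast
  ultimately show ?thesis by (metis span_zero)
qed

subsection \<open>Direct sums and the Killing form\<close>

lemma pointwise_nilpotent_tr:
  assumes "lin f" "\<And>x. \<exists>m. (f ^^ m) x = 0"
  shows "tr f = 0"
proof -
  obtain m where m: "\<And>x. (f ^^ m x) x = 0" using assms(2) by metis
  let ?N = "\<Sum>b\<in>Basis. m b"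
  have "(f ^^ ?N) x = 0" for x
  proof (rule lin_eq_on_span[of "f ^^ ?N" "\<lambda>x. 0" Basis])
    show "(f ^^ ?N) b = 0" if "b \<in> Basis" for b
      by (rule funpow_zero_mono[OF assms(1) m[of b]]) (use that finite_Basis in \<open>auto intro: member_le_sum\<close>)
    show "x \<in> span Basis" by (simp add: span_Basis)
    show "lin (\<lambda>x. 0)" by (rule linI) simp_all
  qed (rule lin_funpow[OF assms(1)])
  thus ?thesis by (rule tr_nilpotent[OF assms(1)])
qed

text \<open>Powers of a product of commuting maps split, so the product inherits nilpotency from
  \<open>f\<close>.\<close>

lemma tr_nilpotent_comp:
  assumes "lin f" "lin g" "\<And>x. f (g x) = g (f x)" "\<And>x. \<exists>m. (f ^^ m) x = 0"
  shows "tr (\<lambda>x. f (g x)) = 0"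
proof (rule pointwise_nilpotent_tr)
  show "lin (\<lambda>x. f (g x))" by (rule lin_fun_comp[OF assms(1,2)])
  have c: "g ((f ^^ k) x) = (f ^^ k) (g x)" for k x by (induction k) (simp_all flip: assms(3))
  have pow: "((\<lambda>x. f (g x)) ^^ k) x = (g ^^ k) ((f ^^ k) x)" for k x
  proof (induction k)
    case (Suc k)
    have c': "f ((g ^^ j) y) = (g ^^ j) (f y)" for j y by (induction j) (simp_all add: assms(3))
    have "f (g ((g ^^ k) ((f ^^ k) x))) = g (f ((g ^^ k) ((f ^^ k) x)))" by (rule assms(3))
    also have "\<dots> = g ((g ^^ k) (f ((f ^^ k) x)))" by (simp only: c')
    finally show ?case using Suc by simp
  qed simp
  show "\<exists>m. ((\<lambda>x. f (g x)) ^^ m) x = 0" for x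
  proof -
    obtain m where "(f ^^ m) x = 0" using assms(4) by blast
    thus ?thesis using pow[of m x] lin_0[OF lin_funpow[OF assms(2)]] by metis
  qed
qed

text \<open>Nonzero vectors picked from distinct members are independent, so their number is bounded
  by the dimension. Independence is assumed for finite subfamilies because \<open>J\<close> is not
  yet known to be finite.\<close>

lemma finite_if_independent_subspaces:
  assumes "\<And>i. i \<in> J \<Longrightarrow> \<exists>v\<in>W i. v \<noteq> 0" "\<And>i. i \<in> J \<Longrightarrow> subspace (W i)"
    and "\<And>F v. \<lbrakk>finite F; F \<subseteq> J; \<forall>i\<in>F. v i \<in> W i; (\<Sum>i\<in>F. v i) = 0\<rbrakk> \<Longrightarrow> \<forall>i\<in>F. v i = 0"
  shows "finite J"
proof -
  obtain e where e: "\<And>i. i \<in> J \<Longrightarrow> e i \<in> W i \<and> e i \<noteq> 0" using assms(1) by metis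
  have bound: "card F \<le> dim UNIV" if F: "F \<subseteq> J" "finite F" for F
  proof -
    have inj: "inj_on e F"
    proof (rule inj_onI, rule ccontr)
      fix i j assume ij: "i \<in> F" "j \<in> F" "e i = e j" "i \<noteq> j"
      let ?v = "\<lambda>k. if k = i then e i else - e j"
      have "\<forall>k\<in>{i, j}. ?v k = 0"
      proof (rule assms(3))
        have "e i \<in> W i" "- e j \<in> W j" using ij F e assms(2) subspace_neg by blast+
        thus "\<forall>k\<in>{i, j}. ?v k \<in> W k" by simp
      qed (use ij F in auto)
      hence "e i = 0" by simp
      thus False using e ij F by blast
    qed
    have "independent (e ` F)"
    proof (rule independent_if_scalars_zero)
      show "finite (e ` F)" using F by simp
      fix f x assume 0: "(\<Sum>x\<in>e ` F. f x *s x) = 0" and "x \<in> e ` F"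
      have "(\<Sum>i\<in>F. f (e i) *s e i) = 0" using 0 by (simp add: sum.reindex[OF inj])
      hence "\<forall>i\<in>F. f (e i) *s e i = 0"
        using F e assms(2) by (intro assms(3)) (auto intro: subspace_scale)
      thus "f x = 0" using \<open>x \<in> e ` F\<close> e F by auto
    qed
    hence "card (e ` F) \<le> dim UNIV" by (intro independent_card_le_dim) auto
    thus ?thesis by (simp add: card_image[OF inj])
  qed
  show ?thesis
  proof (rule ccontr)
    assume "infinite J"
    then obtain F where "finite F" "card F = Suc (dim UNIV)" "F \<subseteq> J"
      by (meson infinite_arbitrarily_large)
    thus False using bound[of F] by simp
  qed
qed

end

text \<open>An internal direct sum, given by spanning and the absence of nontrivial relations. It
  serves both the generalized weight spaces of \<open>h\<close> and the graded weight spaces of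
  \<open>h0\<close>.\<close>

locale dsum = fd_space scale Basis
  for scale :: "complex \<Rightarrow> 'b \<Rightarrow> 'b::ab_group_add" (infixr "*s" 75) and Basis +
  fixes I :: "'i set" and W :: "'i \<Rightarrow> 'b set"
  assumes finite_I: "finite I"
    and subspace_W: "i \<in> I \<Longrightarrow> subspace (W i)"
    and span_W: "v \<in> span (\<Union>i\<in>I. W i)"
    and indep_W: "(\<And>i. i \<in> I \<Longrightarrow> u i \<in> W i) \<Longrightarrow> (\<Sum>i\<in>I. u i) = 0 \<Longrightarrow> i \<in> I \<Longrightarrow> u i = 0"
begin

lemma exists_components: "\<exists>w. (\<forall>i\<in>I. w i \<in> W i) \<and> v = (\<Sum>i\<in>I. w i)"
  using span_W[of v]
proof (induction rule: span_induct_alt)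
  case base
  show ?case by (rule exI[of _ "\<lambda>i. 0"]) (simp add: subspace_0 subspace_W)
next
  case (step c x y)
  obtain w where w: "\<forall>i\<in>I. w i \<in> W i" "y = (\<Sum>i\<in>I. w i)" using step by blast
  obtain j where j: "j \<in> I" "x \<in> W j" using step by blast
  let ?w = "\<lambda>i. (if i = j then c *s x else 0) + w i"
  have "c *s x + y = (\<Sum>i\<in>I. ?w i)" using j w finite_I by (simp add: sum.distrib)
  moreover have "\<forall>i\<in>I. ?w i \<in> W i"
    using w j subspace_W by (auto intro!: subspace_add subspace_scale subspace_0)
  ultimately show ?case by (intro exI[of _ ?w]) auto
qed

text \<open>The value 0 outside \<open>I\<close> lets linearity and the orthogonality rule
  \<open>prj_prj\<close> hold for all indices.\<close>

definition prj :: "'i \<Rightarrow> 'b \<Rightarrow> 'b" where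
  "prj i v = (if i \<in> I then (SOME w. (\<forall>i\<in>I. w i \<in> W i) \<and> v = (\<Sum>i\<in>I. w i)) i else 0)"

lemma prj_in: "i \<in> I \<Longrightarrow> prj i v \<in> W i"
  and sum_prj: "(\<Sum>i\<in>I. prj i v) = v"
  using someI_ex[OF exists_components[of v]] by (simp_all add: prj_def)

lemma prj_unique:
  assumes "\<And>i. i \<in> I \<Longrightarrow> w i \<in> W i" "v = (\<Sum>i\<in>I. w i)" "i \<in> I"
  shows "prj i v = w i"
proof -
  have "prj i v - w i = 0"
  proof (rule indep_W[of "\<lambda>i. prj i v - w i"])
    show "(\<Sum>i\<in>I. prj i v - w i) = 0" using assms(2) by (simp add: sum_subtractf sum_prj)
  qed (use assms subspace_W prj_in in \<open>auto intro: subspace_diff\<close>)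
  thus ?thesis by simp
qed

lemma lin_prj: "lin (prj i)"
proof (cases "i \<in> I")
  case True
  show ?thesis
  proof (rule linI)
    show "prj i (x + y) = prj i x + prj i y" for x y
      by (rule prj_unique) (auto simp: True sum.distrib sum_prj subspace_W prj_in intro: subspace_add)
    show "prj i (c *s x) = c *s prj i x" for c x
      by (rule prj_unique) (auto simp: True sum_prj subspace_W prj_in scale_sum_right[symmetric] intro: subspace_scale)
  qed
qed (simp add: prj_def lin_iff)

lemma prj_W: "j \<in> I \<Longrightarrow> v \<in> W j \<Longrightarrow> prj i v = (if i = j then v else 0)"
proof (cases "i \<in> I")
  case True
  assume "j \<in> I" "v \<in> W j"
  thus ?thesis using True finite_I
    by (intro prj_unique[of "\<lambda>i. if i = j then v else 0"]) (auto simp: subspace_0 subspace_W)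
qed (auto simp: prj_def)

lemma prj_prj: "prj i (prj j v) = (if i = j then prj j v else 0)"
proof (cases "j \<in> I")
  case True
  thus ?thesis using prj_W[OF True prj_in] by simp
next
  case False
  thus ?thesis using lin_0[OF lin_prj[of i]] by (simp add: prj_def)
qed

lemma eq_on_W:
  assumes "lin f" "lin g" "\<And>i x. i \<in> I \<Longrightarrow> x \<in> W i \<Longrightarrow> f x = g x"
  shows "f x = g x"
proof (rule lin_eq_on_span[OF assms(1,2)])
  show "x \<in> span (\<Union>i\<in>I. W i)" by (rule span_W)
qed (use assms(3) in blast)

lemma tr_prj: "i \<in> I \<Longrightarrow> tr (prj i) = of_nat (dim (W i))"
proof -
  assume i: "i \<in> I"
  have "prj i x = x" if "x \<in> W i" for x using prj_W[OF i that] by simp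
  hence "range (prj i) = W i" using prj_in[OF i] by (metis subsetI rangeI image_subset_iff subset_antisym)
  thus ?thesis using tr_projection[OF lin_prj, of i] prj_prj[of i i] by simp
qed

text \<open>Write the identity as the sum of the idempotents \<open>prj i\<close>, double each of
  them, and move one copy to the front by cyclicity.\<close>

lemma tr_diagonal:
  assumes "lin f"
  shows "tr f = (\<Sum>i\<in>I. tr (\<lambda>x. prj i (f (prj i x))))"
proof -
  have "tr f = tr (\<lambda>x. \<Sum>i\<in>I. f (prj i x))"
    by (simp add: lin_sum[OF assms, symmetric] sum_prj)
  also have "\<dots> = (\<Sum>i\<in>I. tr (\<lambda>x. f (prj i x)))" by (rule tr_sum)
  also have "\<dots> = (\<Sum>i\<in>I. tr (\<lambda>x. prj i (f (prj i x))))"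
  proof (rule sum.cong)
    fix i
    have "tr (\<lambda>x. f (prj i (prj i x))) = tr (\<lambda>x. prj i (f (prj i x)))"
      by (rule tr_comm[OF lin_fun_comp[OF assms lin_prj] lin_prj])
    thus "tr (\<lambda>x. f (prj i x)) = tr (\<lambda>x. prj i (f (prj i x)))" by (simp add: prj_prj)
  qed simp
  finally show ?thesis .
qed

lemma tr_off_diagonal:
  assumes "lin f" "\<And>i x. i \<in> I \<Longrightarrow> x \<in> W i \<Longrightarrow> prj i (f x) = 0"
  shows "tr f = 0"
proof -
  have "tr (\<lambda>x. prj i (f (prj i x))) = 0" if "i \<in> I" for i
    using assms(2)[OF that prj_in[OF that]] by (simp add: tr_0)
  thus ?thesis using tr_diagonal[OF assms(1)] by simp
qed

end

section \<open>Lie brackets and the Killing form\<close>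

locale lie_alg = fd_space scale Basis
  for scale :: "complex \<Rightarrow> 'b \<Rightarrow> 'b::ab_group_add" (infixr "*s" 75) and Basis +
  fixes br :: "'b \<Rightarrow> 'b \<Rightarrow> 'b"
  assumes lie: "lie_algebra scale br"
begin

lemma br_add_left: "br (x + y) z = br x z + br y z"
  and br_add_right: "br x (y + z) = br x y + br x z"
  and br_scale_left: "br (c *s x) y = c *s br x y"
  and br_scale_right: "br x (c *s y) = c *s br x y"
  and br_self [simp]: "br x x = 0"
  and jacobi: "br x (br y z) + br y (br z x) + br z (br x y) = 0"
  using lie by (simp_all add: lie_algebra_def)

lemma lin_br: "lin (br x)" and lin_br_right: "lin (\<lambda>y. br y x)"
  by (simp_all add: lin_iff br_add_left br_add_right br_scale_left br_scale_right)

lemma br_0_right [simp]: "br x 0 = 0" and br_0_left [simp]: "br 0 x = 0"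
  using lin_0[OF lin_br] lin_0[OF lin_br_right] by simp_all

lemma br_minus_right: "br x (- y) = - br x y" and br_minus_left: "br (- y) x = - br y x"
  using lin_minus[OF lin_br] lin_minus[OF lin_br_right] by simp_all

lemma br_diff_right: "br x (y - z) = br x y - br x z" and br_diff_left: "br (y - z) x = br y x - br z x"
  using lin_diff[OF lin_br] lin_diff[OF lin_br_right] by simp_all

lemma br_sum_right: "br x (\<Sum>i\<in>I. g i) = (\<Sum>i\<in>I. br x (g i))"
  and br_sum_left: "br (\<Sum>i\<in>I. g i) x = (\<Sum>i\<in>I. br (g i) x)"
  by (rule lin_sum[OF lin_br]) (rule lin_sum[OF lin_br_right])

lemma br_skew: "br x y = - br y x"
proof -
  have "br (x + y) (x + y) = br x y + br y x"
    by (simp only: br_add_left br_add_right) simp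
  thus ?thesis by (simp add: eq_neg_iff_add_eq_0)
qed

lemma leibniz: "br x (br y z) = br (br x y) z + br y (br x z)"
proof -
  have "br x (br y z) = - br y (br z x) - br z (br x y)"
    using jacobi[of x y z] by (simp add: algebra_simps eq_neg_iff_add_eq_0)
  moreover have "br y (br z x) = - br y (br x z)" using br_skew[of z x] by (simp add: br_minus_right)
  moreover have "br z (br x y) = - br (br x y) z" by (rule br_skew)
  ultimately show ?thesis by simp
qed

lemma br_br: "br (br x y) z = br x (br y z) - br y (br x z)"
  using leibniz[of x y z] by simp

definition kf :: "'b \<Rightarrow> 'b \<Rightarrow> complex" where
  "kf x y = tr (\<lambda>u. br x (br y u))"

lemma kf_sym: "kf x y = kf y x"
  unfolding kf_def by (rule tr_comm[OF lin_br lin_br])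

lemma kf_add_left: "kf (x + y) z = kf x z + kf y z"
  and kf_scale_left: "kf (c *s x) z = c * kf x z"
  by (simp_all add: kf_def br_add_left br_scale_left tr_add tr_scale)

lemma kf_add_right: "kf z (x + y) = kf z x + kf z y"
  and kf_scale_right: "kf z (c *s x) = c * kf z x"
  by (metis kf_sym kf_add_left) (metis kf_sym kf_scale_left)

lemma kf_0_right [simp]: "kf x 0 = 0" and kf_0_left [simp]: "kf 0 x = 0"
  using kf_scale_right[of x 0 0] kf_scale_left[of 0 0 x] by simp_all

lemma kf_sum_right: "kf x (\<Sum>i\<in>I. g i) = (\<Sum>i\<in>I. kf x (g i))"
  by (induction I rule: infinite_finite_induct) (simp_all add: kf_add_right)

lemma kf_minus_right: "kf x (- y) = - kf x y"
  using kf_scale_right[of x "- 1" y] by simp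

lemma kf_minus_left: "kf (- y) x = - kf y x"
  by (metis kf_sym kf_minus_right)

lemma kf_diff_right: "kf x (y - z) = kf x y - kf x z"
  using kf_add_right[of x y "- z"] by (simp add: kf_minus_right)

lemma kf_diff_left: "kf (y - z) x = kf y x - kf z x"
  by (metis kf_sym kf_diff_right)

text \<open>Both sides are differences of traces of threefold products with the same first product;
  the second ones agree up to a cyclic rotation.\<close>

lemma kf_invariant: "kf (br x y) z = kf x (br y z)"
proof -
  have "tr (\<lambda>u. br y (br x (br z u))) = tr (\<lambda>u. br x (br z (br y u)))"
    by (rule tr_comm[OF lin_br lin_fun_comp[OF lin_br lin_br]])
  thus ?thesis by (simp add: kf_def br_br br_diff_right tr_diff)
qed

lemma kf_invariant_minus: "kf (br x y) z = - kf y (br x z)"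
  using kf_invariant[of y x z] br_skew[of x y] by (simp add: kf_minus_left)

text \<open>The Leibniz rule distributes the shift by \<open>a + b\<close> over the bracket as a
  shift by \<open>a\<close> of one factor plus a shift by \<open>b\<close> of the other, so each
  application uses up one of the two exponents.\<close>

lemma shift_br_nilpotent:
  "(shift (br x) a ^^ m) u = 0 \<Longrightarrow> (shift (br x) b ^^ k) v = 0 \<Longrightarrow>
   (shift (br x) (a + b) ^^ (m + k)) (br u v) = 0"
proof (induction "m + k" arbitrary: m k u v)
  case 0
  thus ?case by simp
next
  case (Suc N)
  have lin: "lin (shift (br x) c ^^ j)" for c j by (intro lin_funpow lin_shift lin_br)
  have step: "shift (br x) (a + b) (br u v) = br (shift (br x) a u) v + br u (shift (br x) b v)"
    by (simp add: shift_def leibniz[of x u v] br_diff_left br_diff_right br_scale_left br_scale_right scale_left_distrib)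
  note IH = Suc.hyps(1) and N = Suc.hyps(2) and prems = Suc.prems
  have 1: "(shift (br x) (a + b) ^^ N) (br (shift (br x) a u) v) = 0"
  proof (cases m)
    case 0
    hence "u = 0" using Suc.prems by simp
    thus ?thesis by (simp add: lin_0[OF lin] lin_0[OF lin_shift[OF lin_br]])
  next
    case (Suc m')
    have "(shift (br x) a ^^ m') (shift (br x) a u) = 0"
      using prems(1) Suc by (simp add: funpow_swap1)
    thus ?thesis using IH[of m' k] Suc N prems(2) by simp
  qed
  have 2: "(shift (br x) (a + b) ^^ N) (br u (shift (br x) b v)) = 0"
  proof (cases k)
    case 0
    hence "v = 0" using Suc.prems by simp
    thus ?thesis by (simp add: lin_0[OF lin] lin_0[OF lin_shift[OF lin_br]])
  next
    case (Suc k')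
    have "(shift (br x) b ^^ k') (shift (br x) b v) = 0"
      using prems(2) Suc by (simp add: funpow_swap1)
    thus ?thesis using IH[of m k'] Suc N prems(1) by simp
  qed
  have "(shift (br x) (a + b) ^^ Suc N) (br u v) = (shift (br x) (a + b) ^^ N) (shift (br x) (a + b) (br u v))"
    by (simp only: funpow_Suc_right comp_apply)
  also have "\<dots> = 0" unfolding step by (simp add: lin_add[OF lin] 1 2)
  finally show ?case using N by simp
qed

lemma geig_br: "u \<in> geig (br x) a \<Longrightarrow> v \<in> geig (br x) b \<Longrightarrow> br u v \<in> geig (br x) (a + b)"
  using shift_br_nilpotent[where x = x and a = a and b = b and u = u and v = v] by (fastforce simp: geig_def)

end

subsection \<open>Weight spaces of a Cartan subalgebra\<close>

lemma (in fd_space) shift_0 [simp]: "shift f 0 = f"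
  by (simp add: shift_def)

locale simple_lie_alg = lie_alg scale Basis br
  for scale :: "complex \<Rightarrow> 'b \<Rightarrow> 'b::ab_group_add" (infixr "*s" 75) and Basis
    and br :: "'b \<Rightarrow> 'b \<Rightarrow> 'b" +
  assumes simple: "simple_lie scale br UNIV"
begin

lemma nonabelian: "\<exists>x y. br x y \<noteq> 0"
  using simple by (auto simp: simple_lie_def)

lemma ideal_trivial:
  assumes "subspace J" "\<And>x y. y \<in> J \<Longrightarrow> br x y \<in> J"
  shows "J = {0} \<or> J = UNIV"
  using simple assms by (auto simp: simple_lie_def lie_ideal_def)

lemma center_trivial:
  assumes "\<And>x. br x z = 0"
  shows "z = 0"
proof -
  let ?Z = "{z. \<forall>x. br x z = 0}"
  have "?Z = {0} \<or> ?Z = UNIV"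
    by (rule ideal_trivial) (auto simp: subspace_def br_add_right br_scale_right)
  moreover have "?Z \<noteq> UNIV" using nonabelian by auto
  ultimately show ?thesis using assms by blast
qed

lemma brackets_span: "v \<in> span {br x y | x y. True}"
proof -
  let ?D = "span {br x y | x y. True}"
  have in_D: "br x y \<in> ?D" for x y by (rule span_base) blast
  have "?D = {0} \<or> ?D = UNIV" by (rule ideal_trivial[OF subspace_span]) (rule in_D)
  moreover have "?D \<noteq> {0}" using nonabelian in_D by (metis singletonD)
  ultimately show ?thesis by blast
qed

text \<open>The radical is an ideal. This leaves for nondegeneracy only the task of finding one
  nonzero value of \<open>kf\<close>.\<close>

lemma kf_radical: "(\<forall>x y. kf x y = 0) \<or> (\<forall>x. (\<forall>y. kf x y = 0) \<longrightarrow> x = 0)"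
proof -
  let ?R = "{x. \<forall>y. kf x y = 0}"
  have "?R = {0} \<or> ?R = UNIV"
  proof (rule ideal_trivial)
    show "subspace ?R" by (simp add: subspace_def kf_add_left kf_scale_left)
    show "br x y \<in> ?R" if "y \<in> ?R" for x y using that by (simp add: kf_invariant_minus)
  qed
  thus ?thesis by blast
qed

text \<open>At the least length for which all iterated brackets vanish, a nonzero bracket one step
  shorter would be central.\<close>

lemma not_nilpotent: "\<not> nilpotent_lie scale br UNIV"
proof
  assume "nilpotent_lie scale br UNIV"
  then obtain m0 where "\<forall>xs y. length xs = m0 \<longrightarrow> itbr br xs y = 0"
    by (auto simp: nilpotent_lie_def)
  hence ex: "\<exists>m. \<forall>xs y. length xs = m \<longrightarrow> itbr br xs y = 0" by blast
  define m where "m = (LEAST m. \<forall>xs y. length xs = m \<longrightarrow> itbr br xs y = 0)"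
  have m: "\<forall>xs y. length xs = m \<longrightarrow> itbr br xs y = 0" unfolding m_def by (rule LeastI_ex[OF ex])
  show False
  proof (cases m)
    case 0
    hence "y = 0" for y :: 'b using m[rule_format, of "[]" y] by simp
    thus False using nonabelian by metis
  next
    case (Suc k)
    hence "k < (LEAST m. \<forall>xs y. length xs = m \<longrightarrow> itbr br xs y = 0)"
      unfolding m_def by simp
    hence "\<not> (\<forall>xs y. length xs = k \<longrightarrow> itbr br xs y = 0)" by (rule not_less_Least)
    then obtain xs y where xs: "length xs = k" "itbr br xs y \<noteq> 0" by blast
    have "br x (itbr br xs y) = 0" for x
      using m[rule_format, of "x # xs" y] Suc xs(1) by simp
    thus False using center_trivial xs(2) by blast
  qed
qed

end

locale lie_cartan = simple_lie_alg scale Basis br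
  for scale :: "complex \<Rightarrow> 'b \<Rightarrow> 'b::ab_group_add" (infixr "*s" 75) and Basis
    and br :: "'b \<Rightarrow> 'b \<Rightarrow> 'b" +
  fixes h :: "'b set"
  assumes cartan: "cartan_subalg scale br UNIV h"
begin

lemma nilp: "nilpotent_lie scale br h"
  and subspace_h: "subspace h"
  and h_br: "x \<in> h \<Longrightarrow> y \<in> h \<Longrightarrow> br x y \<in> h"
  using cartan by (simp_all add: cartan_subalg_def nilpotent_lie_def lie_subalg_def)

lemma h_normalizer: "(\<And>y. y \<in> h \<Longrightarrow> br y x \<in> h) \<Longrightarrow> x \<in> h"
proof -
  assume "\<And>y. y \<in> h \<Longrightarrow> br y x \<in> h"
  hence "\<forall>y\<in>h. br x y \<in> h" using subspace_neg[OF subspace_h] by (metis br_skew)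
  thus "x \<in> h" using cartan by (auto simp: cartan_subalg_def)
qed

lemma h_geig: "x \<in> h \<Longrightarrow> y \<in> h \<Longrightarrow> y \<in> geig (br x) 0"
proof -
  assume xy: "x \<in> h" "y \<in> h"
  obtain m where m: "\<forall>xs y. length xs = m \<and> set xs \<subseteq> h \<and> y \<in> h \<longrightarrow> itbr br xs y = 0"
    using nilp by (auto simp: nilpotent_lie_def)
  have "itbr br (replicate k x) y = (br x ^^ k) y" for k by (induction k) simp_all
  moreover have "itbr br (replicate m x) y = 0"
    using xy by (intro m[rule_format]) auto
  ultimately show ?thesis by (auto simp: geig_def)
qed

text \<open>Here \<open>\<beta>\<close> is an arbitrary function; that those in \<open>Rt\<close>
  are linear on \<open>h\<close> is proved later from traces.\<close>

definition gws :: "('b \<Rightarrow> complex) \<Rightarrow> 'b set" where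
  "gws \<beta> = {v. \<forall>x\<in>h. v \<in> geig (br x) (\<beta> x)}"

lemma subspace_gws: "subspace (gws \<beta>)"
  using subspace_geig[OF lin_br] by (simp add: gws_def subspace_def)

lemma gws_br: "u \<in> gws \<alpha> \<Longrightarrow> v \<in> gws \<beta> \<Longrightarrow> br u v \<in> gws (\<alpha> + \<beta>)"
  by (simp add: gws_def geig_br)

lemma h_gws: "h \<subseteq> gws 0"
  by (auto simp: gws_def h_geig)

lemma gws_h_stable: "x \<in> h \<Longrightarrow> v \<in> gws \<beta> \<Longrightarrow> br x v \<in> gws \<beta>"
  using gws_br[of x 0 v \<beta>] h_gws by auto

text \<open>Induction on the dimension of \<open>W\<close>: an element of \<open>h\<close> with two
  generalized eigenvalues splits \<open>W\<close> into proper \<open>h\<close>-stable pieces; if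
  there is none, \<open>W\<close> lies in a single \<open>gws c\<close>.\<close>

lemma gws_span:
  assumes "subspace W" "\<And>x v. x \<in> h \<Longrightarrow> v \<in> W \<Longrightarrow> br x v \<in> W"
  shows "W \<subseteq> span (\<Union>\<beta>. W \<inter> gws \<beta>)"
  using assms
proof (induction "dim W" arbitrary: W rule: less_induct)
  case less
  define P where "P = (\<lambda>x c. W \<inter> geig (br x) c)"
  have subP: "subspace (P x c)" for x c
    unfolding P_def by (intro subspace_inter less.prems subspace_geig lin_br)
  \<comment> \<open>The pieces are \<open>h\<close>-stable because nilpotency of \<open>h\<close>
    puts \<open>y\<close> into the generalized eigenspace of \<open>br x\<close> for 0.\<close>
  have Pst: "br y v \<in> P x c" if "x \<in> h" "y \<in> h" "v \<in> P x c" for x y v c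
    using that less.prems(2) geig_br[OF h_geig[of x y], of v c] by (auto simp: P_def)
  have gen: "W \<subseteq> span (\<Union>c. P x c)" if "x \<in> h" for x
    using generalized_eigenspaces_span[OF lin_br less.prems(1), of x] less.prems(2) that
    by (auto simp: P_def)
  show ?case
  proof (cases "\<exists>x\<in>h. \<exists>a b. a \<noteq> b \<and> P x a \<noteq> {0} \<and> P x b \<noteq> {0}")
    case True
    then obtain x a b where x: "x \<in> h" "a \<noteq> b" "P x a \<noteq> {0}" "P x b \<noteq> {0}" by blast
    have sub: "P x c \<subseteq> span (\<Union>\<beta>. W \<inter> gws \<beta>)" for c
    proof -
      have "P x c \<noteq> W"
      proof
        assume eq: "P x c = W"
        have "c = d" if "P x d \<noteq> {0}" for d
        proof (rule ccontr)
          assume "c \<noteq> d"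
          moreover obtain v where "v \<in> P x d" "v \<noteq> 0" using \<open>P x d \<noteq> {0}\<close> subspace_0[OF subP] by blast
          ultimately show False using eq geig_Int[OF lin_br, of v x c d] by (auto simp: P_def)
        qed
        thus False using x by blast
      qed
      hence "P x c \<subset> W" by (auto simp: P_def)
      hence "dim (P x c) < dim W"
        using dim_psubset[of "P x c" W] subP less.prems(1) by (metis span_eq_iff)
      hence "P x c \<subseteq> span (\<Union>\<beta>. P x c \<inter> gws \<beta>)"
        by (rule less.hyps) (use subP Pst x(1) in auto)
      also have "\<dots> \<subseteq> span (\<Union>\<beta>. W \<inter> gws \<beta>)" by (rule span_mono) (auto simp: P_def)
      finally show ?thesis .
    qed
    have "span (\<Union>c. P x c) \<subseteq> span (\<Union>\<beta>. W \<inter> gws \<beta>)"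
      by (rule span_minimal) (use sub in auto)
    thus ?thesis using gen[OF x(1)] by blast
  next
    case False
    have "\<exists>c. W \<subseteq> P x c" if "x \<in> h" for x
    proof (cases "\<exists>c. P x c \<noteq> {0}")
      case True
      then obtain c where c: "P x c \<noteq> {0}" by blast
      have "(\<Union>d. P x d) \<subseteq> P x c"
      proof
        fix v assume "v \<in> (\<Union>d. P x d)"
        then obtain d where "v \<in> P x d" by blast
        moreover have "d = c \<or> P x d = {0}" using False c that by blast
        ultimately show "v \<in> P x c" using subspace_0[OF subP[of x c]] by auto
      qed
      hence "span (\<Union>d. P x d) \<subseteq> P x c" by (rule span_minimal[OF _ subP])
      thus ?thesis using gen[OF that] by blast
    next
      case False
      hence "span (\<Union>d. P x d) = {0}" by simp
      thus ?thesis using gen[OF that] subspace_0[OF subP[of x 0]] by auto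
    qed
    then obtain c where c: "\<And>x. x \<in> h \<Longrightarrow> W \<subseteq> P x (c x)" by metis
    hence "W \<subseteq> gws c" by (auto simp: gws_def P_def)
    thus ?thesis by (auto intro!: span_base)
  qed
qed

text \<open>Vanishing outside \<open>h\<close> makes distinct members differ already on
  \<open>h\<close>. The zero function belongs to \<open>Rt\<close> as soon as \<open>h\<close> is
  nonzero.\<close>

definition Rt :: "('b \<Rightarrow> complex) set" where
  "Rt = {\<beta>. (\<forall>x. x \<notin> h \<longrightarrow> \<beta> x = 0) \<and> (\<exists>v\<in>gws \<beta>. v \<noteq> 0)}"

lemma shift_gws: "x \<in> h \<Longrightarrow> v \<in> gws \<beta> \<Longrightarrow> shift (br x) c v \<in> gws \<beta>"
  unfolding shift_def by (intro subspace_diff subspace_scale subspace_gws gws_h_stable)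

text \<open>For two weights in \<open>F\<close> choose \<open>x\<close> in \<open>h\<close>
  separating them; a power of \<open>shift (br x) (\<gamma> x)\<close> kills the component of
  \<open>\<gamma>\<close> and is injective on \<open>gws \<beta>\<close>.\<close>

lemma gws_indep:
  assumes "finite F" "\<And>\<beta> x. \<beta> \<in> F \<Longrightarrow> x \<notin> h \<Longrightarrow> \<beta> x = 0"
    and "\<And>\<beta>. \<beta> \<in> F \<Longrightarrow> v \<beta> \<in> gws \<beta>" "(\<Sum>\<beta>\<in>F. v \<beta>) = 0" "\<beta> \<in> F"
  shows "v \<beta> = 0"
  using assms
proof (induction "card F" arbitrary: F v \<beta> rule: less_induct)
  case less
  show ?case
  proof (cases "F = {\<beta>}")
    case False
    then obtain \<gamma> where \<gamma>: "\<gamma> \<in> F" "\<gamma> \<noteq> \<beta>" using less.prems(5) by blast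
    then obtain x where x: "\<beta> x \<noteq> \<gamma> x" by (metis ext)
    hence xh: "x \<in> h" using less.prems(2,5) \<gamma> by metis
    let ?f = "shift (br x) (\<gamma> x)"
    obtain N where N: "(?f ^^ N) (v \<gamma>) = 0"
      using less.prems(3)[OF \<gamma>(1)] xh by (auto simp: gws_def geig_def)
    have lin: "lin (?f ^^ N)" by (intro lin_funpow lin_shift lin_br)
    have "(\<Sum>\<delta>\<in>F - {\<gamma>}. (?f ^^ N) (v \<delta>)) = (?f ^^ N) (\<Sum>\<delta>\<in>F. v \<delta>)"
      using sum.remove[OF less.prems(1) \<gamma>(1), of "\<lambda>\<delta>. (?f ^^ N) (v \<delta>)"] N by (simp add: lin_sum[OF lin])
    hence s: "(\<Sum>\<delta>\<in>F - {\<gamma>}. (?f ^^ N) (v \<delta>)) = 0" using less.prems(4) lin_0[OF lin] by simp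
    have st: "(?f ^^ k) u \<in> gws \<delta>" if "u \<in> gws \<delta>" for k u \<delta>
      by (induction k) (use that shift_gws[OF xh] in auto)
    have "(?f ^^ N) (v \<beta>) = 0"
      by (rule less.hyps[of "F - {\<gamma>}" "\<lambda>\<delta>. (?f ^^ N) (v \<delta>)"])
        (use less.prems \<gamma> s st card_Diff1_less[of F \<gamma>] in auto)
    moreover have "u = 0" if "u \<in> gws \<beta>" "(?f ^^ k) u = 0" for k u
      using that
    proof (induction k)
      case (Suc k)
      have "(?f ^^ k) u = 0"
        by (rule shift_inj_geig[OF lin_br, of _ x "\<beta> x" "\<gamma> x"])
          (use Suc.prems st[OF Suc.prems(1), of k] xh x in \<open>auto simp: gws_def\<close>)
      thus ?case using Suc by blast
    qed simp
    ultimately show ?thesis using less.prems(3,5) by blast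
  qed (use less.prems in auto)
qed

lemma gws_cong: "(\<And>x. x \<in> h \<Longrightarrow> \<alpha> x = \<beta> x) \<Longrightarrow> gws \<alpha> = gws \<beta>"
  by (auto simp: gws_def)

sublocale G: dsum scale Basis Rt gws
proof
  show "finite Rt"
  proof (rule finite_if_independent_subspaces[of Rt gws])
    fix F and v :: "('b \<Rightarrow> complex) \<Rightarrow> 'b"
    assume F: "finite F" "F \<subseteq> Rt" "\<forall>\<beta>\<in>F. v \<beta> \<in> gws \<beta>" "(\<Sum>\<beta>\<in>F. v \<beta>) = 0"
    show "\<forall>\<beta>\<in>F. v \<beta> = 0"
    proof
      fix \<beta> assume "\<beta> \<in> F"
      thus "v \<beta> = 0" using F by (intro gws_indep[of F v]) (auto simp: Rt_def)
    qed
  qed (auto simp: Rt_def subspace_gws)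
  show "subspace (gws \<beta>)" for \<beta> by (rule subspace_gws)
  show "v \<in> span (\<Union>\<beta>\<in>Rt. gws \<beta>)" for v
  proof -
    have "(\<Union>\<beta>. UNIV \<inter> gws \<beta>) \<subseteq> span (\<Union>\<beta>\<in>Rt. gws \<beta>)"
    proof
      fix u assume "u \<in> (\<Union>\<beta>. UNIV \<inter> gws \<beta>)"
      then obtain \<beta> where "u \<in> gws \<beta>" by blast
      hence u: "u \<in> gws (\<lambda>x. if x \<in> h then \<beta> x else 0)" (is "u \<in> gws ?b")
        using gws_cong[of \<beta> ?b] by auto
      show "u \<in> span (\<Union>\<beta>\<in>Rt. gws \<beta>)"
      proof (cases "u = 0")
        case False
        hence "?b \<in> Rt" using u by (auto simp: Rt_def)
        thus ?thesis using u by (blast intro: span_base)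
      qed (simp add: span_zero)
    qed
    hence "span (\<Union>\<beta>. UNIV \<inter> gws \<beta>) \<subseteq> span (\<Union>\<beta>\<in>Rt. gws \<beta>)"
      by (rule span_minimal) simp
    moreover have "UNIV \<subseteq> span (\<Union>\<beta>. UNIV \<inter> gws \<beta>)" by (rule gws_span) auto
    ultimately show ?thesis by blast
  qed
  show "u \<beta> = 0" if "\<And>\<beta>. \<beta> \<in> Rt \<Longrightarrow> u \<beta> \<in> gws \<beta>" "(\<Sum>\<beta>\<in>Rt. u \<beta>) = 0" "\<beta> \<in> Rt" for u \<beta>
    by (rule gws_indep[OF \<open>finite Rt\<close> _ that]) (auto simp: Rt_def)
qed

text \<open>Engel's theorem for the nilpotent action of \<open>h\<close> on \<open>gws 0 / h\<close>: an ideal of \<open>h\<close> of maximal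
  dimension mapping some vector outside \<open>h\<close> into \<open>h\<close> must be all of \<open>h\<close>.\<close>
lemma gws_0: "gws 0 = h"
proof (rule ccontr)
  assume "gws 0 \<noteq> h"
  hence "\<not> gws 0 \<subseteq> h" using h_gws by blast
  define adm where "adm K \<longleftrightarrow> subspace K \<and> K \<subseteq> h \<and> (\<forall>x\<in>h. \<forall>y\<in>K. br x y \<in> K)
    \<and> (\<exists>v\<in>gws 0 - h. \<forall>y\<in>K. br y v \<in> h)" for K
  have "adm {0}"
    using \<open>\<not> gws 0 \<subseteq> h\<close> subspace_0[OF subspace_h] by (auto simp: adm_def)
  moreover have "\<forall>K. adm K \<longrightarrow> dim K < Suc (dim UNIV)"
    by (auto simp: less_Suc_eq_le intro!: dim_subset_UNIV[unfolded dimension_def])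
  ultimately obtain K where K: "adm K" "\<And>K'. adm K' \<Longrightarrow> dim K' \<le> dim K"
    using ex_has_greatest_nat[of adm "{0}" dim] by metis
  have Kh: "subspace K" "K \<subseteq> h" "\<And>x y. x \<in> h \<Longrightarrow> y \<in> K \<Longrightarrow> br x y \<in> K" using K(1) by (auto simp: adm_def)
  have "K = h"
  proof (rule ccontr)
    assume "K \<noteq> h"
    then obtain y0 where y0: "y0 \<in> h" "y0 \<notin> K" using Kh by blast
    \<comment> \<open>Otherwise every element of \<open>h\<close> outside \<open>K\<close> could be
      bracketed to another such element, giving nonzero iterated brackets of every length in the
      nilpotent \<open>h\<close>.\<close>
    have "\<exists>x\<in>h - K. \<forall>z\<in>h. br z x \<in> K"
    proof (rule ccontr)
      assume "\<not> ?thesis"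
      hence n: "\<exists>z\<in>h. br z x \<notin> K" if "x \<in> h" "x \<notin> K" for x using that by blast
      have "\<exists>xs. length xs = m \<and> set xs \<subseteq> h \<and> itbr br xs y0 \<in> h \<and> itbr br xs y0 \<notin> K" for m
      proof (induction m)
        case 0
        show ?case using y0 by simp
      next
        case (Suc m)
        then obtain xs where xs: "length xs = m" "set xs \<subseteq> h" "itbr br xs y0 \<in> h" "itbr br xs y0 \<notin> K" by blast
        obtain z where "z \<in> h" "br z (itbr br xs y0) \<notin> K" using n xs by blast
        thus ?case using xs h_br by (intro exI[of _ "z # xs"]) auto
      qed
      moreover obtain m where "\<forall>xs y. length xs = m \<and> set xs \<subseteq> h \<and> y \<in> h \<longrightarrow> itbr br xs y = 0"
        using nilp by (auto simp: nilpotent_lie_def)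
      ultimately show False using y0(1) subspace_0[OF Kh(1)] by metis
    qed
    then obtain x where x: "x \<in> h" "x \<notin> K" "\<And>z. z \<in> h \<Longrightarrow> br z x \<in> K" by blast
    define N where "N = {v \<in> gws 0. \<forall>y\<in>K. br y v \<in> h}"
    have Nst: "br x v \<in> N" if "v \<in> N" for v
    proof -
      have "br y (br x v) \<in> h" if "y \<in> K" for y
      proof -
        have "br y x \<in> K" using x(3) that Kh by blast
        hence "br (br y x) v \<in> h" using \<open>v \<in> N\<close> by (simp add: N_def)
        moreover have "br x (br y v) \<in> h" using \<open>v \<in> N\<close> that x h_br by (simp add: N_def)
        ultimately show ?thesis using leibniz[of y x v] subspace_add[OF subspace_h] by simp
      qed
      thus ?thesis using that gws_h_stable[OF x(1)] by (simp add: N_def)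
    qed
    obtain v where v: "v \<in> N" "v \<notin> h" using K(1) by (auto simp: adm_def N_def)
    have "v \<in> geig (br x) 0" using v x(1) by (auto simp: N_def gws_def)
    then obtain m where "(br x ^^ m) v = 0" by (auto simp: geig_def)
    hence ex: "\<exists>m. (br x ^^ m) v \<in> h" using subspace_0[OF subspace_h] by metis
    define m where "m = (LEAST m. (br x ^^ m) v \<in> h)"
    have m: "(br x ^^ m) v \<in> h" unfolding m_def by (rule LeastI_ex[OF ex])
    then obtain k where k: "m = Suc k" using v(2) by (cases m) auto
    let ?w = "(br x ^^ k) v"
    have "?w \<notin> h" using not_less_Least[of k "\<lambda>m. (br x ^^ m) v \<in> h"] k unfolding m_def by auto
    moreover have "?w \<in> N" by (induction k) (use v Nst in auto)
    moreover have "br x ?w \<in> h" using m k by simp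
    ultimately have w: "?w \<in> gws 0 - h" "\<And>y. y \<in> K \<Longrightarrow> br y ?w \<in> h" "br x ?w \<in> h" by (auto simp: N_def)
    let ?K = "span (insert x K)"
    have in_K: "\<exists>c. y - c *s x \<in> K" if "y \<in> ?K" for y
      using that Kh(1) by (simp add: span_breakdown_eq span_eq_iff[THEN iffD2])
    have "?K \<subseteq> h" by (rule span_minimal) (use x Kh subspace_h in auto)
    moreover have "br z y \<in> ?K" if "z \<in> h" "y \<in> ?K" for z y
    proof -
      obtain c where "y - c *s x \<in> K" using in_K[OF \<open>y \<in> ?K\<close>] by blast
      hence "br z (y - c *s x) + c *s br z x \<in> K" using x(3) Kh that(1) by (intro subspace_add subspace_scale) simp_all
      thus ?thesis by (intro span_base) (simp add: br_diff_right br_scale_right)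
    qed
    moreover have "br y ?w \<in> h" if y: "y \<in> ?K" for y
    proof -
      obtain c where "y - c *s x \<in> K" using in_K[OF y] by blast
      hence "br (y - c *s x) ?w + c *s br x ?w \<in> h"
        using w subspace_h by (intro subspace_add subspace_scale) simp_all
      thus ?thesis by (simp add: br_diff_left br_scale_left)
    qed
    ultimately have "adm ?K" using w(1) unfolding adm_def by (intro conjI ballI subspace_span bexI[OF _ w(1)]) blast+
    hence "dim ?K \<le> dim K" by (rule K(2))
    moreover have "K \<subset> ?K"
      using x(2) span_superset[of "insert x K"] by auto
    hence "dim K < dim ?K" using dim_psubset[of K ?K] Kh(1) by (simp add: span_eq_iff[THEN iffD2] del: dim_span)
    ultimately show False by simp
  qed
  then obtain v where "v \<in> gws 0 - h" "\<forall>y\<in>h. br y v \<in> h" using K(1) by (auto simp: adm_def)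
  thus False using h_normalizer by blast
qed

end

subsection \<open>Cartan subalgebras are toral\<close>

lemma (in dsum) prj_commute:
  assumes "lin f" "\<And>i x. i \<in> I \<Longrightarrow> x \<in> W i \<Longrightarrow> f x \<in> W i"
  shows "prj i (f x) = f (prj i x)"
proof (rule eq_on_W[of "\<lambda>x. prj i (f x)" "\<lambda>x. f (prj i x)"])
  show "prj i (f x) = f (prj i x)" if "j \<in> I" "x \<in> W j" for j x
    using prj_W[OF that] prj_W[OF that(1) assms(2)[OF that]] lin_0[OF assms(1)] by simp
qed (rule lin_fun_comp[OF lin_prj assms(1)], rule lin_fun_comp[OF assms(1) lin_prj])

context lie_cartan
begin

text \<open>Together with \<open>nilp_part\<close> this is the Jordan decomposition of
  \<open>br x\<close> for \<open>x\<close> in \<open>h\<close>.\<close>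

definition ss_part :: "'b \<Rightarrow> 'b \<Rightarrow> 'b" where
  "ss_part x u = (\<Sum>\<beta>\<in>Rt. \<beta> x *s G.prj \<beta> u)"

definition nilp_part :: "'b \<Rightarrow> 'b \<Rightarrow> 'b" where
  "nilp_part x u = br x u - ss_part x u"

lemma lin_ss_part: "lin (ss_part x)"
  unfolding ss_part_def by (intro lin_fun_sum lin_fun_scale G.lin_prj)

lemma lin_nilp_part: "lin (nilp_part x)"
  unfolding nilp_part_def by (intro lin_fun_diff lin_br lin_ss_part)

lemma ss_part_gws: "\<beta> \<in> Rt \<Longrightarrow> u \<in> gws \<beta> \<Longrightarrow> ss_part x u = \<beta> x *s u"
proof -
  assume "\<beta> \<in> Rt" "u \<in> gws \<beta>"
  hence "ss_part x u = (\<Sum>\<gamma>\<in>Rt. if \<gamma> = \<beta> then \<beta> x *s u else 0)"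
    unfolding ss_part_def by (intro sum.cong) (auto simp: G.prj_W)
  thus ?thesis using G.finite_I \<open>\<beta> \<in> Rt\<close> by simp
qed

lemma nilp_part_gws: "\<beta> \<in> Rt \<Longrightarrow> u \<in> gws \<beta> \<Longrightarrow> nilp_part x u = shift (br x) (\<beta> x) u"
  by (simp add: nilp_part_def shift_def ss_part_gws)

lemma nilp_part_in_gws: "x \<in> h \<Longrightarrow> \<beta> \<in> Rt \<Longrightarrow> u \<in> gws \<beta> \<Longrightarrow> nilp_part x u \<in> gws \<beta>"
  by (simp add: nilp_part_gws shift_gws)

lemma nilp_part_nilpotent:
  assumes "x \<in> h"
  shows "\<exists>m. (nilp_part x ^^ m) u = 0"
proof -
  have "(\<Union>\<beta>\<in>Rt. gws \<beta>) \<subseteq> geig (nilp_part x) 0"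
  proof
    fix w assume "w \<in> (\<Union>\<beta>\<in>Rt. gws \<beta>)"
    then obtain \<beta> where b: "\<beta> \<in> Rt" "w \<in> gws \<beta>" by blast
    have "(nilp_part x ^^ k) w = (shift (br x) (\<beta> x) ^^ k) w \<and> (nilp_part x ^^ k) w \<in> gws \<beta>" for k
      by (induction k) (use b nilp_part_gws nilp_part_in_gws[OF assms] in auto)
    moreover obtain m where "(shift (br x) (\<beta> x) ^^ m) w = 0"
      using b(2) assms by (auto simp: gws_def geig_def)
    ultimately show "w \<in> geig (nilp_part x) 0" by (auto simp: geig_def)
  qed
  hence "span (\<Union>\<beta>\<in>Rt. gws \<beta>) \<subseteq> geig (nilp_part x) 0"
    by (rule span_minimal) (rule subspace_geig[OF lin_nilp_part])
  thus ?thesis using G.span_W[of u] by (auto simp: geig_def)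
qed

lemma prj_ad: "x \<in> h \<Longrightarrow> G.prj \<beta> (br x u) = br x (G.prj \<beta> u)"
  by (rule G.prj_commute[OF lin_br]) (rule gws_h_stable)

lemma prj_nilp_part: "x \<in> h \<Longrightarrow> G.prj \<beta> (nilp_part x u) = nilp_part x (G.prj \<beta> u)"
  by (rule G.prj_commute[OF lin_nilp_part]) (rule nilp_part_in_gws)

lemma prj_ss_part: "\<beta> \<in> Rt \<Longrightarrow> G.prj \<beta> (ss_part x u) = \<beta> x *s G.prj \<beta> u"
proof -
  assume b: "\<beta> \<in> Rt"
  have "G.prj \<beta> (ss_part x u) = ss_part x (G.prj \<beta> u)"
    by (rule G.prj_commute[OF lin_ss_part]) (simp add: ss_part_gws subspace_scale subspace_gws)
  thus ?thesis using ss_part_gws[OF b G.prj_in[OF b]] by simp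
qed

text \<open>On \<open>gws \<beta>\<close> the map \<open>br x\<close> is the scalar
  \<open>\<beta> x\<close> plus a nilpotent map. Reading \<open>\<beta> x\<close> off a trace is
  what yields additivity, homogeneity and vanishing on brackets below.\<close>

lemma tr_prj_ad:
  assumes "x \<in> h" "\<beta> \<in> Rt"
  shows "tr (\<lambda>u. G.prj \<beta> (br x u)) = \<beta> x * of_nat (dim (gws \<beta>))"
proof -
  have "G.prj \<beta> (br x u) = nilp_part x (G.prj \<beta> u) + \<beta> x *s G.prj \<beta> u" for u
  proof -
    have "br x u = nilp_part x u + ss_part x u" by (simp add: nilp_part_def)
    thus ?thesis by (simp add: lin_add[OF G.lin_prj] prj_nilp_part prj_ss_part assms)
  qed
  moreover have "tr (\<lambda>u. nilp_part x (G.prj \<beta> u)) = 0"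
    by (rule tr_nilpotent_comp[OF lin_nilp_part G.lin_prj prj_nilp_part[OF assms(1), symmetric] nilp_part_nilpotent[OF assms(1)]])
  ultimately show ?thesis by (simp add: tr_add tr_scale G.tr_prj[OF assms(2)])
qed

lemma gws_nontrivial: "\<beta> \<in> Rt \<Longrightarrow> \<not> gws \<beta> \<subseteq> {0}"
  by (auto simp: Rt_def)

lemma root_add:
  assumes "x \<in> h" "y \<in> h" "\<beta> \<in> Rt"
  shows "\<beta> (x + y) = \<beta> x + \<beta> y"
proof -
  have "x + y \<in> h" using assms subspace_h by (intro subspace_add)
  hence "\<beta> (x + y) * of_nat (dim (gws \<beta>)) = \<beta> x * of_nat (dim (gws \<beta>)) + \<beta> y * of_nat (dim (gws \<beta>))"
    using assms by (simp add: tr_prj_ad[symmetric] br_add_left lin_add[OF G.lin_prj] tr_add)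
  hence "(\<beta> (x + y) - (\<beta> x + \<beta> y)) * of_nat (dim (gws \<beta>)) = 0" by (simp add: algebra_simps)
  thus ?thesis using gws_nontrivial[OF assms(3)] by simp
qed

lemma root_scale:
  assumes "x \<in> h" "\<beta> \<in> Rt"
  shows "\<beta> (c *s x) = c * \<beta> x"
proof -
  have "c *s x \<in> h" using assms subspace_h by (intro subspace_scale)
  hence "\<beta> (c *s x) * of_nat (dim (gws \<beta>)) = c * (\<beta> x * of_nat (dim (gws \<beta>)))"
    using assms by (simp add: tr_prj_ad[symmetric] br_scale_left lin_scale[OF G.lin_prj] tr_scale)
  thus ?thesis using gws_nontrivial[OF assms(2)] by simp
qed

lemma root_br:
  assumes "x \<in> h" "y \<in> h" "\<beta> \<in> Rt"
  shows "\<beta> (br x y) = 0"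
proof -
  have "tr (\<lambda>u. br x (G.prj \<beta> (br y u))) = tr (\<lambda>u. G.prj \<beta> (br y (br x u)))"
    by (rule tr_comm[OF lin_br lin_fun_comp[OF G.lin_prj lin_br]])
  hence "tr (\<lambda>u. G.prj \<beta> (br (br x y) u)) = 0"
    by (simp add: br_br lin_diff[OF G.lin_prj] tr_diff prj_ad assms)
  thus ?thesis using tr_prj_ad[OF h_br[OF assms(1,2)] assms(3)] gws_nontrivial[OF assms(3)] by simp
qed

lemma kf_h_square:
  assumes "x \<in> h"
  shows "kf x x = (\<Sum>\<beta>\<in>Rt. of_nat (dim (gws \<beta>)) * \<beta> x * \<beta> x)"
proof -
  have comm: "ss_part x (br x u) = br x (ss_part x u)" for u
    by (simp add: ss_part_def br_sum_right br_scale_right prj_ad assms)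
  have "br x (br x u) = nilp_part x (br x u) + ss_part x (br x u)" for u by (simp add: nilp_part_def)
  hence "kf x x = tr (\<lambda>u. nilp_part x (br x u)) + tr (\<lambda>u. ss_part x (br x u))"
    by (simp add: kf_def flip: tr_add)
  also have "tr (\<lambda>u. nilp_part x (br x u)) = 0"
    by (rule tr_nilpotent_comp[OF lin_nilp_part lin_br])
      (simp_all add: nilp_part_nilpotent assms nilp_part_def comm br_diff_right)
  also have "tr (\<lambda>u. ss_part x (br x u)) = (\<Sum>\<beta>\<in>Rt. \<beta> x * (\<beta> x * of_nat (dim (gws \<beta>))))"
    by (simp add: ss_part_def tr_sum tr_scale tr_prj_ad assms)
  finally show ?thesis by (simp add: mult_ac)
qed

text \<open>Polarization of the square case. The trace argument for squares involves a single
  element of \<open>h\<close>, so commutativity of \<open>h\<close>, which is later deduced with the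
  help of this formula, is not presupposed.\<close>

lemma kf_h:
  assumes "x \<in> h" "y \<in> h"
  shows "kf x y = (\<Sum>\<beta>\<in>Rt. of_nat (dim (gws \<beta>)) * \<beta> x * \<beta> y)"
proof -
  have "x + y \<in> h" using assms subspace_h by (intro subspace_add)
  have "2 * kf x y = kf (x + y) (x + y) - kf x x - kf y y"
    using kf_sym[of x y] by (simp add: kf_add_left kf_add_right)
  also have "\<dots> = (\<Sum>\<beta>\<in>Rt. of_nat (dim (gws \<beta>)) * \<beta> (x + y) * \<beta> (x + y)
      - of_nat (dim (gws \<beta>)) * \<beta> x * \<beta> x - of_nat (dim (gws \<beta>)) * \<beta> y * \<beta> y)"
    by (simp add: kf_h_square assms \<open>x + y \<in> h\<close> sum_subtractf)
  also have "\<dots> = (\<Sum>\<beta>\<in>Rt. 2 * (of_nat (dim (gws \<beta>)) * \<beta> x * \<beta> y))"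
    by (rule sum.cong) (simp_all add: root_add[OF assms] algebra_simps)
  finally show ?thesis by (simp add: sum_distrib_left[symmetric])
qed

lemma Rt_I: "(\<And>x. x \<notin> h \<Longrightarrow> \<beta> x = 0) \<Longrightarrow> v \<in> gws \<beta> \<Longrightarrow> v \<noteq> 0 \<Longrightarrow> \<beta> \<in> Rt"
  by (auto simp: Rt_def)

lemma Rt_outside: "\<beta> \<in> Rt \<Longrightarrow> x \<notin> h \<Longrightarrow> \<beta> x = 0"
  by (simp add: Rt_def)

text \<open>The commutator \<open>br u v\<close> has trace zero on the \<open>\<alpha>\<close>-string through \<open>\<beta>\<close>.\<close>
lemma root_string_ratio:
  assumes \<alpha>: "\<alpha> \<in> Rt" and \<beta>: "\<beta> \<in> Rt" and u: "u \<in> gws \<alpha>" and v: "v \<in> gws (- \<alpha>)"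
  shows "\<exists>r::real. \<beta> (br u v) = of_real r * \<alpha> (br u v)"
proof -
  define H where "H = br u v"
  have H: "H \<in> h" using gws_br[OF u v] gws_0 by (simp add: H_def)
  define T where "T = {\<gamma> \<in> Rt. \<exists>i::int. \<gamma> = (\<lambda>x. \<beta> x + of_int i * \<alpha> x)}"
  have finT: "finite T" using G.finite_I by (simp add: T_def)
  define P where "P w = (\<Sum>\<gamma>\<in>T. G.prj \<gamma> w)" for w
  have linP: "lin P" unfolding P_def by (intro lin_fun_sum G.lin_prj)
  have P_gws: "P w = (if \<gamma> \<in> T then w else 0)" if "\<gamma> \<in> Rt" "w \<in> gws \<gamma>" for \<gamma> w
    using that finT by (simp add: P_def G.prj_W)
  have PT: "P (br z w) = br z (P w)" if z: "z \<in> gws (\<lambda>x. of_int k * \<alpha> x)" for z k w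
  proof (rule G.eq_on_W[of "\<lambda>w. P (br z w)" "\<lambda>w. br z (P w)"])
    fix \<gamma> w assume w: "\<gamma> \<in> Rt" "w \<in> gws \<gamma>"
    show "P (br z w) = br z (P w)"
    proof (cases "br z w = 0")
      case True
      thus ?thesis using P_gws[OF w] lin_0[OF linP] by simp
    next
      case False
      let ?g = "(\<lambda>x. of_int k * \<alpha> x) + \<gamma>"
      have zw: "br z w \<in> gws ?g" by (rule gws_br[OF z w(2)])
      hence g: "?g \<in> Rt" using False w(1) \<alpha> by (intro Rt_I[of _ "br z w"]) (auto simp: Rt_outside)
      have "?g \<in> T \<longleftrightarrow> \<gamma> \<in> T"
      proof
        assume "?g \<in> T"
        then obtain i :: int where "?g = (\<lambda>x. \<beta> x + of_int i * \<alpha> x)" by (auto simp: T_def)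
        hence "\<gamma> x = \<beta> x + of_int (i - k) * \<alpha> x" for x by (auto simp: fun_eq_iff algebra_simps)
        hence "\<gamma> = (\<lambda>x. \<beta> x + of_int (i - k) * \<alpha> x)" by blast
        thus "\<gamma> \<in> T" using w(1) unfolding T_def by blast
      next
        assume "\<gamma> \<in> T"
        then obtain i :: int where "\<gamma> = (\<lambda>x. \<beta> x + of_int i * \<alpha> x)" by (auto simp: T_def)
        hence "?g = (\<lambda>x. \<beta> x + of_int (i + k) * \<alpha> x)" by (auto simp: fun_eq_iff algebra_simps)
        thus "?g \<in> T" using g unfolding T_def by blast
      qed
      thus ?thesis using P_gws[OF w] P_gws[OF g zw] by simp
    qed
  qed (rule lin_fun_comp[OF linP lin_br], rule lin_fun_comp[OF lin_br linP])
  have Pu: "P (br u w) = br u (P w)" for w using PT[of u 1] u by simp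
  have Pv: "P (br v w) = br v (P w)" for w 
  proof (rule PT[of v "-1"])
    have "- \<alpha> = (\<lambda>x. of_int (- 1) * \<alpha> x)" by (simp add: fun_eq_iff)
    thus "v \<in> gws (\<lambda>x. of_int (- 1) * \<alpha> x)" using v by simp
  qed
  have "tr (\<lambda>w. br u (P (br v w))) = tr (\<lambda>w. P (br v (br u w)))"
    by (rule tr_comm[OF lin_br lin_fun_comp[OF linP lin_br]])
  hence "tr (\<lambda>w. P (br H w)) = 0"
    by (simp add: H_def br_br lin_diff[OF linP] tr_diff Pu)
  moreover have "tr (\<lambda>w. P (br H w)) = (\<Sum>\<gamma>\<in>T. \<gamma> H * of_nat (dim (gws \<gamma>)))"
    by (simp add: P_def tr_sum) (rule sum.cong, auto simp: T_def tr_prj_ad H)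
  ultimately have 0: "(\<Sum>\<gamma>\<in>T. \<gamma> H * of_nat (dim (gws \<gamma>))) = 0" by simp
  obtain i :: "_ \<Rightarrow> int" where i: "\<And>\<gamma>. \<gamma> \<in> T \<Longrightarrow> \<gamma> = (\<lambda>x. \<beta> x + of_int (i \<gamma>) * \<alpha> x)"
  proof -
    have "\<forall>\<gamma>\<in>T. \<exists>i::int. \<gamma> = (\<lambda>x. \<beta> x + of_int i * \<alpha> x)" by (simp add: T_def)
    from bchoice[OF this] show ?thesis using that by blast
  qed
  have "\<gamma> H = \<beta> H + of_int (i \<gamma>) * \<alpha> H" if "\<gamma> \<in> T" for \<gamma> using i[OF that] by metis
  hence "(\<Sum>\<gamma>\<in>T. (\<beta> H + of_int (i \<gamma>) * \<alpha> H) * of_nat (dim (gws \<gamma>))) = 0" using 0 by simp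
  hence "\<beta> H * of_nat (\<Sum>\<gamma>\<in>T. dim (gws \<gamma>)) + \<alpha> H * of_int (\<Sum>\<gamma>\<in>T. i \<gamma> * int (dim (gws \<gamma>))) = 0"
    by (simp add: distrib_right sum.distrib) (simp add: sum_distrib_left mult_ac)
  moreover define a where "a = (\<Sum>\<gamma>\<in>T. dim (gws \<gamma>))"
  moreover define b where "b = (\<Sum>\<gamma>\<in>T. i \<gamma> * int (dim (gws \<gamma>)))"
  ultimately have ab: "\<beta> H * of_nat a + \<alpha> H * of_int b = 0" by simp
  have "\<beta> \<in> T" using \<beta> unfolding T_def by (auto intro!: exI[of _ 0])
  hence "a \<noteq> 0" using finT gws_nontrivial[OF \<beta>] by (auto simp: a_def)
  hence "\<beta> H = of_real (- (of_int b / of_nat a)) * \<alpha> H"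
    using ab by (simp add: field_simps eq_neg_iff_add_eq_0)
  thus ?thesis unfolding H_def by blast
qed

text \<open>A simple algebra is spanned by brackets, and only brackets of opposite generalized
  weight spaces contribute to the component in \<open>gws 0\<close>, which is
  \<open>h\<close>.\<close>

lemma h_span:
  assumes "x \<in> h"
  shows "x \<in> span {br u v | u v \<alpha>. \<alpha> \<in> Rt \<and> u \<in> gws \<alpha> \<and> v \<in> gws (- \<alpha>)}" (is "x \<in> span ?S")
proof (cases "x = 0")
  case False
  have 0: "0 \<in> Rt" using assms h_gws False by (intro Rt_I[of _ x]) auto
  have brS: "G.prj 0 (br u v) \<in> span ?S" if uv: "\<alpha> \<in> Rt" "u \<in> gws \<alpha>" "\<beta> \<in> Rt" "v \<in> gws \<beta>" for u v \<alpha> \<beta>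
  proof (cases "br u v = 0")
    case True
    thus ?thesis by (simp add: lin_0[OF G.lin_prj] span_zero)
  next
    case False
    have uv': "br u v \<in> gws (\<alpha> + \<beta>)" by (rule gws_br[OF uv(2,4)])
    hence ab: "\<alpha> + \<beta> \<in> Rt" using False uv by (intro Rt_I[of _ "br u v"]) (auto simp: Rt_outside)
    show ?thesis
    proof (cases "\<alpha> + \<beta> = 0")
      case True
      hence "\<beta> = - \<alpha>" by (simp add: eq_neg_iff_add_eq_0 add.commute)
      hence "br u v \<in> ?S" using uv by blast
      thus ?thesis using G.prj_W[OF ab uv'] True by (auto intro: span_base)
    next
      case False
      thus ?thesis using G.prj_W[OF ab uv', of 0] by (auto simp: span_zero)
    qed
  qed
  have "G.prj 0 (br a b) \<in> span ?S" for a b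
  proof -
    have "br a b = br (\<Sum>\<alpha>\<in>Rt. G.prj \<alpha> a) (\<Sum>\<beta>\<in>Rt. G.prj \<beta> b)" by (simp add: G.sum_prj)
    also have "\<dots> = (\<Sum>\<alpha>\<in>Rt. \<Sum>\<beta>\<in>Rt. br (G.prj \<alpha> a) (G.prj \<beta> b))"
      by (simp only: br_sum_left br_sum_right) (rule sum.swap)
    finally have "G.prj 0 (br a b) = (\<Sum>\<alpha>\<in>Rt. \<Sum>\<beta>\<in>Rt. G.prj 0 (br (G.prj \<alpha> a) (G.prj \<beta> b)))"
      by (simp add: lin_sum[OF G.lin_prj])
    thus ?thesis using brS G.prj_in by (auto intro!: span_sum)
  qed
  hence "span {br a b | a b. True} \<subseteq> {y. G.prj 0 y \<in> span ?S}"
    by (intro span_minimal lin_subspace_vimage G.lin_prj subspace_span) auto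
  hence "G.prj 0 x \<in> span ?S" using brackets_span[of x] by blast
  moreover have "G.prj 0 x = x" using G.prj_W[OF 0, of x 0] assms h_gws by auto
  ultimately show ?thesis by simp
qed (simp add: span_zero)

text \<open>Killing's argument: all roots take real multiples of \<open>\<alpha> H\<close> at \<open>H = br u v\<close>, so \<open>kf H H\<close> is
  \<open>(\<alpha> H)\<^sup>2\<close> times a positive number.\<close>
lemma kf_not_zero: "\<not> (\<forall>x y. kf x y = 0)"
proof
  assume kf0: "\<forall>x y. kf x y = 0"
  have gen0: "\<beta> (br u v) = 0"
    if \<alpha>: "\<alpha> \<in> Rt" and \<beta>: "\<beta> \<in> Rt" and u: "u \<in> gws \<alpha>" and v: "v \<in> gws (- \<alpha>)" for \<alpha> \<beta> u v
  proof -
    let ?H = "br u v"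
    have H: "?H \<in> h" using gws_br[OF u v] gws_0 by simp
    obtain r :: "_ \<Rightarrow> real" where r: "\<And>\<gamma>. \<gamma> \<in> Rt \<Longrightarrow> \<gamma> ?H = of_real (r \<gamma>) * \<alpha> ?H"
      using root_string_ratio[OF \<alpha> _ u v] by metis
    have "\<alpha> ?H = 0"
    proof (rule ccontr)
      assume a: "\<alpha> ?H \<noteq> 0"
      have "of_real (r \<alpha>) = (1 :: complex)" using r[OF \<alpha>] a by simp
      hence r1: "r \<alpha> = 1" by simp
      have "0 = (\<Sum>\<gamma>\<in>Rt. of_nat (dim (gws \<gamma>)) * \<gamma> ?H * \<gamma> ?H)"
        using kf_h_square[OF H] kf0 by simp
      also have "\<dots> = (\<Sum>\<gamma>\<in>Rt. of_real (real (dim (gws \<gamma>)) * (r \<gamma>)\<^sup>2) * (\<alpha> ?H)\<^sup>2)"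
        by (rule sum.cong) (simp_all add: r power2_eq_square mult_ac)
      also have "\<dots> = of_real (\<Sum>\<gamma>\<in>Rt. real (dim (gws \<gamma>)) * (r \<gamma>)\<^sup>2) * (\<alpha> ?H)\<^sup>2"
        by (simp add: sum_distrib_right)
      finally have "(of_real (\<Sum>\<gamma>\<in>Rt. real (dim (gws \<gamma>)) * (r \<gamma>)\<^sup>2) :: complex) = 0" using a by simp
      hence s0: "(\<Sum>\<gamma>\<in>Rt. real (dim (gws \<gamma>)) * (r \<gamma>)\<^sup>2) = 0" by (simp only: of_real_eq_0_iff)
      have "real (dim (gws \<alpha>)) * (r \<alpha>)\<^sup>2 \<le> (\<Sum>\<gamma>\<in>Rt. real (dim (gws \<gamma>)) * (r \<gamma>)\<^sup>2)"
        by (rule member_le_sum[OF \<alpha>]) (simp_all add: G.finite_I)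
      thus False using s0 r1 gws_nontrivial[OF \<alpha>] by simp
    qed
    thus ?thesis using r[OF \<beta>] by simp
  qed
  have "\<beta> x = 0" if \<beta>: "\<beta> \<in> Rt" and x: "x \<in> h" for \<beta> x
  proof -
    have "x \<in> h \<and> \<beta> x = 0"
      using h_span[OF x]
    proof (induction rule: span_induct_alt)
      case base
      show ?case using subspace_0[OF subspace_h] root_scale[OF subspace_0[OF subspace_h] \<beta>, of 0] by simp
    next
      case (step c s y)
      then obtain u v \<alpha> where s: "s = br u v" "\<alpha> \<in> Rt" "u \<in> gws \<alpha>" "v \<in> gws (- \<alpha>)" by blast
      have "s \<in> h" using gws_br[OF s(3,4)] s(1) gws_0 by simp
      moreover from this have "c *s s \<in> h" by (rule subspace_scale[OF subspace_h])
      moreover have "\<beta> s = 0" using gen0[OF s(2) \<beta> s(3,4)] s(1) by simp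
      ultimately show ?case using step subspace_h \<beta>
        by (simp add: root_add root_scale subspace_add)
    qed
    thus ?thesis ..
  qed
  hence "\<beta> x = 0" if "\<beta> \<in> Rt" for \<beta> x using Rt_outside[OF that] that by (cases "x \<in> h") auto
  \<comment> \<open>With 0 as the only possible weight the whole algebra is \<open>gws 0\<close>,
    that is, the nilpotent \<open>h\<close>.\<close>
  hence "Rt \<subseteq> {0}" by (auto simp: fun_eq_iff)
  hence "span (\<Union>\<beta>\<in>Rt. gws \<beta>) \<subseteq> gws 0" by (intro span_minimal subspace_gws) auto
  hence "h = UNIV" using G.span_W gws_0 by blast
  thus False using nilp not_nilpotent by simp
qed

theorem kf_nondegenerate: "(\<And>y. kf x y = 0) \<Longrightarrow> x = 0"
  using kf_radical kf_not_zero by blast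

lemma kf_gws:
  assumes "\<alpha> \<in> Rt" "\<beta> \<in> Rt" "u \<in> gws \<alpha>" "v \<in> gws \<beta>" "\<alpha> + \<beta> \<noteq> 0"
  shows "kf u v = 0"
  unfolding kf_def
proof (rule G.tr_off_diagonal)
  show "lin (\<lambda>w. br u (br v w))" by (rule lin_fun_comp[OF lin_br lin_br])
  fix \<gamma> w assume w: "\<gamma> \<in> Rt" "w \<in> gws \<gamma>"
  show "G.prj \<gamma> (br u (br v w)) = 0"
  proof (cases "br u (br v w) = 0")
    case False
    have in': "br u (br v w) \<in> gws (\<alpha> + (\<beta> + \<gamma>))" by (intro gws_br assms w)
    hence "\<alpha> + (\<beta> + \<gamma>) \<in> Rt"
      using False assms w by (intro Rt_I[of _ "br u (br v w)"]) (auto simp: Rt_outside)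
    moreover have "\<gamma> \<noteq> \<alpha> + (\<beta> + \<gamma>)" using assms(5) by (simp add: add.assoc[symmetric])
    ultimately show ?thesis using G.prj_W[OF _ in', of \<gamma>] by simp
  qed (simp add: lin_0[OF G.lin_prj])
qed

text \<open>Such an \<open>x\<close> is orthogonal to \<open>h\<close> by the trace formula and to
  the other generalized weight spaces by their weights, so nondegeneracy applies.\<close>

lemma roots_separate:
  assumes "x \<in> h" "\<And>\<beta>. \<beta> \<in> Rt \<Longrightarrow> \<beta> x = 0"
  shows "x = 0"
proof (rule ccontr)
  assume "x \<noteq> 0"
  hence 0: "0 \<in> Rt" using assms h_gws by (intro Rt_I[of _ x]) auto
  have "kf x (G.prj \<beta> y) = 0" if "\<beta> \<in> Rt" for y \<beta>
  proof (cases "\<beta> = 0")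
    case True
    hence "G.prj \<beta> y \<in> h" using G.prj_in[OF that] gws_0 by auto
    hence "kf x (G.prj \<beta> y) = (\<Sum>\<gamma>\<in>Rt. of_nat (dim (gws \<gamma>)) * \<gamma> x * \<gamma> (G.prj \<beta> y))"
      by (rule kf_h[OF assms(1)])
    also have "\<dots> = 0" by (rule sum.neutral) (simp add: assms(2))
    finally show ?thesis .
  next
    case False
    thus ?thesis using kf_gws[OF 0 that] G.prj_in[OF that] assms(1) h_gws by auto
  qed
  hence "kf x (\<Sum>\<beta>\<in>Rt. G.prj \<beta> y) = 0" for y by (simp add: kf_sum_right)
  hence "x = 0" by (intro kf_nondegenerate) (simp add: G.sum_prj)
  thus False using \<open>x \<noteq> 0\<close> by blast
qed

theorem cartan_abelian: "x \<in> h \<Longrightarrow> y \<in> h \<Longrightarrow> br x y = 0"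
  by (rule roots_separate) (simp_all add: h_br root_br)

text \<open>\<open>ss_part x\<close> multiplies \<open>gws \<beta>\<close> by
  \<open>\<beta> x\<close>, and weights add under brackets, so it is a derivation; hence so is its
  difference from \<open>br x\<close>.\<close>

lemma nilp_part_derivation:
  assumes "x \<in> h"
  shows "nilp_part x (br a b) = br (nilp_part x a) b + br a (nilp_part x b)"
proof -
  have gg: "ss_part x (br u v) = br (ss_part x u) v + br u (ss_part x v)"
    if uv: "\<alpha> \<in> Rt" "u \<in> gws \<alpha>" "\<beta> \<in> Rt" "v \<in> gws \<beta>" for \<alpha> \<beta> u v
  proof (cases "br u v = 0")
    case True
    thus ?thesis using ss_part_gws uv by (simp add: lin_0[OF lin_ss_part] br_scale_left br_scale_right)
  next
    case False
    have uv': "br u v \<in> gws (\<alpha> + \<beta>)" by (rule gws_br[OF uv(2,4)])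
    hence ab: "\<alpha> + \<beta> \<in> Rt" using False uv by (intro Rt_I[of _ "br u v"]) (auto simp: Rt_outside)
    show ?thesis using ss_part_gws[OF ab uv'] ss_part_gws uv
      by (simp add: br_scale_left br_scale_right scale_left_distrib)
  qed
  have "ss_part x (br u b) = br (ss_part x u) b + br u (ss_part x b)" if "\<alpha> \<in> Rt" "u \<in> gws \<alpha>" for \<alpha> u b
    by (rule G.eq_on_W[OF lin_fun_comp[OF lin_ss_part lin_br] lin_fun_add[OF lin_br lin_fun_comp[OF lin_br lin_ss_part]] gg[OF that]])
  hence "ss_part x (br a b) = br (ss_part x a) b + br a (ss_part x b)"
    by (rule G.eq_on_W[OF lin_fun_comp[OF lin_ss_part lin_br_right] lin_fun_add[OF lin_fun_comp[OF lin_br_right lin_ss_part] lin_br_right]])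
  thus ?thesis by (simp add: nilp_part_def leibniz[of x a b] br_diff_left br_diff_right)
qed

text \<open>The nilpotent part of \<open>ad x\<close> is a derivation that is trace-orthogonal to all \<open>ad y\<close>;
  this forces it to vanish, without using that derivations are inner.\<close>
lemma nilp_part_zero:
  assumes x: "x \<in> h"
  shows "nilp_part x a = 0"
proof -
  have tr0: "tr (\<lambda>u. nilp_part x (br y u)) = 0" for y
  proof -
    have gen: "tr (\<lambda>u. nilp_part x (br y u)) = 0" if y: "\<alpha> \<in> Rt" "y \<in> gws \<alpha>" for \<alpha> y
    proof (cases "\<alpha> = 0")
      case True
      hence yh: "y \<in> h" using y gws_0 by simp
      have "nilp_part x y = 0" using nilp_part_gws[OF y] True cartan_abelian[OF x yh] by simp
      hence "nilp_part x (br y u) = br y (nilp_part x u)" for u using nilp_part_derivation[OF x, of y u] by simp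
      thus ?thesis by (rule tr_nilpotent_comp[OF lin_nilp_part lin_br _ nilp_part_nilpotent[OF x]])
    next
      case False
      show ?thesis
      proof (rule G.tr_off_diagonal)
        show "lin (\<lambda>w. nilp_part x (br y w))" by (rule lin_fun_comp[OF lin_nilp_part lin_br])
        fix \<gamma> w assume w: "\<gamma> \<in> Rt" "w \<in> gws \<gamma>"
        show "G.prj \<gamma> (nilp_part x (br y w)) = 0"
        proof (cases "br y w = 0")
          case nz: False
          have in': "br y w \<in> gws (\<alpha> + \<gamma>)" by (intro gws_br y w)
          hence ag: "\<alpha> + \<gamma> \<in> Rt" using nz y w by (intro Rt_I[of _ "br y w"]) (auto simp: Rt_outside)
          show ?thesis using G.prj_W[OF ag nilp_part_in_gws[OF x ag in'], of \<gamma>] False by simp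
        qed (simp add: lin_0[OF G.lin_prj] lin_0[OF lin_nilp_part])
      qed
    qed
    have "nilp_part x (br y u) = (\<Sum>\<alpha>\<in>Rt. nilp_part x (br (G.prj \<alpha> y) u))" for u
      by (simp add: lin_sum[OF lin_nilp_part, symmetric] br_sum_left[symmetric] G.sum_prj)
    thus ?thesis using gen G.prj_in by (simp add: tr_sum)
  qed
  have "kf (nilp_part x a) b = 0" for b
  proof -
    \<comment> \<open>For a derivation, bracketing with \<open>nilp_part x a\<close> is the
      commutator of \<open>nilp_part x\<close> with \<open>br a\<close>. Cyclicity then leaves the
      trace of \<open>nilp_part x\<close> composed with bracketing by \<open>br a b\<close>.\<close>
    have "br (nilp_part x a) u = nilp_part x (br a u) - br a (nilp_part x u)" for u using nilp_part_derivation[OF x, of a u] by simp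
    hence "kf (nilp_part x a) b = tr (\<lambda>u. nilp_part x (br a (br b u))) - tr (\<lambda>u. br a (nilp_part x (br b u)))"
      by (simp add: kf_def tr_diff)
    also have "tr (\<lambda>u. br a (nilp_part x (br b u))) = tr (\<lambda>u. nilp_part x (br b (br a u)))"
      by (rule tr_comm[OF lin_br lin_fun_comp[OF lin_nilp_part lin_br]])
    finally show ?thesis using tr0[of "br a b"] by (simp add: br_br lin_diff[OF lin_nilp_part] tr_diff)
  qed
  thus ?thesis by (rule kf_nondegenerate)
qed

theorem cartan_diagonal: "v \<in> span {u. \<exists>\<beta>. \<forall>x\<in>h. br x u = \<beta> x *s u}"
proof -
  have "br x u = \<beta> x *s u" if "\<beta> \<in> Rt" "u \<in> gws \<beta>" "x \<in> h" for \<beta> u x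
    using nilp_part_zero[OF that(3), of u] ss_part_gws[OF that(1,2)] by (simp add: nilp_part_def)
  hence "(\<Union>\<beta>\<in>Rt. gws \<beta>) \<subseteq> {u. \<exists>\<beta>. \<forall>x\<in>h. br x u = \<beta> x *s u}" by blast
  thus ?thesis using G.span_W span_mono by blast
qed

end

subsection \<open>Weights of a graded simple Lie algebra\<close>

lemma nat_mod_add_cancel: "(a + r) mod n = r mod n \<longleftrightarrow> a mod n = 0" for a r n :: nat
  using mod_eq_dvd_iff_nat[of r "a + r" n] by (auto simp: mod_eq_0_iff_dvd)

text \<open>From here on weights refer to the smaller \<open>h0\<close>, which inherits
  commutativity and the diagonal action from \<open>h\<close>.\<close>

locale graded_lie = lie_cartan scale Basis br h
  for scale :: "complex \<Rightarrow> 'b \<Rightarrow> 'b::ab_group_add" (infixr "*s" 75) and Basis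
    and br :: "'b \<Rightarrow> 'b \<Rightarrow> 'b" and h +
  fixes n :: nat and gr :: "nat \<Rightarrow> 'b set" and h0 :: "'b set"
  assumes grading: "zn_grading scale br n gr"
    and h0_def: "h0 = h \<inter> gr 0"
    and cartan0: "cartan_subalg scale br (gr 0) h0"
begin

lemma n_pos: "0 < n"
  and subspace_gr: "j < n \<Longrightarrow> subspace (gr j)"
  and gr_br: "i < n \<Longrightarrow> j < n \<Longrightarrow> x \<in> gr i \<Longrightarrow> y \<in> gr j \<Longrightarrow> br x y \<in> gr ((i + j) mod n)"
  using grading by (auto simp: zn_grading_def)

lemma gr_decomp: "\<exists>!f. (\<forall>j<n. f j \<in> gr j) \<and> (\<forall>j\<ge>n. f j = 0) \<and> x = (\<Sum>j<n. f j)"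
  using grading by (auto simp: zn_grading_def)

lemma gr_components: "\<exists>f. (\<forall>j<n. f j \<in> gr j) \<and> x = (\<Sum>j<n. f j)"
  using gr_decomp[of x] by blast

lemma gr_unique:
  assumes "\<And>j. j < n \<Longrightarrow> f j \<in> gr j" "\<And>j. j < n \<Longrightarrow> g j \<in> gr j" "(\<Sum>j<n. f j) = (\<Sum>j<n. g j)" "j < n"
  shows "f j = g j"
proof -
  let ?f = "\<lambda>j. if j < n then f j else 0" and ?g = "\<lambda>j. if j < n then g j else 0"
  obtain k where k: "\<And>k'. (\<forall>j<n. k' j \<in> gr j) \<and> (\<forall>j\<ge>n. k' j = 0) \<and> (\<Sum>j<n. f j) = (\<Sum>j<n. k' j) \<Longrightarrow> k' = k"
    using gr_decomp[of "\<Sum>j<n. f j"] by blast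
  have "?f = k" by (rule k) (use assms in auto)
  moreover have "?g = k" by (rule k) (use assms in auto)
  ultimately have "?f = ?g" by simp
  from fun_cong[OF this, of j] show ?thesis using assms(4) by simp
qed

lemma gr_indep:
  assumes "\<And>j. j < n \<Longrightarrow> f j \<in> gr j" "(\<Sum>j<n. f j) = 0" "j < n"
  shows "f j = 0"
  using gr_unique[of f "\<lambda>_. 0"] assms subspace_0[OF subspace_gr] by simp

lemma gr_component_eq:
  assumes "i < n" "x \<in> gr i" "\<And>j. j < n \<Longrightarrow> f j \<in> gr j" "x = (\<Sum>j<n. f j)" "j < n"
  shows "f j = (if j = i then x else 0)"
  using assms subspace_0[OF subspace_gr]
  by (intro gr_unique[of f "\<lambda>j. if j = i then x else 0"]) auto

lemma h0_gr: "h0 \<subseteq> gr 0" and h0_h: "h0 \<subseteq> h"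
  by (auto simp: h0_def)

lemma subspace_h0: "subspace h0"
  unfolding h0_def by (intro subspace_inter subspace_h subspace_gr n_pos)

lemma h0_abelian: "x \<in> h0 \<Longrightarrow> y \<in> h0 \<Longrightarrow> br x y = 0"
  using cartan_abelian h0_h by blast

lemma gr0_br: "j < n \<Longrightarrow> x \<in> gr 0 \<Longrightarrow> y \<in> gr j \<Longrightarrow> br x y \<in> gr j"
  using gr_br[of 0 j x y] n_pos by simp

lemma h0_centralizer:
  assumes "x \<in> gr 0" "\<And>y. y \<in> h0 \<Longrightarrow> br y x = 0"
  shows "x \<in> h0"
proof -
  have "\<forall>y\<in>h0. br x y \<in> h0" using assms subspace_0[OF subspace_h0] by (metis br_skew neg_0_equal_iff_equal)
  thus ?thesis using cartan0 assms(1) by (auto simp: cartan_subalg_def)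
qed

definition wvec :: "('b \<Rightarrow> complex) \<Rightarrow> 'b set" where
  "wvec \<mu> = {v. \<forall>x\<in>h0. br x v = \<mu> x *s v}"

text \<open>The normalization used in \<open>is_weight\<close>, under which functionals agreeing on
  \<open>h0\<close> are equal.\<close>

definition nrm :: "('b \<Rightarrow> complex) \<Rightarrow> bool" where
  "nrm \<mu> \<longleftrightarrow> (\<forall>x. x \<notin> h0 \<longrightarrow> \<mu> x = 0)"

lemma subspace_wvec: "subspace (wvec \<mu>)"
  by (simp add: subspace_def wvec_def br_add_right br_scale_right scale_right_distrib mult.commute)

text \<open>The elimination from \<open>gws_indep\<close>, carried out modulo a stable subspace. For
  \<open>W\<close> zero it gives independence, for general \<open>W\<close> the splitting of
  submodules into weight vectors.\<close>

lemma weight_components_in: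
  assumes "subspace W" "\<And>x v. x \<in> h0 \<Longrightarrow> v \<in> W \<Longrightarrow> br x v \<in> W"
    and "finite F" "\<And>\<mu>. \<mu> \<in> F \<Longrightarrow> nrm \<mu> \<and> v \<mu> \<in> wvec \<mu>" "(\<Sum>\<mu>\<in>F. v \<mu>) \<in> W" "\<mu> \<in> F"
  shows "v \<mu> \<in> W"
  using assms(3-6)
proof (induction "card F" arbitrary: F v \<mu> rule: less_induct)
  case less
  show ?case
  proof (cases "F = {\<mu>}")
    case False
    then obtain \<nu> where \<nu>: "\<nu> \<in> F" "\<nu> \<noteq> \<mu>" using less.prems(4) by blast
    then obtain x where x: "\<mu> x \<noteq> \<nu> x" by (metis ext)
    hence xh: "x \<in> h0" using less.prems(2)[OF \<nu>(1)] less.prems(2)[OF less.prems(4)]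
      unfolding nrm_def by metis
    let ?f = "shift (br x) (\<nu> x)"
    have fv: "?f (v \<kappa>) = (\<kappa> x - \<nu> x) *s v \<kappa>" if "\<kappa> \<in> F" for \<kappa>
      using less.prems(2)[OF that] xh by (simp add: shift_def wvec_def scale_left_diff_distrib)
    have "(\<Sum>\<kappa>\<in>F - {\<nu>}. (\<kappa> x - \<nu> x) *s v \<kappa>) = (\<Sum>\<kappa>\<in>F. (\<kappa> x - \<nu> x) *s v \<kappa>)"
      using sum.remove[OF less.prems(1) \<nu>(1), of "\<lambda>\<kappa>. (\<kappa> x - \<nu> x) *s v \<kappa>"] by simp
    also have "\<dots> = ?f (\<Sum>\<kappa>\<in>F. v \<kappa>)" by (simp add: lin_sum[OF lin_shift[OF lin_br]] fv)
    also have "\<dots> \<in> W" using less.prems(3) xh assms(1,2)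
      by (simp add: shift_def subspace_diff subspace_scale)
    finally have s: "(\<Sum>\<kappa>\<in>F - {\<nu>}. (\<kappa> x - \<nu> x) *s v \<kappa>) \<in> W" .
    have c: "card (F - {\<nu>}) < card F" by (rule card_Diff1_less[OF less.prems(1) \<nu>(1)])
    have "(\<mu> x - \<nu> x) *s v \<mu> \<in> W"
      by (rule less.hyps[OF c, of "\<lambda>\<kappa>. (\<kappa> x - \<nu> x) *s v \<kappa>"])
        (use less.prems \<nu> s subspace_scale[OF subspace_wvec] in auto)
    hence "(1 / (\<mu> x - \<nu> x)) *s (\<mu> x - \<nu> x) *s v \<mu> \<in> W" by (rule subspace_scale[OF assms(1)])
    thus ?thesis using x by simp
  qed (use less.prems in auto)
qed

lemma wvec_decomp: "\<exists>F v. finite F \<and> (\<forall>\<mu>\<in>F. nrm \<mu> \<and> v \<mu> \<in> wvec \<mu>) \<and> w = (\<Sum>\<mu>\<in>F. v \<mu>)"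
  using cartan_diagonal[of w]
proof (induction rule: span_induct_alt)
  case base
  show ?case by (rule exI[of _ "{}"]) simp
next
  case (step c x y)
  obtain F v where F: "finite F" "\<forall>\<mu>\<in>F. nrm \<mu> \<and> v \<mu> \<in> wvec \<mu>" "y = (\<Sum>\<mu>\<in>F. v \<mu>)"
    using step by blast
  obtain \<beta> where \<beta>: "\<forall>z\<in>h. br z x = \<beta> z *s x" using step by blast
  let ?b = "\<lambda>z. if z \<in> h0 then \<beta> z else 0"
  have b: "nrm ?b" "x \<in> wvec ?b" using \<beta> h0_h by (auto simp: nrm_def wvec_def)
  let ?v = "\<lambda>\<mu>. (if \<mu> = ?b then c *s x else 0) + (if \<mu> \<in> F then v \<mu> else 0)"
  have "(\<Sum>\<mu>\<in>insert ?b F. ?v \<mu>) = c *s x + y"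
    using F(1,3) by (cases "?b \<in> F") (simp_all add: sum.distrib insert_absorb sum.If_cases Int_absorb1 Int_absorb2)
  moreover have "\<forall>\<mu>\<in>insert ?b F. nrm \<mu> \<and> ?v \<mu> \<in> wvec \<mu>"
    using F(2) b subspace_wvec by (auto intro!: subspace_add subspace_scale subspace_0)
  ultimately show ?case using F(1) by (intro exI[of _ "insert ?b F"] exI[of _ ?v]) auto
qed

lemma wvec_span:
  assumes "subspace W" "\<And>x v. x \<in> h0 \<Longrightarrow> v \<in> W \<Longrightarrow> br x v \<in> W"
  shows "W \<subseteq> span {v. v \<in> W \<and> (\<exists>\<mu>. nrm \<mu> \<and> v \<in> wvec \<mu>)}"
proof
  fix w assume w: "w \<in> W"
  obtain F v where F: "finite F" "\<forall>\<mu>\<in>F. nrm \<mu> \<and> v \<mu> \<in> wvec \<mu>" "w = (\<Sum>\<mu>\<in>F. v \<mu>)"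
    using wvec_decomp[of w] by blast
  have "v \<mu> \<in> W" if "\<mu> \<in> F" for \<mu>
    by (rule weight_components_in[OF assms F(1), of v]) (use F w that in auto)
  thus "w \<in> span {v. v \<in> W \<and> (\<exists>\<mu>. nrm \<mu> \<and> v \<in> wvec \<mu>)}"
    unfolding F(3) using F(2) by (intro span_sum span_base) auto
qed

definition wsp :: "('b \<Rightarrow> complex) \<times> nat \<Rightarrow> 'b set" where
  "wsp p = gr (snd p) \<inter> wvec (fst p)"

text \<open>Zero functionals and degree 0 are included, so roots of \<open>gr 0\<close>, the pair
  \<open>(0, 0)\<close> and the elements of \<open>Sigma_plus\<close> are handled together.\<close>

definition Wt :: "(('b \<Rightarrow> complex) \<times> nat) set" where
  "Wt = {p. snd p < n \<and> nrm (fst p) \<and> (\<exists>v\<in>wsp p. v \<noteq> 0)}"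

definition wadd :: "('b \<Rightarrow> complex) \<times> nat \<Rightarrow> ('b \<Rightarrow> complex) \<times> nat \<Rightarrow> ('b \<Rightarrow> complex) \<times> nat" where
  "wadd p q = (fst p + fst q, (snd p + snd q) mod n)"

definition wneg :: "('b \<Rightarrow> complex) \<times> nat \<Rightarrow> ('b \<Rightarrow> complex) \<times> nat" where
  "wneg p = (- fst p, (n - snd p) mod n)"

lemma is_weight_iff:
  "is_weight scale br h0 (M \<inter> gr j) \<mu> \<longleftrightarrow> nrm \<mu> \<and> (\<exists>v\<in>M \<inter> wsp (\<mu>, j). v \<noteq> 0)"
  by (auto simp: is_weight_def nrm_def wsp_def wvec_def)

lemma is_weight_Wt: "j < n \<Longrightarrow> is_weight scale br h0 (gr j) \<mu> \<longleftrightarrow> (\<mu>, j) \<in> Wt"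
  by (auto simp: is_weight_def nrm_def wsp_def wvec_def Wt_def)

lemma Wt_lt: "p \<in> Wt \<Longrightarrow> snd p < n" and Wt_nrm: "p \<in> Wt \<Longrightarrow> nrm (fst p)"
  by (simp_all add: Wt_def)

lemma WtI: "snd p < n \<Longrightarrow> nrm (fst p) \<Longrightarrow> v \<in> wsp p \<Longrightarrow> v \<noteq> 0 \<Longrightarrow> p \<in> Wt"
  by (auto simp: Wt_def)

lemma Wt_vec: "p \<in> Wt \<Longrightarrow> \<exists>v\<in>wsp p. v \<noteq> 0"
  by (simp add: Wt_def)

lemma wadd_lt: "snd (wadd p q) < n" and wneg_lt: "snd (wneg p) < n"
  using n_pos by (simp_all add: wadd_def wneg_def)

lemma wadd_nrm: "nrm (fst p) \<Longrightarrow> nrm (fst q) \<Longrightarrow> nrm (fst (wadd p q))"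
  and wneg_nrm: "nrm (fst p) \<Longrightarrow> nrm (fst (wneg p))"
  by (simp_all add: nrm_def wadd_def wneg_def)

lemma fst_wadd [simp]: "fst (wadd p q) = fst p + fst q" and fst_wneg [simp]: "fst (wneg p) = - fst p"
  by (simp_all add: wadd_def wneg_def)

lemma wadd_commute: "wadd p q = wadd q p"
  by (simp add: wadd_def add.commute)

lemma wadd_assoc: "wadd (wadd p q) r = wadd p (wadd q r)"
  by (simp add: wadd_def add.assoc mod_add_left_eq mod_add_right_eq)

lemma wadd_eq_right: "snd q < n \<Longrightarrow> wadd p q = q \<longleftrightarrow> fst p = 0 \<and> snd p mod n = 0"
  using nat_mod_add_cancel[of "snd p" "snd q" n] by (auto simp: wadd_def prod_eq_iff)

lemma wadd_0: "snd q < n \<Longrightarrow> wadd (0, 0) q = q"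
  by (simp add: wadd_def)

lemma wadd_wneg: "snd p < n \<Longrightarrow> wadd p (wneg p) = (0, 0)"
  by (cases "snd p = 0") (simp_all add: wadd_def wneg_def mod_add_right_eq)

lemma wneg_wneg: "snd p < n \<Longrightarrow> wneg (wneg p) = p"
  by (cases "snd p = 0") (simp_all add: wneg_def prod_eq_iff)

lemma wadd_zero_iff: "snd p < n \<Longrightarrow> snd q < n \<Longrightarrow> wadd p q = (0, 0) \<longleftrightarrow> q = wneg p"
proof
  assume pq: "snd p < n" "snd q < n" "wadd p q = (0, 0)"
  have "q = wadd (wadd p (wneg p)) q" using pq by (simp add: wadd_wneg wadd_0)
  also have "\<dots> = wadd (wneg p) (wadd p q)" by (metis wadd_commute wadd_assoc)
  also have "\<dots> = wneg p" using pq(3) wadd_0[OF wneg_lt] by (simp add: wadd_commute)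
  finally show "q = wneg p" .
qed (simp add: wadd_wneg)

lemma br_wvec: "u \<in> wvec \<mu> \<Longrightarrow> v \<in> wvec \<nu> \<Longrightarrow> br u v \<in> wvec (\<mu> + \<nu>)"
proof -
  assume uv: "u \<in> wvec \<mu>" "v \<in> wvec \<nu>"
  have "br x (br u v) = (\<mu> + \<nu>) x *s br u v" if "x \<in> h0" for x
    using uv that leibniz[of x u v] by (simp add: wvec_def br_scale_left br_scale_right scale_left_distrib)
  thus ?thesis by (simp add: wvec_def)
qed

lemma br_wsp: "snd p < n \<Longrightarrow> snd q < n \<Longrightarrow> u \<in> wsp p \<Longrightarrow> v \<in> wsp q \<Longrightarrow> br u v \<in> wsp (wadd p q)"
  by (simp add: wsp_def br_wvec gr_br wadd_def)

lemma br_Wt: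
  "p \<in> Wt \<Longrightarrow> q \<in> Wt \<Longrightarrow> u \<in> wsp p \<Longrightarrow> v \<in> wsp q \<Longrightarrow> br u v \<noteq> 0 \<Longrightarrow> wadd p q \<in> Wt"
  by (rule WtI[OF wadd_lt _ br_wsp]) (simp_all add: Wt_lt Wt_nrm wadd_nrm del: fst_wadd)

lemma subspace_wsp: "snd p < n \<Longrightarrow> subspace (wsp p)"
  unfolding wsp_def by (intro subspace_inter subspace_gr subspace_wvec)

lemma wsp_h0: "x \<in> h0 \<Longrightarrow> v \<in> wsp p \<Longrightarrow> br x v = fst p x *s v"
  by (simp add: wsp_def wvec_def)

text \<open>\<open>h0\<close> is abelian and, being its own normalizer in \<open>gr 0\<close>,
  contains its centralizer there.\<close>

lemma wsp_zero: "wsp (0, 0) = h0"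
  using h0_centralizer h0_gr h0_abelian by (auto simp: wsp_def wvec_def)

lemma wsp_indep:
  assumes "finite F" "\<And>p. p \<in> F \<Longrightarrow> snd p < n \<and> nrm (fst p)" "\<And>p. p \<in> F \<Longrightarrow> v p \<in> wsp p"
    "(\<Sum>p\<in>F. v p) = 0" "p \<in> F"
  shows "v p = 0"
proof -
  let ?f = "\<lambda>j. \<Sum>q\<in>{q \<in> F. snd q = j}. v q"
  have "(\<Sum>j<n. ?f j) = (\<Sum>p\<in>F. v p)"
    by (rule sum.group) (use assms in auto)
  hence "?f (snd p) = 0"
    using assms subspace_gr by (intro gr_indep[of ?f]) (auto intro!: subspace_sum simp: wsp_def)
  moreover have "?f (snd p) = (\<Sum>\<mu>\<in>{\<mu>. (\<mu>, snd p) \<in> F}. v (\<mu>, snd p))"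
    by (rule sum.reindex_bij_witness[of _ "\<lambda>\<mu>. (\<mu>, snd p)" fst]) auto
  ultimately have s: "(\<Sum>\<mu>\<in>{\<mu>. (\<mu>, snd p) \<in> F}. v (\<mu>, snd p)) \<in> {0}" by simp
  have fin: "finite {\<mu>. (\<mu>, snd p) \<in> F}"
    by (rule finite_subset[OF _ finite_imageI[OF assms(1), of fst]]) force
  have "v (fst p, snd p) \<in> {0}"
    by (rule weight_components_in[OF subspace_single_0 _ fin, of "\<lambda>\<mu>. v (\<mu>, snd p)"])
      (use assms s in \<open>auto simp: wsp_def\<close>)
  thus ?thesis by simp
qed

lemma gr_wsp_span:
  assumes "j < n" "subspace W" "W \<subseteq> gr j" "\<And>x v. x \<in> h0 \<Longrightarrow> v \<in> W \<Longrightarrow> br x v \<in> W"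
  shows "W \<subseteq> span (\<Union>\<mu>\<in>{\<mu>. (\<mu>, j) \<in> Wt}. W \<inter> wsp (\<mu>, j))"
proof -
  let ?U = "span (\<Union>\<mu>\<in>{\<mu>. (\<mu>, j) \<in> Wt}. W \<inter> wsp (\<mu>, j))"
  have "{v. v \<in> W \<and> (\<exists>\<mu>. nrm \<mu> \<and> v \<in> wvec \<mu>)} \<subseteq> ?U"
  proof
    fix v assume "v \<in> {v. v \<in> W \<and> (\<exists>\<mu>. nrm \<mu> \<and> v \<in> wvec \<mu>)}"
    then obtain \<mu> where v: "v \<in> W" "nrm \<mu>" "v \<in> wsp (\<mu>, j)" using assms(3) by (auto simp: wsp_def)
    show "v \<in> ?U"
    proof (cases "v = 0")
      case False
      hence "(\<mu>, j) \<in> Wt" using v assms(1) by (auto intro: WtI)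
      thus ?thesis using v by (intro span_base) auto
    qed (simp add: span_zero)
  qed
  thus ?thesis using wvec_span[OF assms(2,4)] span_minimal[OF _ subspace_span] by blast
qed

sublocale D: dsum scale Basis Wt wsp
proof
  show "finite Wt"
  proof (rule finite_if_independent_subspaces[of Wt wsp])
    fix F and v :: "('b \<Rightarrow> complex) \<times> nat \<Rightarrow> 'b"
    assume F: "finite F" "F \<subseteq> Wt" "\<forall>p\<in>F. v p \<in> wsp p" "(\<Sum>p\<in>F. v p) = 0"
    show "\<forall>p\<in>F. v p = 0"
    proof
      fix p assume p: "p \<in> F"
      show "v p = 0" by (rule wsp_indep[OF F(1) _ _ F(4) p]) (use F Wt_lt Wt_nrm in auto)
    qed
  qed (auto simp: Wt_vec subspace_wsp Wt_lt)
  show "subspace (wsp p)" if "p \<in> Wt" for p using that by (intro subspace_wsp Wt_lt)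
  show "v \<in> span (\<Union>p\<in>Wt. wsp p)" for v
  proof -
    obtain f where f: "\<forall>j<n. f j \<in> gr j" "v = (\<Sum>j<n. f j)" using gr_components by blast
    have "f j \<in> span (\<Union>p\<in>Wt. wsp p)" if "j < n" for j
    proof -
      have "gr j \<subseteq> span (\<Union>\<mu>\<in>{\<mu>. (\<mu>, j) \<in> Wt}. gr j \<inter> wsp (\<mu>, j))"
        by (rule gr_wsp_span) (use that subspace_gr gr0_br h0_gr in auto)
      also have "\<dots> \<subseteq> span (\<Union>p\<in>Wt. wsp p)" by (rule span_mono) blast
      finally show ?thesis using f(1) that by blast
    qed
    thus ?thesis unfolding f(2) by (intro span_sum) simp
  qed
  show "u p = 0" if "\<And>p. p \<in> Wt \<Longrightarrow> u p \<in> wsp p" "(\<Sum>p\<in>Wt. u p) = 0" "p \<in> Wt" for u p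
    by (rule wsp_indep[OF \<open>finite Wt\<close> _ that]) (auto simp: Wt_lt Wt_nrm)
qed

lemma kf_wsp:
  assumes "p \<in> Wt" "q \<in> Wt" "u \<in> wsp p" "v \<in> wsp q" "wadd p q \<noteq> (0, 0)"
  shows "kf u v = 0"
  unfolding kf_def
proof (rule D.tr_off_diagonal)
  show "lin (\<lambda>w. br u (br v w))" by (rule lin_fun_comp[OF lin_br lin_br])
  fix r w assume r: "r \<in> Wt" "w \<in> wsp r"
  show "D.prj r (br u (br v w)) = 0"
  proof (cases "br u (br v w) = 0")
    case False
    have 1: "br v w \<in> wsp (wadd q r)" "br u (br v w) \<in> wsp (wadd p (wadd q r))"
      by (intro br_wsp wadd_lt Wt_lt assms r)+
    have "wadd q r \<in> Wt" using False by (intro br_Wt[OF assms(2) r(1) assms(4) r(2)]) auto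
    hence 2: "wadd p (wadd q r) \<in> Wt" using False 1(1) by (intro br_Wt[OF assms(1) _ assms(3)]) auto
    have "r \<noteq> wadd (wadd p q) r"
      using assms(5) wadd_eq_right[OF Wt_lt[OF r(1)], of "wadd p q"] n_pos by (auto simp: wadd_def prod_eq_iff)
    thus ?thesis using D.prj_W[OF 2 1(2), of r] by (simp add: wadd_assoc)
  qed (simp add: lin_0[OF D.lin_prj])
qed

text \<open>Nondegeneracy gives some weight component pairing with \<open>u\<close>, and
  orthogonality forces it to sit at the opposite pair.\<close>

lemma kf_pairing:
  assumes "p \<in> Wt" "u \<in> wsp p" "u \<noteq> 0"
  shows "\<exists>v\<in>wsp (wneg p). kf u v \<noteq> 0"
proof -
  obtain y where "kf u y \<noteq> 0" using kf_nondegenerate[of u] assms(3) by auto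
  hence "(\<Sum>q\<in>Wt. kf u (D.prj q y)) \<noteq> 0" by (simp add: kf_sum_right[symmetric] D.sum_prj)
  then obtain q where q: "q \<in> Wt" "kf u (D.prj q y) \<noteq> 0" 
    using sum.neutral[of Wt "\<lambda>q. kf u (D.prj q y)"] by blast
  hence "wadd p q = (0, 0)" using kf_wsp[OF assms(1) q(1) assms(2) D.prj_in[OF q(1)]] by blast
  hence "q = wneg p" using wadd_zero_iff[OF Wt_lt[OF assms(1)] Wt_lt[OF q(1)]] by simp
  thus ?thesis using q(2) D.prj_in[OF q(1), of y] by (intro bexI[of _ "D.prj q y"]) auto
qed

lemma wneg_Wt: "p \<in> Wt \<Longrightarrow> wneg p \<in> Wt"
proof -
  assume p: "p \<in> Wt"
  obtain u where "u \<in> wsp p" "u \<noteq> 0" using Wt_vec[OF p] by blast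
  then obtain v where v: "v \<in> wsp (wneg p)" "kf u v \<noteq> 0" using kf_pairing[OF p] by blast
  thus ?thesis using p by (intro WtI[OF wneg_lt wneg_nrm v(1)]) (auto simp: Wt_nrm)
qed

lemma kf_h0:
  assumes "x \<in> h0" "y \<in> h0"
  shows "kf x y = (\<Sum>p\<in>Wt. of_nat (dim (wsp p)) * fst p x * fst p y)"
proof -
  have "br x (br y u) = (\<Sum>p\<in>Wt. (fst p x * fst p y) *s D.prj p u)" for u
  proof (rule D.eq_on_W[of "\<lambda>u. br x (br y u)" "\<lambda>u. \<Sum>p\<in>Wt. (fst p x * fst p y) *s D.prj p u"])
    show "lin (\<lambda>u. br x (br y u))" by (rule lin_fun_comp[OF lin_br lin_br])
    show "lin (\<lambda>u. \<Sum>p\<in>Wt. (fst p x * fst p y) *s D.prj p u)"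
      by (intro lin_fun_sum lin_fun_scale D.lin_prj)
    fix q u assume q: "q \<in> Wt" "u \<in> wsp q"
    have "(\<Sum>p\<in>Wt. (fst p x * fst p y) *s D.prj p u) = (\<Sum>p\<in>Wt. if p = q then (fst q x * fst q y) *s u else 0)"
      by (rule sum.cong) (auto simp: D.prj_W[OF q])
    thus "br x (br y u) = (\<Sum>p\<in>Wt. (fst p x * fst p y) *s D.prj p u)"
      using q D.finite_I assms by (simp add: wsp_h0 br_scale_right mult.commute)
  qed
  hence "kf x y = (\<Sum>p\<in>Wt. fst p x * fst p y * tr (D.prj p))"
    by (simp add: kf_def tr_sum tr_scale)
  thus ?thesis by (simp add: D.tr_prj mult_ac)
qed

text \<open>Such an \<open>x\<close> kills every weight space, hence is central.\<close>

lemma h0_separated: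
  assumes "x \<in> h0" "\<And>p. p \<in> Wt \<Longrightarrow> fst p x = 0"
  shows "x = 0"
proof (rule center_trivial)
  fix u
  have "br x u = 0"
    by (rule D.eq_on_W[of "br x" "\<lambda>u. 0", OF lin_br]) (simp_all add: lin_iff wsp_h0 assms)
  thus "br u x = 0" using br_skew[of u x] by simp
qed

lemma weight_add: "p \<in> Wt \<Longrightarrow> x \<in> h0 \<Longrightarrow> y \<in> h0 \<Longrightarrow> fst p (x + y) = fst p x + fst p y"
proof -
  assume p: "p \<in> Wt" and xy: "x \<in> h0" "y \<in> h0"
  obtain u where u: "u \<in> wsp p" "u \<noteq> 0" using Wt_vec[OF p] by blast
  have "x + y \<in> h0" using xy subspace_h0 by (intro subspace_add)
  hence "fst p (x + y) *s u = br (x + y) u" by (simp add: wsp_h0[OF _ u(1)])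
  also have "\<dots> = (fst p x + fst p y) *s u"
    using xy by (simp add: br_add_left scale_left_distrib wsp_h0[OF _ u(1)])
  finally show ?thesis using u by simp
qed

lemma weight_scale: "p \<in> Wt \<Longrightarrow> x \<in> h0 \<Longrightarrow> fst p (c *s x) = c * fst p x"
proof -
  assume p: "p \<in> Wt" and x: "x \<in> h0"
  obtain u where u: "u \<in> wsp p" "u \<noteq> 0" using Wt_vec[OF p] by blast
  have "c *s x \<in> h0" using x subspace_h0 by (intro subspace_scale)
  hence "fst p (c *s x) *s u = br (c *s x) u" by (simp add: wsp_h0[OF _ u(1)])
  also have "\<dots> = (c * fst p x) *s u" using x by (simp add: br_scale_left wsp_h0[OF _ u(1)])
  finally show ?thesis using u by simp
qed

subsection \<open>Three-dimensional simple subalgebras and the invariant form\<close>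

lemma wadd_iter:
  shows fst_wadd_iter: "fst ((wadd r ^^ m) q) x = fst q x + of_nat m * fst r x"
    and wadd_iter_lt: "snd q < n \<Longrightarrow> snd ((wadd r ^^ m) q) < n"
    and wadd_iter_nrm: "nrm (fst r) \<Longrightarrow> nrm (fst q) \<Longrightarrow> nrm (fst ((wadd r ^^ m) q))"
  by (induction m) (simp_all add: wadd_lt algebra_simps nrm_def)

lemma ad_pow_wsp:
  assumes "snd r < n" "snd q < n" "x \<in> wsp r" "v \<in> wsp q"
  shows "(br x ^^ m) v \<in> wsp ((wadd r ^^ m) q)"
  by (induction m) (simp_all add: assms br_wsp wadd_iter_lt)

lemma ad_pow_Wt:
  assumes "snd r < n" "nrm (fst r)" "q \<in> Wt" "x \<in> wsp r" "v \<in> wsp q" "(br x ^^ m) v \<noteq> 0"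
  shows "(wadd r ^^ m) q \<in> Wt"
  by (rule WtI[OF wadd_iter_lt[OF Wt_lt[OF assms(3)]] wadd_iter_nrm[OF assms(2) Wt_nrm[OF assms(3)]]
      ad_pow_wsp[OF assms(1) Wt_lt[OF assms(3)] assms(4,5)] assms(6)])

text \<open>The pairs along the string are distinct since \<open>fst r\<close> is nonzero, while
  \<open>Wt\<close> is finite.\<close>

lemma ad_nilpotent:
  assumes "snd r < n" "nrm (fst r)" "fst r \<noteq> 0" "x \<in> wsp r" "q \<in> Wt" "v \<in> wsp q"
  shows "\<exists>m. (br x ^^ m) v = 0"
proof (rule ccontr)
  assume "\<not> ?thesis"
  hence "range (\<lambda>m. (wadd r ^^ m) q) \<subseteq> Wt"
    using ad_pow_Wt[OF assms(1,2,5,4,6)] by blast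
  moreover have "inj (\<lambda>m. (wadd r ^^ m) q)"
  proof (rule injI)
    fix k m assume eq: "(wadd r ^^ k) q = (wadd r ^^ m) q"
    obtain y where y: "fst r y \<noteq> 0" using assms(3) by (auto simp: fun_eq_iff)
    have "fst q y + of_nat k * fst r y = fst q y + of_nat m * fst r y"
      using eq by (metis fst_wadd_iter)
    thus "k = m" using y by simp
  qed
  ultimately show False using D.finite_I finite_imageD[of "\<lambda>m. (wadd r ^^ m) q" UNIV]
    by (metis finite_subset infinite_UNIV_nat)
qed

text \<open>The commutation formula of an \<open>sl2\<close>-triple, for a \<open>t\<close> that is
  not normalized: \<open>coroot_nonzero\<close> applies it with \<open>fst p t = 0\<close> to refute
  this very case. For \<open>fst p t = 2\<close> the coefficient is the familiar
  \<open>(m + 1) * (fst q t - m)\<close>.\<close>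

lemma ef_power:
  assumes p: "snd p < n" and q: "snd q < n" and f: "f \<in> wsp (wneg p)"
    and t: "br e f = t" "t \<in> h0" and v: "v \<in> wsp q"
  shows "br e ((br f ^^ Suc m) v) = (br f ^^ Suc m) (br e v)
    + (of_nat (Suc m) * (fst q t - of_nat m * fst p t / 2)) *s (br f ^^ m) v"
proof (induction m)
  case 0
  have "br e (br f v) = br t v + br f (br e v)" using leibniz[of e f v] t by simp
  thus ?case using wsp_h0[OF t(2) v] by (simp add: add.commute)
next
  case (Suc m)
  let ?u = "(br f ^^ Suc m) v"
  have "br t ?u = (fst q t - of_nat (Suc m) * fst p t) *s ?u"
    using wsp_h0[OF t(2) ad_pow_wsp[OF wneg_lt q f v, of "Suc m"]]
    by (simp only: fst_wadd_iter) simp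
  moreover have "br e (br f ?u) = br t ?u + br f (br e ?u)" using leibniz[of e f ?u] t by simp
  moreover have "br f (br e ?u) = (br f ^^ Suc (Suc m)) (br e v)
      + (of_nat (Suc m) * (fst q t - of_nat m * fst p t / 2)) *s ?u"
    unfolding Suc.IH by (simp add: br_add_right br_scale_right)
  ultimately have "br e (br f ?u) = (br f ^^ Suc (Suc m)) (br e v)
      + (fst q t - of_nat (Suc m) * fst p t
         + of_nat (Suc m) * (fst q t - of_nat m * fst p t / 2)) *s ?u"
    by (simp add: scale_left_distrib)
  also have "fst q t - of_nat (Suc m) * fst p t + of_nat (Suc m) * (fst q t - of_nat m * fst p t / 2)
      = of_nat (Suc (Suc m)) * (fst q t - of_nat (Suc m) * fst p t / 2)"
    by (simp add: field_simps)
  finally show ?case by simp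
qed

text \<open>If \<open>br f (br e v)\<close> were 0, then by \<open>ef_power\<close> raising each
  positive \<open>f\<close>-power of \<open>v\<close> would give a nonzero multiple of the preceding
  one; so no power of \<open>f\<close> would kill \<open>v\<close>, against nilpotency.\<close>

lemma ef_nonzero:
  assumes p: "p \<in> Wt" "fst p \<noteq> 0" and q: "q \<in> Wt" and f: "f \<in> wsp (wneg p)"
    and t: "br e f = t" "t \<in> h0" and v: "v \<in> wsp q" "v \<noteq> 0"
    and w: "\<And>m::nat. fst q t \<noteq> of_nat m * fst p t / 2"
  shows "br f (br e v) \<noteq> 0"
proof
  assume 0: "br f (br e v) = 0"
  have fe: "(br f ^^ Suc m) (br e v) = 0" for m by (induction m) (simp_all add: 0)
  have "(br f ^^ m) v \<noteq> 0" for m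
  proof (induction m)
    case (Suc m)
    have "fst q t - of_nat m * fst p t / 2 \<noteq> 0" using w[of m] by simp
    hence "br e ((br f ^^ Suc m) v) \<noteq> 0"
      unfolding ef_power[OF Wt_lt[OF p(1)] Wt_lt[OF q] f t v(1)] fe using Suc by (simp add: add_eq_0_iff del: of_nat_Suc)
    thus ?case by (metis br_0_right)
  qed (use v in simp)
  moreover have "fst (wneg p) \<noteq> 0" using p(2) by simp
  ultimately show False
    using ad_nilpotent[OF wneg_lt wneg_nrm[OF Wt_nrm[OF p(1)]] _ f q v(1)] by blast
qed

lemma kf_h0_nondegenerate:
  assumes "z \<in> h0" "\<And>y. y \<in> h0 \<Longrightarrow> kf z y = 0"
  shows "z = 0"
proof (rule ccontr)
  assume z: "z \<noteq> 0"
  have "(0, 0) \<in> Wt" using assms z n_pos by (intro WtI[of _ z]) (auto simp: nrm_def wsp_zero)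
  then obtain v where "v \<in> wsp (wneg (0, 0))" "kf z v \<noteq> 0"
    using kf_pairing[of "(0, 0)" z] assms(1) z by (auto simp: wsp_zero)
  moreover have "wneg (0, 0) = (0, 0)" by (simp add: wneg_def)
  ultimately show False using assms(2) by (simp add: wsp_zero)
qed

text \<open>By invariance. Thus \<open>br e f\<close> represents \<open>kf e f\<close> times the
  functional \<open>fst p\<close> on \<open>h0\<close>, which ties coroots to the form on
  weights.\<close>

lemma kf_br_h0:
  assumes "f \<in> wsp (wneg p)" "x \<in> h0"
  shows "kf (br e f) x = kf e f * fst p x"
proof -
  have "br f x = fst p x *s f"
    using br_skew[of f x] wsp_h0[OF assms(2,1)] by simp
  thus ?thesis by (simp add: kf_invariant kf_scale_right)
qed

lemma br_opposite_h0:
  "snd p < n \<Longrightarrow> e \<in> wsp p \<Longrightarrow> f \<in> wsp (wneg p) \<Longrightarrow> br e f \<in> h0"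
  using br_wsp[OF _ wneg_lt, of p e f p] by (simp add: wadd_wneg wsp_zero)

text \<open>If the value were 0, evaluation at \<open>br e f\<close> would be constant along strings
  in direction \<open>p\<close>; a nonzero constant would let \<open>e\<close> act forever by
  \<open>ef_nonzero\<close>. So all weights vanish there, forcing \<open>br e f\<close> and then
  \<open>fst p\<close> to be 0.\<close>

lemma coroot_nonzero:
  assumes p: "p \<in> Wt" "fst p \<noteq> 0" and e: "e \<in> wsp p" and f: "f \<in> wsp (wneg p)" and ef: "kf e f \<noteq> 0"
  shows "fst p (br e f) \<noteq> 0"
proof
  assume 0: "fst p (br e f) = 0"
  let ?t = "br e f"
  have t: "?t \<in> h0" by (rule br_opposite_h0[OF Wt_lt[OF p(1)] e f])
  have "fst q ?t = 0" if q: "q \<in> Wt" for q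
  proof (rule ccontr)
    assume q0: "fst q ?t \<noteq> 0"
    obtain v where v: "v \<in> wsp q" "v \<noteq> 0" using Wt_vec[OF q] by blast
    have "(br e ^^ m) v \<noteq> 0" for m
    proof (induction m)
      case (Suc m)
      let ?u = "(br e ^^ m) v" and ?q = "(wadd p ^^ m) q"
      have u: "?u \<in> wsp ?q" by (rule ad_pow_wsp[OF Wt_lt[OF p(1)] Wt_lt[OF q] e v(1)])
      have "?q \<in> Wt" by (rule ad_pow_Wt[OF Wt_lt[OF p(1)] Wt_nrm[OF p(1)] q e v(1) Suc])
      moreover have "fst ?q ?t = fst q ?t" using 0 by (simp add: fst_wadd_iter)
      ultimately have "br f (br e ?u) \<noteq> 0"
        using q0 0 by (intro ef_nonzero[OF p _ f refl t u Suc]) auto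
      thus ?case by (metis br_0_right comp_apply funpow.simps(2))
    qed (use v in simp)
    thus False using ad_nilpotent[OF Wt_lt[OF p(1)] Wt_nrm[OF p(1)] p(2) e q v(1)] by blast
  qed
  hence "?t = 0" by (rule h0_separated[OF t])
  hence "fst p x = 0" if "x \<in> h0" for x using kf_br_h0[OF f that, of e] ef by simp
  hence "fst p = 0" using Wt_nrm[OF p(1)] by (auto simp: nrm_def fun_eq_iff)
  thus False using p(2) by blast
qed

definition sl2 :: "('b \<Rightarrow> complex) \<times> nat \<Rightarrow> 'b \<Rightarrow> 'b \<Rightarrow> 'b \<Rightarrow> bool" where
  "sl2 p e f t \<longleftrightarrow> p \<in> Wt \<and> fst p \<noteq> 0 \<and> e \<in> wsp p \<and> f \<in> wsp (wneg p) \<and> br e f = t \<and> t \<in> h0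
     \<and> fst p t = 2 \<and> kf e f \<noteq> 0"

lemma sl2_exists:
  assumes p: "p \<in> Wt" "fst p \<noteq> 0" and e: "e \<in> wsp p" "e \<noteq> 0"
  shows "\<exists>f t. sl2 p e f t"
proof -
  obtain f where f: "f \<in> wsp (wneg p)" "kf e f \<noteq> 0" using kf_pairing[OF p(1) e] by blast
  have nz: "fst p (br e f) \<noteq> 0" by (rule coroot_nonzero[OF p e(1) f])
  have t: "br e f \<in> h0" by (rule br_opposite_h0[OF Wt_lt[OF p(1)] e(1) f(1)])
  let ?c = "2 / fst p (br e f)"
  have "br e (?c *s f) = ?c *s br e f" by (rule br_scale_right)
  moreover have "?c *s f \<in> wsp (wneg p)" by (rule subspace_scale[OF subspace_wsp[OF wneg_lt] f(1)])
  moreover have "?c *s br e f \<in> h0" by (rule subspace_scale[OF subspace_h0 t])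
  moreover have "fst p (?c *s br e f) = 2" using weight_scale[OF p(1) t] nz by simp
  moreover have "kf e (?c *s f) \<noteq> 0" using f(2) nz by (simp add: kf_scale_right)
  ultimately have "sl2 p e (?c *s f) (?c *s br e f)" using p e by (simp add: sl2_def)
  thus ?thesis by blast
qed

lemma weight_minus: "p \<in> Wt \<Longrightarrow> x \<in> h0 \<Longrightarrow> fst p (- x) = - fst p x"
  using weight_scale[of p x "- 1"] by simp

lemma sl2_sym: "sl2 p e f t \<Longrightarrow> sl2 (wneg p) f e (- t)"
  unfolding sl2_def
  using kf_sym[of e f] br_skew[of f e] wneg_Wt[of p] subspace_neg[OF subspace_h0, of t] weight_minus[of p t]
  by (auto simp: wneg_wneg Wt_lt)

text \<open>With \<open>fst p t = 2\<close> the values excluded in \<open>ef_nonzero\<close> are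
  exactly the natural numbers.\<close>

lemma sl2_fe:
  assumes "sl2 p e f t" "q \<in> Wt" "v \<in> wsp q" "v \<noteq> 0" "fst q t \<notin> \<nat>"
  shows "br f (br e v) \<noteq> 0"
  by (rule ef_nonzero[of p q f e t v]) (use assms in \<open>auto simp: sl2_def\<close>)

lemma sl2_ef:
  assumes "sl2 p e f t" "q \<in> Wt" "v \<in> wsp q" "v \<noteq> 0" "- fst q t \<notin> \<nat>"
  shows "br e (br f v) \<noteq> 0"
  by (rule sl2_fe[OF sl2_sym[OF assms(1)] assms(2-4)])
    (use assms weight_minus[of q t] in \<open>simp add: sl2_def\<close>)

text \<open>A nonintegral value stays outside the naturals along the whole string, so
  \<open>e\<close> could be applied forever.\<close>

lemma sl2_int:
  assumes s: "sl2 p e f t" and q: "q \<in> Wt"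
  shows "fst q t \<in> \<int>"
proof (rule ccontr)
  assume ni: "fst q t \<notin> \<int>"
  have p: "p \<in> Wt" "fst p \<noteq> 0" "e \<in> wsp p" "fst p t = 2" using s by (auto simp: sl2_def)
  obtain v where v: "v \<in> wsp q" "v \<noteq> 0" using Wt_vec[OF q] by blast
  have "(br e ^^ m) v \<noteq> 0" for m
  proof (induction m)
    case (Suc m)
    let ?u = "(br e ^^ m) v" and ?q = "(wadd p ^^ m) q"
    have u: "?u \<in> wsp ?q" by (rule ad_pow_wsp[OF Wt_lt[OF p(1)] Wt_lt[OF q] p(3) v(1)])
    have q': "?q \<in> Wt" by (rule ad_pow_Wt[OF Wt_lt[OF p(1)] Wt_nrm[OF p(1)] q p(3) v(1) Suc])
    have "fst ?q t \<notin> \<nat>"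
    proof
      assume "fst ?q t \<in> \<nat>"
      then obtain k where "fst q t + of_nat m * 2 = of_nat k" by (auto simp: fst_wadd_iter p Nats_def)
      hence "fst q t = of_int (int k - int m * 2)" by (simp add: algebra_simps)
      thus False using ni by (metis Ints_of_int)
    qed
    hence "br f (br e ?u) \<noteq> 0" by (rule sl2_fe[OF s q' u Suc])
    thus ?case by (metis br_0_right comp_apply funpow.simps(2))
  qed (use v in simp)
  thus False using ad_nilpotent[OF Wt_lt[OF p(1)] Wt_nrm[OF p(1)] p(2,3) q v(1)] by blast
qed

lemma Ints_imp_Reals: "x \<in> \<int> \<Longrightarrow> x \<in> \<real>" for x :: complex
  by (auto elim!: Ints_cases)

text \<open>The trace formula is a sum of squares of real numbers with positive multiplicities, not
  all zero because weights separate \<open>h0\<close>.\<close>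

lemma kf_real_square:
  assumes "x \<in> h0" "\<And>q. q \<in> Wt \<Longrightarrow> fst q x \<in> \<real>" "x \<noteq> 0"
  shows "\<exists>c. c > 0 \<and> kf x x = of_real c"
proof -
  define r where "r q = Re (fst q x)" for q :: "('b \<Rightarrow> complex) \<times> nat"
  have r: "fst q x = of_real (r q)" if "q \<in> Wt" for q
    using of_real_Re[OF assms(2)[OF that]] by (simp add: r_def)
  have "kf x x = (\<Sum>q\<in>Wt. of_real (real (dim (wsp q)) * r q * r q))"
    unfolding kf_h0[OF assms(1,1)] by (rule sum.cong) (simp_all add: r)
  hence eq: "kf x x = of_real (\<Sum>q\<in>Wt. real (dim (wsp q)) * r q * r q)" by simp
  obtain q where q: "q \<in> Wt" "fst q x \<noteq> 0" using h0_separated[OF assms(1)] assms(3) by blast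
  have "dim (wsp q) > 0" using Wt_vec[OF q(1)] dim_eq_0[of "wsp q"] by (metis gr0I singletonD subsetD)
  moreover have "r q * r q > 0" using q r[OF q(1)] by (auto simp: zero_less_mult_iff linorder_neq_iff)
  ultimately have "0 < real (dim (wsp q)) * r q * r q" by (simp only: mult.assoc mult_pos_pos of_nat_0_less_iff)
  also have "\<dots> \<le> (\<Sum>q\<in>Wt. real (dim (wsp q)) * r q * r q)"
    by (rule member_le_sum[OF q(1)]) (simp_all add: D.finite_I mult.assoc)
  finally show ?thesis using eq by blast
qed

lemma sl2_kf_pos:
  assumes "sl2 p e f t"
  shows "\<exists>c. c > 0 \<and> kf e f = of_real c"
proof -
  have t: "t \<in> h0" "fst p t = 2" "f \<in> wsp (wneg p)" "br e f = t" "p \<in> Wt" using assms by (auto simp: sl2_def)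
  have "t \<noteq> 0" using weight_scale[OF t(5,1), of 0] t(2) by auto
  moreover have "fst q t \<in> \<real>" if "q \<in> Wt" for q
    by (rule Ints_imp_Reals[OF sl2_int[OF assms that]])
  ultimately obtain c where c: "c > 0" "kf t t = of_real c" using kf_real_square[OF t(1)] by blast
  have "kf t t = kf e f * 2" using kf_br_h0[OF t(3,1), of e] t by simp
  hence "kf e f = of_real (c / 2)" using c by simp
  thus ?thesis using c(1) by (intro exI[of _ "c / 2"]) auto
qed

section \<open>The positive definite form on the real span of the weights\<close>

definition dual :: "'b \<Rightarrow> ('b \<Rightarrow> complex) \<Rightarrow> bool" where
  "dual t \<phi> \<longleftrightarrow> t \<in> h0 \<and> nrm \<phi> \<and> (\<forall>x\<in>h0. kf t x = \<phi> x) \<and> (\<forall>q\<in>Wt. fst q t \<in> \<real>)"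

text \<open>Despite the name, this is a real vector space: the functionals represented under
  \<open>kf\<close> by elements of \<open>h0\<close> on which all weights are real.\<close>

definition lat :: "('b \<Rightarrow> complex) \<Rightarrow> bool" where
  "lat \<phi> \<longleftrightarrow> (\<exists>t. dual t \<phi>)"

text \<open>The representative is unique because \<open>kf\<close> is nondegenerate on
  \<open>h0\<close>. For arguments in \<open>lat\<close> the value is already real, and
  \<open>Re\<close> only adjusts the type.\<close>

definition ip :: "('b \<Rightarrow> complex) \<Rightarrow> ('b \<Rightarrow> complex) \<Rightarrow> real" where
  "ip \<phi> \<psi> = Re (\<phi> (SOME t. dual t \<psi>))"

lemma dual_add: "dual s \<phi> \<Longrightarrow> dual t \<psi> \<Longrightarrow> dual (s + t) (\<phi> + \<psi>)"
  by (auto simp: dual_def nrm_def kf_add_left weight_add intro: subspace_add[OF subspace_h0])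

lemma dual_minus: "dual s \<phi> \<Longrightarrow> dual (- s) (- \<phi>)"
  by (auto simp: dual_def nrm_def kf_minus_left weight_minus intro: subspace_neg[OF subspace_h0])

lemma dual_0: "dual 0 0"
  using weight_scale[OF _ subspace_0[OF subspace_h0], of _ 0]
  by (auto simp: dual_def nrm_def subspace_0[OF subspace_h0])

lemma lat_0 [simp]: "lat 0" and lat_add: "lat \<phi> \<Longrightarrow> lat \<psi> \<Longrightarrow> lat (\<phi> + \<psi>)" and lat_minus: "lat \<phi> \<Longrightarrow> lat (- \<phi>)"
  unfolding lat_def using dual_0 dual_add dual_minus by blast+

lemma lat_sum_list: "(\<And>\<phi>. \<phi> \<in> set xs \<Longrightarrow> lat \<phi>) \<Longrightarrow> lat (sum_list xs)"
  by (induction xs) (simp_all add: lat_add)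

lemma ip_dual:
  assumes "dual s \<phi>" "dual t \<psi>"
  shows "of_real (ip \<phi> \<psi>) = kf s t"
proof -
  define u where "u = (SOME t. dual t \<psi>)"
  have t: "dual u \<psi>" unfolding u_def by (rule someI[of "\<lambda>t. dual t \<psi>", OF assms(2)])
  have "kf u x = kf t x" if "x \<in> h0" for x using t assms(2) that by (simp add: dual_def)
  hence "kf (u - t) x = 0" if "x \<in> h0" for x using that by (simp add: kf_diff_left)
  moreover have "u - t \<in> h0" using t assms(2) subspace_h0 by (auto simp: dual_def intro: subspace_diff)
  ultimately have "u = t" using kf_h0_nondegenerate[of "u - t"] by simp
  hence "ip \<phi> \<psi> = Re (\<phi> t)" by (simp add: ip_def u_def)
  also have "\<phi> t = kf s t" using assms by (simp add: dual_def)
  finally have "ip \<phi> \<psi> = Re (kf s t)" .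
  moreover have "kf s t \<in> \<real>" using assms by (auto simp: dual_def kf_h0 intro!: sum_in_Reals Reals_mult)
  ultimately show ?thesis by simp
qed

lemma ip_sym: "lat \<phi> \<Longrightarrow> lat \<psi> \<Longrightarrow> ip \<phi> \<psi> = ip \<psi> \<phi>"
proof -
  assume "lat \<phi>" "lat \<psi>"
  then obtain s t where "dual s \<phi>" "dual t \<psi>" by (auto simp: lat_def)
  hence "complex_of_real (ip \<phi> \<psi>) = complex_of_real (ip \<psi> \<phi>)" using kf_sym[of s t] by (simp add: ip_dual)
  thus ?thesis by (simp only: of_real_eq_iff)
qed

lemma ip_add_left: "lat \<phi> \<Longrightarrow> lat \<phi>' \<Longrightarrow> lat \<psi> \<Longrightarrow> ip (\<phi> + \<phi>') \<psi> = ip \<phi> \<psi> + ip \<phi>' \<psi>"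
proof -
  assume "lat \<phi>" "lat \<phi>'" "lat \<psi>"
  then obtain s s' t where st: "dual s \<phi>" "dual s' \<phi>'" "dual t \<psi>" by (auto simp: lat_def)
  have "complex_of_real (ip (\<phi> + \<phi>') \<psi>) = complex_of_real (ip \<phi> \<psi> + ip \<phi>' \<psi>)"
    using ip_dual[OF dual_add[OF st(1,2)] st(3)] ip_dual[OF st(1,3)] ip_dual[OF st(2,3)]
    by (simp add: kf_add_left)
  thus ?thesis by (simp only: of_real_eq_iff)
qed

lemma ip_minus_left: "lat \<phi> \<Longrightarrow> lat \<psi> \<Longrightarrow> ip (- \<phi>) \<psi> = - ip \<phi> \<psi>"
  using ip_add_left[of \<phi> "- \<phi>" \<psi>] ip_add_left[of 0 0 \<psi>] by (simp add: lat_minus)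

lemma ip_0_left: "lat \<psi> \<Longrightarrow> ip 0 \<psi> = 0"
  using ip_add_left[of 0 0 \<psi>] by simp

lemma ip_minus_right: "lat \<phi> \<Longrightarrow> lat \<psi> \<Longrightarrow> ip \<psi> (- \<phi>) = - ip \<psi> \<phi>"
  using ip_minus_left[of \<phi> \<psi>] by (simp add: ip_sym[of \<psi>] lat_minus)

lemma ip_sum_list_left:
  "(\<And>\<phi>. \<phi> \<in> set xs \<Longrightarrow> lat \<phi>) \<Longrightarrow> lat \<psi> \<Longrightarrow> ip (sum_list xs) \<psi> = (\<Sum>\<phi>\<leftarrow>xs. ip \<phi> \<psi>)"
  by (induction xs) (simp_all add: ip_0_left ip_add_left lat_sum_list)

lemma ip_pos: "lat \<phi> \<Longrightarrow> \<phi> \<noteq> 0 \<Longrightarrow> ip \<phi> \<phi> > 0"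
proof -
  assume "lat \<phi>" and nz: "\<phi> \<noteq> 0"
  then obtain t where t: "dual t \<phi>" by (auto simp: lat_def)
  have "t \<noteq> 0"
  proof
    assume "t = 0"
    hence "\<phi> x = 0" for x using t by (cases "x \<in> h0") (auto simp: dual_def nrm_def)
    thus False using nz by (auto simp: fun_eq_iff)
  qed
  then obtain c where "c > 0" "kf t t = of_real c" using kf_real_square[of t] t by (auto simp: dual_def)
  thus ?thesis using ip_dual[OF t t] by (metis of_real_eq_iff)
qed

text \<open>The coroot divided by \<open>kf e f\<close> represents the weight; integrality and
  \<open>sl2_kf_pos\<close> keep all weights real on it.\<close>

lemma lat_weight: "p \<in> Wt \<Longrightarrow> lat (fst p)"
proof (cases "fst p = 0")
  case False
  assume p: "p \<in> Wt"
  obtain e where "e \<in> wsp p" "e \<noteq> 0" using Wt_vec[OF p] by blast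
  then obtain f t where s: "sl2 p e f t" using sl2_exists[OF p False] by blast
  then obtain c where c: "c > 0" "kf e f = of_real c" using sl2_kf_pos by blast
  have t: "t \<in> h0" "f \<in> wsp (wneg p)" "br e f = t" using s by (auto simp: sl2_def)
  have "dual ((1 / kf e f) *s t) (fst p)"
    unfolding dual_def
  proof (intro conjI ballI)
    show "(1 / kf e f) *s t \<in> h0" by (rule subspace_scale[OF subspace_h0 t(1)])
    show "nrm (fst p)" by (rule Wt_nrm[OF p])
    show "kf ((1 / kf e f) *s t) x = fst p x" if "x \<in> h0" for x
      using kf_br_h0[OF t(2) that, of e] t(3) c by (simp add: kf_scale_left)
    show "fst q ((1 / kf e f) *s t) \<in> \<real>" if "q \<in> Wt" for q
      using Ints_imp_Reals[OF sl2_int[OF s that]] c by (simp add: weight_scale[OF that t(1)])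
  qed
  thus ?thesis by (auto simp: lat_def)
qed simp

text \<open>The coroot is the positive multiple by \<open>kf e f\<close> of the element representing
  \<open>fst p\<close>, so the sign of \<open>ip\<close> can be fed into the nonvanishing
  criteria.\<close>

lemma sl2_ip:
  assumes s: "sl2 p e f t"
  shows "\<exists>c>0. \<forall>\<phi>. lat \<phi> \<longrightarrow> \<phi> t = of_real (c * ip \<phi> (fst p))"
proof -
  obtain c where c: "c > 0" "kf e f = of_real c" using sl2_kf_pos[OF s] by blast
  have t: "t \<in> h0" "f \<in> wsp (wneg p)" "br e f = t" "p \<in> Wt" using s by (auto simp: sl2_def)
  have "\<phi> t = of_real (c * ip \<phi> (fst p))" if "lat \<phi>" for \<phi>
  proof -
    obtain r where r: "dual r \<phi>" using \<open>lat \<phi>\<close> by (auto simp: lat_def)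
    obtain r' where r': "dual r' (fst p)" using lat_weight[OF t(4)] by (auto simp: lat_def)
    have rh: "r \<in> h0" using r by (simp add: dual_def)
    have "\<phi> t = kf r t" using r t(1) by (simp add: dual_def)
    also have "\<dots> = kf t r" by (rule kf_sym)
    also have "\<dots> = kf e f * fst p r" using kf_br_h0[OF t(2) rh, of e] t(3) by simp
    also have "fst p r = kf r' r" using r' rh by (simp add: dual_def)
    also have "\<dots> = of_real (ip \<phi> (fst p))" using ip_dual[OF r r'] kf_sym[of r r'] by simp
    finally show ?thesis using c by simp
  qed
  thus ?thesis using c(1) by blast
qed

lemma neg_real_not_Nats: "x < 0 \<Longrightarrow> complex_of_real x \<notin> \<nat>"
proof
  assume "x < 0" "complex_of_real x \<in> \<nat>"
  then obtain m where "complex_of_real x = of_nat m" by (auto simp: Nats_def)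
  hence "complex_of_real x = complex_of_real (real m)" by simp
  hence "x = real m" by (simp only: of_real_eq_iff)
  thus False using \<open>x < 0\<close> by simp
qed

lemma raise_nonzero:
  assumes p: "p \<in> Wt" "fst p \<noteq> 0" and x: "x \<in> wsp p" "x \<noteq> 0"
    and q: "q \<in> Wt" and v: "v \<in> wsp q" "v \<noteq> 0" and neg: "ip (fst q) (fst p) < 0"
  shows "br x v \<noteq> 0"
proof -
  obtain f t where s: "sl2 p x f t" using sl2_exists[OF p x] by blast
  obtain c where c: "c > 0" "\<And>\<phi>. lat \<phi> \<Longrightarrow> \<phi> t = of_real (c * ip \<phi> (fst p))" using sl2_ip[OF s] by blast
  have "fst q t \<notin> \<nat>"
    unfolding c(2)[OF lat_weight[OF q]] by (rule neg_real_not_Nats) (use c(1) neg in \<open>simp add: mult_pos_neg\<close>)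
  hence "br f (br x v) \<noteq> 0" by (rule sl2_fe[OF s q v])
  thus ?thesis by (metis br_0_right)
qed

text \<open>Only the functionals are opposite; the degrees need not cancel, so \<open>br x v\<close>
  is not confined to \<open>h0\<close>. The coroot values are -2, 0, 2. If the second bracket
  vanished, \<open>br x\<close> would kill \<open>br f (br x v)\<close>, a nonzero vector of value
  -2, against \<open>sl2_fe\<close>.\<close>

lemma raise_opposite:
  assumes p: "p \<in> Wt" "fst p \<noteq> 0" and x: "x \<in> wsp p" "x \<noteq> 0"
    and q: "q \<in> Wt" and v: "v \<in> wsp q" "v \<noteq> 0" and opp: "fst q = - fst p"
  shows "br x v \<noteq> 0" "br x (br x v) \<noteq> 0"
proof -
  obtain f t where s: "sl2 p x f t" using sl2_exists[OF p x] by blast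
  have t: "t \<in> h0" "f \<in> wsp (wneg p)" "br x f = t" "fst p t = 2" using s by (auto simp: sl2_def)
  have m2: "(- 2 :: complex) \<notin> \<nat>" using neg_real_not_Nats[of "- 2"] by simp
  have fqt: "fst q t = - 2" using opp t(4) by simp
  have fe: "br f (br x v) \<noteq> 0" by (rule sl2_fe[OF s q v]) (simp add: fqt m2)
  thus xv: "br x v \<noteq> 0" by (metis br_0_right)
  let ?u = "br x v"
  have u: "?u \<in> wsp (wadd p q)" by (intro br_wsp Wt_lt p q x v)
  have "br f ?u \<in> wsp (wadd (wneg p) (wadd p q))" by (intro br_wsp wneg_lt wadd_lt t u)
  moreover have "wadd (wneg p) (wadd p q) = q"
    using wadd_wneg[OF Wt_lt[OF p(1)]] wadd_0[OF Wt_lt[OF q]] by (metis wadd_commute wadd_assoc)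
  ultimately have fu: "br f ?u \<in> wsp q" by simp
  show "br x ?u \<noteq> 0"
  proof
    assume 0: "br x ?u = 0"
    have "br x (br f ?u) = br t ?u + br f (br x ?u)" using leibniz[of x f ?u] t(3) by simp
    also have "br t ?u = 0" using wsp_h0[OF t(1) u] opp by simp
    finally have "br x (br f ?u) = 0" using 0 by simp
    moreover have "br f (br x (br f ?u)) \<noteq> 0" by (rule sl2_fe[OF s q fu fe]) (simp add: fqt m2)
    ultimately show False by simp
  qed
qed

text \<open>Subtract the multiple of \<open>x\<close> that makes the pairing with \<open>f\<close>
  zero. The remainder \<open>?z\<close> then commutes with \<open>f\<close>, which its coroot value
  2 forbids for a nonzero vector.\<close>

lemma multiplicity_one:
  assumes p: "p \<in> Wt" "fst p \<noteq> 0" and x: "x \<in> wsp p" "x \<noteq> 0" and y: "y \<in> wsp p"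
  shows "\<exists>c. y = c *s x"
proof -
  obtain f t where s: "sl2 p x f t" using sl2_exists[OF p x] by blast
  have t: "t \<in> h0" "f \<in> wsp (wneg p)" "fst p t = 2" "kf x f \<noteq> 0" using s by (auto simp: sl2_def)
  let ?c = "kf y f / kf x f" let ?z = "y - ?c *s x"
  have z: "?z \<in> wsp p" by (intro subspace_diff subspace_scale subspace_wsp Wt_lt p x y)
  have "kf ?z f = 0" using t(4) by (simp add: kf_diff_left kf_scale_left)
  hence "br ?z f = 0"
    using kf_br_h0[OF t(2), of _ ?z] by (intro kf_h0_nondegenerate br_opposite_h0[OF Wt_lt[OF p(1)] z t(2)]) simp
  hence "br f ?z = 0" using br_skew[of f ?z] by simp
  moreover have "- fst p t \<notin> \<nat>" using neg_real_not_Nats[of "- 2"] t(3) by simp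
  ultimately have "?z = 0" using sl2_ef[OF s p(1) z] by (metis br_0_right)
  thus ?thesis by (intro exI[of _ ?c]) simp
qed

lemma wadd_wneg_cancel: "snd p < n \<Longrightarrow> snd q < n \<Longrightarrow> wadd (wneg p) (wadd p q) = q"
  using wadd_assoc[of "wneg p" p q] wadd_commute[of "wneg p" p] by (simp add: wadd_wneg wadd_0)

text \<open>When \<open>raise_nonzero\<close> does not apply, start from the sum: on
  \<open>wsp (wadd p q)\<close> the coroot value is at least 2, so lowering and then raising is
  nonzero there, and the lowered vector is a multiple of \<open>v\<close> by multiplicity
  one.\<close>

lemma br_nonzero:
  assumes p: "p \<in> Wt" "fst p \<noteq> 0" and x: "x \<in> wsp p" "x \<noteq> 0"
    and q: "q \<in> Wt" "fst q \<noteq> 0" and v: "v \<in> wsp q" "v \<noteq> 0" and pq: "wadd p q \<in> Wt"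
  shows "br x v \<noteq> 0"
proof (cases "ip (fst q) (fst p) < 0")
  case True
  thus ?thesis by (rule raise_nonzero[OF p x q(1) v])
next
  case False
  obtain f t where s: "sl2 p x f t" using sl2_exists[OF p x] by blast
  have t: "f \<in> wsp (wneg p)" "fst p t = 2" using s by (auto simp: sl2_def)
  obtain c where c: "c > 0" "\<And>\<phi>. lat \<phi> \<Longrightarrow> \<phi> t = of_real (c * ip \<phi> (fst p))" using sl2_ip[OF s] by blast
  obtain u where u: "u \<in> wsp (wadd p q)" "u \<noteq> 0" using Wt_vec[OF pq] by blast
  have "- fst (wadd p q) t = of_real (- 2 - c * ip (fst q) (fst p))"
    using c(2)[OF lat_weight[OF q(1)]] t(2) by simp
  moreover have "- 2 - c * ip (fst q) (fst p) < 0" using mult_nonneg_nonneg[of c "ip (fst q) (fst p)"] False c(1) by linarith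
  ultimately have "- fst (wadd p q) t \<notin> \<nat>" using neg_real_not_Nats by metis
  hence "br x (br f u) \<noteq> 0" by (rule sl2_ef[OF s pq u])
  moreover have "br f u \<in> wsp q"
    using br_wsp[OF wneg_lt wadd_lt t(1) u(1)] by (simp add: wadd_wneg_cancel Wt_lt p q)
  then obtain d where "br f u = d *s v" using multiplicity_one[OF q v] by blast
  ultimately show ?thesis by (metis br_scale_right scale_zero_right)
qed

lemma lower_Wt:
  assumes p: "p \<in> Wt" "fst p \<noteq> 0" and q: "q \<in> Wt" and pos: "ip (fst q) (fst p) > 0"
  shows "wadd (wneg p) q \<in> Wt"
proof -
  obtain x where x: "x \<in> wsp (wneg p)" "x \<noteq> 0" using Wt_vec[OF wneg_Wt[OF p(1)]] by blast
  obtain v where v: "v \<in> wsp q" "v \<noteq> 0" using Wt_vec[OF q] by blast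
  have "br x v \<noteq> 0"
    by (rule raise_nonzero[OF wneg_Wt[OF p(1)] _ x q v])
      (use p q pos in \<open>simp_all add: ip_minus_right lat_weight\<close>)
  thus ?thesis by (rule br_Wt[OF wneg_Wt[OF p(1)] q x(1) v(1)])
qed

text \<open>A vector of coroot value 0 killed by raising is invariant: for a nonzero
  \<open>br f v\<close>, of value -2, \<open>sl2_fe\<close> would make \<open>br x (br f v)\<close>
  nonzero, but the Leibniz rule gives 0.\<close>

lemma lowering_zero:
  assumes p: "p \<in> Wt" "fst p \<noteq> 0" and x: "x \<in> wsp p" "x \<noteq> 0"
    and q: "q \<in> Wt" and v: "v \<in> wsp q" and 0: "ip (fst q) (fst p) = 0" "br x v = 0" and y: "y \<in> wsp (wneg p)"
  shows "br y v = 0"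
proof -
  obtain f t where s: "sl2 p x f t" using sl2_exists[OF p x] by blast
  have t: "t \<in> h0" "f \<in> wsp (wneg p)" "br x f = t" "fst p t = 2" "kf x f \<noteq> 0" using s by (auto simp: sl2_def)
  obtain c where c: "c > 0" "\<And>\<phi>. lat \<phi> \<Longrightarrow> \<phi> t = of_real (c * ip \<phi> (fst p))" using sl2_ip[OF s] by blast
  have qt: "fst q t = 0" using c(2)[OF lat_weight[OF q]] 0 by simp
  have "f \<noteq> 0" using t(5) by auto
  then obtain d where d: "y = d *s f" using multiplicity_one[OF wneg_Wt[OF p(1)] _ t(2) _ y] p(2) by auto
  have "br f v = 0"
  proof (rule ccontr)
    assume nz: "br f v \<noteq> 0"
    have fv: "br f v \<in> wsp (wadd (wneg p) q)" by (intro br_wsp wneg_lt Wt_lt q t v)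
    have in': "wadd (wneg p) q \<in> Wt" by (rule br_Wt[OF wneg_Wt[OF p(1)] q t(2) v nz])
    have "fst (wadd (wneg p) q) t \<notin> \<nat>" using neg_real_not_Nats[of "- 2"] qt t(4) by simp
    hence "br f (br x (br f v)) \<noteq> 0" by (rule sl2_fe[OF s in' fv nz])
    moreover have "br x (br f v) = br t v + br f (br x v)" using leibniz[of x f v] t(3) by simp
    ultimately show False using 0 qt wsp_h0[OF t(1) v] by simp
  qed
  thus ?thesis using d by (simp add: br_scale_left)
qed

end

subsection \<open>Positive roots of a Borel subalgebra\<close>

lemma qplus_iff_list: "q \<in> qplus S \<longleftrightarrow> (\<exists>xs. set xs \<subseteq> S \<and> q = sum_list xs)"
proof
  assume "q \<in> qplus S"
  thus "\<exists>xs. set xs \<subseteq> S \<and> q = sum_list xs"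
  proof induction
    case qplus_zero
    show ?case by (rule exI[of _ "[]"]) simp
  next
    case (qplus_add \<alpha> q)
    then obtain xs where "set xs \<subseteq> S" "q = sum_list xs" by blast
    thus ?case using qplus_add by (intro exI[of _ "\<alpha> # xs"]) simp
  qed
next
  assume "\<exists>xs. set xs \<subseteq> S \<and> q = sum_list xs"
  then obtain xs where "set xs \<subseteq> S" "q = sum_list xs" by blast
  thus "q \<in> qplus S" by (induction xs arbitrary: q) (auto intro: qplus.intros)
qed

lemma qplus_add_closed: "p \<in> qplus S \<Longrightarrow> q \<in> qplus S \<Longrightarrow> p + q \<in> qplus S"
  by (induction rule: qplus.induct) (auto simp: add.assoc intro: qplus.intros)

lemma qplus_base: "\<alpha> \<in> S \<Longrightarrow> \<alpha> \<in> qplus S"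
  using qplus_add[OF _ qplus_zero] by fastforce

context lie_alg
begin

lemma br_span:
  assumes "x \<in> span S" "y \<in> span T" "subspace U" "\<And>x y. x \<in> S \<Longrightarrow> y \<in> T \<Longrightarrow> br x y \<in> U"
  shows "br x y \<in> U"
proof -
  have "br s y \<in> U" if "s \<in> S" for s
    using assms(2)
  proof (induction rule: span_induct_alt)
    case (step c t y)
    thus ?case using assms(3,4) that by (simp add: br_add_right br_scale_right subspace_add subspace_scale)
  qed (simp add: subspace_0[OF assms(3)])
  with assms(1) show ?thesis
  proof (induction rule: span_induct_alt)
    case (step c s x)
    thus ?case using assms(3) by (simp add: br_add_left br_scale_left subspace_add subspace_scale)
  qed (simp add: subspace_0[OF assms(3)])
qed

end

context graded_lie
begin

text \<open>Pairing a vanishing sum with one of its terms \<open>p\<close> produces another term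
  \<open>q\<close> with negative product; replacing both by \<open>wadd p q\<close> shortens the
  sum. It is applied to the positive roots and to the weights of a nilpotent subalgebra.\<close>

lemma zero_sum_free:
  assumes closed: "\<And>p q. p \<in> S \<Longrightarrow> q \<in> S \<Longrightarrow> wadd p q \<in> Wt \<Longrightarrow> fst p + fst q \<noteq> 0 \<Longrightarrow> wadd p q \<in> S"
    and noopp: "\<And>p q. p \<in> S \<Longrightarrow> q \<in> S \<Longrightarrow> fst p + fst q \<noteq> 0"
    and S: "\<And>p. p \<in> S \<Longrightarrow> p \<in> Wt \<and> fst p \<noteq> 0"
    and xs: "xs \<noteq> []" "set xs \<subseteq> S"
  shows "(\<Sum>p\<leftarrow>xs. fst p) \<noteq> 0"
  using xs
proof (induction "length xs" arbitrary: xs rule: less_induct)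
  case less
  then obtain p ys where xs: "xs = p # ys" by (cases xs) auto
  have p: "p \<in> S" and ys: "set ys \<subseteq> S" using less.prems xs by auto
  show ?case
  proof
    assume 0: "(\<Sum>p\<leftarrow>xs. fst p) = 0"
    have lat: "lat (fst q)" if "q \<in> set xs" for q using that less.prems S lat_weight by blast
    have "ip (\<Sum>p\<leftarrow>xs. fst p) (fst p) = (\<Sum>q\<leftarrow>xs. ip (fst q) (fst p))"
    proof -
      have "lat \<phi>" if "\<phi> \<in> set (map fst xs)" for \<phi> using that lat by auto
      moreover have "lat (fst p)" by (rule lat) (simp add: xs)
      ultimately show ?thesis using ip_sum_list_left[of "map fst xs" "fst p"] by (simp add: comp_def)
    qed
    hence "ip (fst p) (fst p) + (\<Sum>q\<leftarrow>ys. ip (fst q) (fst p)) = 0"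
      using 0 xs ip_0_left[of "fst p"] lat by simp
    moreover have "ip (fst p) (fst p) > 0" using ip_pos S p lat_weight by blast
    ultimately have "(\<Sum>q\<leftarrow>ys. ip (fst q) (fst p)) < 0" by linarith
    hence "\<not> (\<forall>q\<in>set ys. ip (fst q) (fst p) \<ge> 0)"
      using sum_list_nonneg[of "map (\<lambda>q. ip (fst q) (fst p)) ys"] by auto
    then obtain q where q: "q \<in> set ys" "ip (fst q) (fst p) < 0" by force
    have qS: "q \<in> S" using q ys by blast
    obtain x where x: "x \<in> wsp p" "x \<noteq> 0" using Wt_vec S p by blast
    obtain v where v: "v \<in> wsp q" "v \<noteq> 0" using Wt_vec S qS by blast
    have "br x v \<noteq> 0" using raise_nonzero[OF _ _ x _ v q(2)] S p qS by blast
    hence "wadd p q \<in> Wt" using br_Wt[OF _ _ x(1) v(1)] S p qS by blast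
    hence pq: "wadd p q \<in> S" using closed[OF p qS] noopp[OF p qS] by blast
    let ?zs = "wadd p q # remove1 q ys"
    have "length ?zs < length xs" using length_pos_if_in_set[OF q(1)] q(1) xs by (simp add: length_remove1)
    moreover have "set ?zs \<subseteq> S" using pq ys set_remove1_subset[of q ys] by auto
    moreover have "(\<Sum>p\<leftarrow>?zs. fst p) = (\<Sum>p\<leftarrow>xs. fst p)"
      using sum_list_map_remove1[OF q(1), of fst] xs by (simp add: add.assoc)
    ultimately show False using less.hyps[of ?zs] 0 by simp
  qed
qed

definition Phi :: "('b \<Rightarrow> complex) set" where
  "Phi = {\<alpha>. (\<alpha>, 0) \<in> Wt \<and> \<alpha> \<noteq> 0}"

lemma finite_Phi: "finite Phi"
  by (rule finite_subset[OF _ finite_imageI[OF D.finite_I, of fst]]) (force simp: Phi_def)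

lemma Phi_minus: "\<alpha> \<in> Phi \<Longrightarrow> - \<alpha> \<in> Phi"
  using wneg_Wt[of "(\<alpha>, 0)"] by (simp add: Phi_def wneg_def)

lemma wadd_00: "wadd (\<alpha>, 0) (\<beta>, 0) = (\<alpha> + \<beta>, 0)"
  by (simp add: wadd_def)

text \<open>The rank counts the roots of \<open>S\<close> lying below a given one; a bracket strictly increases it,
  so the derived series terminates.\<close>
lemma zero_sum_free_solvable:
  assumes S: "S \<subseteq> Phi" and closed: "\<And>\<alpha> \<beta>. \<alpha> \<in> S \<Longrightarrow> \<beta> \<in> S \<Longrightarrow> \<alpha> + \<beta> \<in> Phi \<Longrightarrow> \<alpha> + \<beta> \<in> S"
    and free: "\<And>xs. xs \<noteq> [] \<Longrightarrow> set xs \<subseteq> S \<Longrightarrow> sum_list xs \<noteq> 0"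
  defines "b \<equiv> span (h0 \<union> (\<Union>\<alpha>\<in>S. wsp (\<alpha>, 0)))"
  shows "solvable_lie scale br b" "b \<subseteq> gr 0"
proof -
  have finS: "finite S" using S finite_Phi finite_subset by blast
  define N where "N = {sum_list xs | xs. xs \<noteq> [] \<and> set xs \<subseteq> S}"
  have N0: "0 \<notin> N" using free by (auto simp: N_def)
  have NS: "\<alpha> \<in> N" if "\<alpha> \<in> S" for \<alpha>
    unfolding N_def using that by (intro CollectI exI[of _ "[\<alpha>]"]) simp
  have Nadd: "x + y \<in> N" if xy: "x \<in> N" "y \<in> N" for x y
  proof -
    obtain xs where "xs \<noteq> []" "set xs \<subseteq> S" "x = sum_list xs" using xy by (auto simp: N_def)
    moreover obtain ys where "set ys \<subseteq> S" "y = sum_list ys" using xy by (auto simp: N_def)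
    ultimately show ?thesis unfolding N_def by (intro CollectI exI[of _ "xs @ ys"]) auto
  qed
  define rk where "rk \<alpha> = card {\<delta> \<in> S. \<alpha> - \<delta> \<in> N}" for \<alpha>
  have rk_less: "rk \<alpha> < rk (\<alpha> + \<beta>)" if ab: "\<alpha> \<in> S" "\<beta> \<in> S" for \<alpha> \<beta>
    unfolding rk_def
  proof (rule psubset_card_mono)
    show "finite {\<delta> \<in> S. \<alpha> + \<beta> - \<delta> \<in> N}" using finS by simp
    have "\<alpha> + \<beta> - \<delta> \<in> N" if "\<alpha> - \<delta> \<in> N" for \<delta>
      using Nadd[OF that NS[OF ab(2)]] by (simp add: algebra_simps)
    moreover have "\<alpha> \<in> {\<delta> \<in> S. \<alpha> + \<beta> - \<delta> \<in> N}" using ab NS by simp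
    moreover have "\<alpha> \<notin> {\<delta> \<in> S. \<alpha> - \<delta> \<in> N}" using N0 by simp
    ultimately show "{\<delta> \<in> S. \<alpha> - \<delta> \<in> N} \<subset> {\<delta> \<in> S. \<alpha> + \<beta> - \<delta> \<in> N}" by blast
  qed
  define L where "L m = span (\<Union>\<alpha>\<in>{\<alpha> \<in> S. m \<le> rk \<alpha>}. wsp (\<alpha>, 0))" for m
  have subL: "subspace (L m)" for m by (simp add: L_def)
  have brL: "br x y \<in> L m'" if "\<alpha> \<in> S" "\<beta> \<in> S" "x \<in> wsp (\<alpha>, 0)" "y \<in> wsp (\<beta>, 0)" "m' \<le> Suc (rk \<alpha>)" for \<alpha> \<beta> x y m'
  proof (cases "br x y = 0")
    case False
    have Wt: "(\<alpha>, 0) \<in> Wt" "(\<beta>, 0) \<in> Wt" using that S by (auto simp: Phi_def)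
    have in': "br x y \<in> wsp (\<alpha> + \<beta>, 0)"
      using br_wsp[OF Wt_lt[OF Wt(1)] Wt_lt[OF Wt(2)] that(3,4)] by (simp add: wadd_00)
    have "\<alpha> + \<beta> \<noteq> 0" using free[of "[\<alpha>, \<beta>]"] that by simp
    hence "\<alpha> + \<beta> \<in> Phi" using br_Wt[OF Wt that(3,4) False] by (simp add: Phi_def wadd_00)
    hence "\<alpha> + \<beta> \<in> S" using closed that by blast
    moreover have "m' \<le> rk (\<alpha> + \<beta>)" using rk_less[OF that(1,2)] that(5) by simp
    ultimately show ?thesis using in' unfolding L_def by (intro span_base) blast
  qed (simp add: subspace_0[OF subL])
  have brL0: "br x y \<in> L 0" if xy: "x \<in> b" "y \<in> b" for x y
  proof (rule br_span[OF _ _ subL])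
    show "x \<in> span (h0 \<union> (\<Union>\<alpha>\<in>S. wsp (\<alpha>, 0)))" "y \<in> span (h0 \<union> (\<Union>\<alpha>\<in>S. wsp (\<alpha>, 0)))"
      using xy by (simp_all add: b_def)
    have hL: "br x y \<in> L 0" if "x \<in> h0" "y \<in> h0 \<union> (\<Union>\<alpha>\<in>S. wsp (\<alpha>, 0))" for x y
      using that
    proof (elim UnE)
      assume "y \<in> (\<Union>\<alpha>\<in>S. wsp (\<alpha>, 0))"
      then obtain \<alpha> where a: "\<alpha> \<in> S" "y \<in> wsp (\<alpha>, 0)" by blast
      hence "y \<in> L 0" unfolding L_def by (intro span_base) blast
      thus "br x y \<in> L 0" using wsp_h0[OF that(1) a(2)] subspace_scale[OF subL] by simp
    qed (simp add: h0_abelian subspace_0[OF subL])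
    fix x y assume "x \<in> h0 \<union> (\<Union>\<alpha>\<in>S. wsp (\<alpha>, 0))" "y \<in> h0 \<union> (\<Union>\<alpha>\<in>S. wsp (\<alpha>, 0))"
    thus "br x y \<in> L 0"
    proof (elim UnE)
      assume x: "x \<in> (\<Union>\<alpha>\<in>S. wsp (\<alpha>, 0))" and y: "y \<in> h0"
      have "br y x \<in> L 0" using hL x y by blast
      thus "br x y \<in> L 0" using br_skew[of x y] subspace_neg[OF subL] by simp
    qed (use hL brL in auto)
  qed
  have L0b: "L 0 \<subseteq> b" unfolding L_def b_def by (rule span_mono) blast
  have der: "derived scale br b (Suc m) \<subseteq> L m" for m
  proof (induction m)
    case 0
    have "{br x y | x y. x \<in> b \<and> y \<in> b} \<subseteq> L 0" using brL0 by blast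
    thus ?case by (simp add: span_minimal subL)
  next
    case (Suc m)
    have "br x y \<in> L (Suc m)" if xy: "x \<in> L m" "y \<in> L m" for x y
    proof (rule br_span[OF xy[unfolded L_def] subL])
      fix x y assume "x \<in> (\<Union>\<alpha>\<in>{\<alpha> \<in> S. m \<le> rk \<alpha>}. wsp (\<alpha>, 0))" "y \<in> (\<Union>\<alpha>\<in>{\<alpha> \<in> S. m \<le> rk \<alpha>}. wsp (\<alpha>, 0))"
      then obtain \<alpha> \<beta> where "\<alpha> \<in> S" "m \<le> rk \<alpha>" "x \<in> wsp (\<alpha>, 0)" "\<beta> \<in> S" "y \<in> wsp (\<beta>, 0)" by blast
      thus "br x y \<in> L (Suc m)" by (intro brL[of \<alpha> \<beta>]) simp_all
    qed
    hence "{br x y | x y. x \<in> derived scale br b (Suc m) \<and> y \<in> derived scale br b (Suc m)} \<subseteq> L (Suc m)"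
      using Suc by blast
    hence "span {br x y | x y. x \<in> derived scale br b (Suc m) \<and> y \<in> derived scale br b (Suc m)} \<subseteq> L (Suc m)"
      by (rule span_minimal[OF _ subL])
    thus ?case by simp
  qed
  have "rk \<alpha> \<le> card S" for \<alpha> unfolding rk_def by (rule card_mono[OF finS]) blast
  hence "{\<alpha> \<in> S. Suc (card S) \<le> rk \<alpha>} = {}" by (auto simp: not_less_eq_eq)
  hence "L (Suc (card S)) = {0}" unfolding L_def by (simp only: UN_empty span_empty)
  hence "derived scale br b (Suc (Suc (card S))) \<subseteq> {0}" using der[of "Suc (card S)"] by simp
  moreover have "0 \<in> derived scale br b (Suc (Suc (card S)))" by (simp add: span_zero)
  ultimately have "derived scale br b (Suc (Suc (card S))) = {0}" by blast
  moreover have "lie_subalg scale br b"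
    using brL0 L0b by (auto simp: lie_subalg_def b_def)
  ultimately show "solvable_lie scale br b" unfolding solvable_lie_def by blast
  show "b \<subseteq> gr 0"
    unfolding b_def by (rule span_minimal[OF _ subspace_gr[OF n_pos]]) (use h0_gr in \<open>auto simp: wsp_def\<close>)
qed

end

locale borel_lie = graded_lie scale Basis br h n gr h0
  for scale :: "complex \<Rightarrow> 'b \<Rightarrow> 'b::ab_group_add" (infixr "*s" 75) and Basis
    and br :: "'b \<Rightarrow> 'b \<Rightarrow> 'b" and h n gr h0 +
  fixes b0 :: "'b set"
  assumes borel: "borel_subalg scale br (gr 0) b0"
    and h0_b0: "h0 \<subseteq> b0"
begin

definition Ps :: "('b \<Rightarrow> complex) set" where
  "Ps = pos_roots0 scale br gr h0 b0"

definition Dl :: "('b \<Rightarrow> complex) set" where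
  "Dl = simple_roots0 scale br gr h0 b0"

lemma b0_gr: "b0 \<subseteq> gr 0" and subspace_b0: "subspace b0"
  and b0_br: "x \<in> b0 \<Longrightarrow> y \<in> b0 \<Longrightarrow> br x y \<in> b0"
  and b0_solvable: "solvable_lie scale br b0"
  and b0_maximal: "b0 \<subseteq> C \<Longrightarrow> C \<subseteq> gr 0 \<Longrightarrow> solvable_lie scale br C \<Longrightarrow> C = b0"
  using borel by (auto simp: borel_subalg_def solvable_lie_def lie_subalg_def)

lemma Ps_iff: "\<alpha> \<in> Ps \<longleftrightarrow> \<alpha> \<in> Phi \<and> wsp (\<alpha>, 0) \<subseteq> b0"
  using is_weight_Wt[OF n_pos] by (auto simp: Ps_def pos_roots0_def Phi_def wsp_def wvec_def)

lemma Ps_Phi: "Ps \<subseteq> Phi" and Dl_Ps: "Dl \<subseteq> Ps"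
  by (auto simp: Ps_iff Dl_def simple_roots0_def simp flip: Ps_def)

lemma PhiD: "\<alpha> \<in> Phi \<Longrightarrow> (\<alpha>, 0) \<in> Wt \<and> \<alpha> \<noteq> 0"
  by (simp add: Phi_def)

text \<open>Multiplicity one makes \<open>b0\<close> contain a root space as soon as it meets it
  nontrivially.\<close>

lemma b0_span: "b0 \<subseteq> span (h0 \<union> (\<Union>\<alpha>\<in>Ps. wsp (\<alpha>, 0)))"
proof -
  have "b0 \<subseteq> span (\<Union>\<mu>\<in>{\<mu>. (\<mu>, 0) \<in> Wt}. b0 \<inter> wsp (\<mu>, 0))"
    by (rule gr_wsp_span[OF n_pos subspace_b0 b0_gr]) (use b0_br h0_b0 in blast)
  also have "\<dots> \<subseteq> span (h0 \<union> (\<Union>\<alpha>\<in>Ps. wsp (\<alpha>, 0)))"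
  proof (rule span_minimal[OF _ subspace_span], rule subsetI)
    fix v assume "v \<in> (\<Union>\<mu>\<in>{\<mu>. (\<mu>, 0) \<in> Wt}. b0 \<inter> wsp (\<mu>, 0))"
    then obtain \<mu> where v: "(\<mu>, 0) \<in> Wt" "v \<in> b0" "v \<in> wsp (\<mu>, 0)" by blast
    show "v \<in> span (h0 \<union> (\<Union>\<alpha>\<in>Ps. wsp (\<alpha>, 0)))"
    proof (cases "v = 0 \<or> \<mu> = 0")
      case True
      thus ?thesis using v wsp_zero by (auto intro: span_base simp: span_zero)
    next
      case False
      hence "wsp (\<mu>, 0) \<subseteq> b0"
        using multiplicity_one[OF v(1) _ v(3)] v(2) subspace_scale[OF subspace_b0] by force
      hence "\<mu> \<in> Ps" using v(1) False by (simp add: Ps_iff Phi_def)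
      thus ?thesis using v(3) by (intro span_base) blast
    qed
  qed
  finally show ?thesis .
qed

text \<open>Two opposite root spaces in \<open>b0\<close> would give a copy of \<open>sl2\<close>,
  which survives in every term of the derived series.\<close>

lemma Ps_no_opposite: "\<alpha> \<in> Ps \<Longrightarrow> - \<alpha> \<notin> Ps"
proof
  assume a: "\<alpha> \<in> Ps" "- \<alpha> \<in> Ps"
  have aW: "(\<alpha>, 0) \<in> Wt" "\<alpha> \<noteq> 0" using a(1) by (auto simp: Ps_iff Phi_def)
  obtain e where e: "e \<in> wsp (\<alpha>, 0)" "e \<noteq> 0" using Wt_vec[OF aW(1)] by blast
  have "\<exists>f t. sl2 (\<alpha>, 0) e f t" by (rule sl2_exists[OF aW(1) _ e]) (simp add: aW)
  then obtain f t where s: "sl2 (\<alpha>, 0) e f t" by blast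
  have f: "f \<in> wsp (- \<alpha>, 0)" "br e f = t" "t \<in> h0" "\<alpha> t = 2"
    using s by (auto simp: sl2_def wneg_def)
  have te: "br t e = 2 *s e" "br t f = (- 2) *s f"
    using wsp_h0[OF f(3) e(1)] wsp_h0[OF f(3) f(1)] f(4) by simp_all
  have "e \<in> derived scale br b0 m \<and> f \<in> derived scale br b0 m \<and> t \<in> derived scale br b0 m" for m
  proof (induction m)
    case 0
    show ?case using a e(1) f h0_b0 by (auto simp: Ps_iff)
  next
    case (Suc m)
    have br: "br x y \<in> derived scale br b0 (Suc m)" if "x \<in> derived scale br b0 m" "y \<in> derived scale br b0 m" for x y
      using that by (simp, intro span_base) blast
    have sc: "c *s x \<in> derived scale br b0 (Suc m)" if "x \<in> derived scale br b0 (Suc m)" for c x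
      using that by (simp add: span_scale)
    \<comment> \<open>The scalars undo the eigenvalues 2 and -2 of \<open>br t\<close> on
      \<open>e\<close> and \<open>f\<close>.\<close>
    have "(1 / 2) *s br t e \<in> derived scale br b0 (Suc m)" "(- 1 / 2) *s br t f \<in> derived scale br b0 (Suc m)"
      using Suc by (intro sc br; blast)+
    moreover have "br e f \<in> derived scale br b0 (Suc m)" using Suc by (intro br) blast+
    ultimately show ?case using te f(2) by (simp del: derived.simps)
  qed
  moreover obtain m where "derived scale br b0 m = {0}" using b0_solvable by (auto simp: solvable_lie_def)
  ultimately show False using e(2) by blast
qed

lemma Ps_closed: "\<alpha> \<in> Ps \<Longrightarrow> \<beta> \<in> Ps \<Longrightarrow> \<alpha> + \<beta> \<in> Phi \<Longrightarrow> \<alpha> + \<beta> \<in> Ps"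
proof -
  assume ab: "\<alpha> \<in> Ps" "\<beta> \<in> Ps" "\<alpha> + \<beta> \<in> Phi"
  have W: "(\<alpha>, 0) \<in> Wt" "\<alpha> \<noteq> 0" "(\<beta>, 0) \<in> Wt" "\<beta> \<noteq> 0" using ab by (auto simp: Ps_iff Phi_def)
  obtain x where x: "x \<in> wsp (\<alpha>, 0)" "x \<noteq> 0" using Wt_vec[OF W(1)] by blast
  obtain y where y: "y \<in> wsp (\<beta>, 0)" "y \<noteq> 0" using Wt_vec[OF W(3)] by blast
  have "br x y \<noteq> 0" using W ab(3) by (intro br_nonzero[OF W(1) _ x W(3) _ y]) (auto simp: wadd_00 Phi_def)
  moreover have "br x y \<in> wsp (\<alpha> + \<beta>, 0)" using br_wsp[OF Wt_lt[OF W(1)] Wt_lt[OF W(3)] x(1) y(1)] by (simp add: wadd_00)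
  moreover have "br x y \<in> b0" using x y ab by (intro b0_br) (auto simp: Ps_iff)
  ultimately have "wsp (\<alpha> + \<beta>, 0) \<subseteq> b0"
    using multiplicity_one[of "(\<alpha> + \<beta>, 0)" "br x y"] PhiD[OF ab(3)] subspace_scale[OF subspace_b0] by force
  thus ?thesis using ab(3) by (simp add: Ps_iff)
qed

lemma Ps_zero_sum_free:
  assumes "xs \<noteq> []" "set xs \<subseteq> Ps"
  shows "sum_list xs \<noteq> 0"
proof -
  have "(\<Sum>p\<leftarrow>map (\<lambda>\<alpha>. (\<alpha>, 0 :: nat)) xs. fst p) \<noteq> 0"
  proof (rule zero_sum_free[of "(\<lambda>\<alpha>. (\<alpha>, 0)) ` Ps"])
    fix p q :: "('b \<Rightarrow> complex) \<times> nat"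
    assume pq: "p \<in> (\<lambda>\<alpha>. (\<alpha>, 0)) ` Ps" "q \<in> (\<lambda>\<alpha>. (\<alpha>, 0)) ` Ps"
    then obtain \<alpha> \<beta> where ab: "p = (\<alpha>, 0)" "q = (\<beta>, 0)" "\<alpha> \<in> Ps" "\<beta> \<in> Ps" by blast
    show "wadd p q \<in> (\<lambda>\<alpha>. (\<alpha>, 0)) ` Ps" if "wadd p q \<in> Wt" "fst p + fst q \<noteq> 0"
      using that ab Ps_closed[OF ab(3,4)] by (simp add: wadd_00 Phi_def)
    show "fst p + fst q \<noteq> 0"
      using Ps_no_opposite[OF ab(3)] ab by (auto simp: eq_neg_iff_add_eq_0[symmetric] minus_equation_iff)
  next
    fix p :: "('b \<Rightarrow> complex) \<times> nat" assume "p \<in> (\<lambda>\<alpha>. (\<alpha>, 0)) ` Ps"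
    thus "p \<in> Wt \<and> fst p \<noteq> 0" using Ps_Phi PhiD by auto
  qed (use assms in auto)
  thus ?thesis by (simp add: comp_def)
qed

text \<open>Separates the copies of \<open>\<gamma>\<close> from the other terms. The clause for
  \<open>a = 0\<close> lets a list without \<open>\<gamma>\<close> be refuted by
  \<open>Ps_zero_sum_free\<close>.\<close>

lemma sum_list_insert:
  assumes "set xs \<subseteq> insert \<gamma> S" "\<gamma> \<notin> S"
  shows "\<exists>us a. set us \<subseteq> S \<and> (a = 0 \<longrightarrow> us = xs) \<and> (\<forall>x. sum_list xs x = sum_list us x + of_nat a * (\<gamma> x :: complex))"
  using assms(1)
proof (induction xs)
  case Nil
  show ?case by (rule exI[of _ "[]"], rule exI[of _ 0]) simp
next
  case (Cons \<beta> xs)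
  hence "set xs \<subseteq> insert \<gamma> S" by simp
  from Cons.IH[OF this] obtain us a where
    u: "set us \<subseteq> S \<and> (a = 0 \<longrightarrow> us = xs) \<and> (\<forall>x. sum_list xs x = sum_list us x + of_nat a * \<gamma> x)"
    by (elim exE)
  show ?case
  proof (cases "\<beta> = \<gamma>")
    case True
    thus ?thesis using u by (intro exI[of _ us] exI[of _ "Suc a"]) (simp add: algebra_simps)
  next
    case False
    thus ?thesis using u Cons.prems by (intro exI[of _ "\<beta> # us"] exI[of _ a]) (simp add: algebra_simps)
  qed
qed

lemma sum_list_copies: "sum_list (concat (replicate k us)) x = of_nat k * (sum_list us x :: complex)"
  by (induction k) (simp_all add: algebra_simps)

lemma set_copies: "set (concat (replicate k us)) \<subseteq> set us"
  by (induction k) auto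

text \<open>If neither \<open>\<alpha>\<close> nor \<open>- \<alpha>\<close> were positive, then one of them could be adjoined without creating
  a vanishing sum, and the resulting larger subalgebra would still be solvable.\<close>
lemma Phi_Ps:
  assumes \<alpha>: "\<alpha> \<in> Phi"
  shows "\<alpha> \<in> Ps \<or> - \<alpha> \<in> Ps"
proof (rule ccontr)
  assume no: "\<not> ?thesis"
  have a0: "\<alpha> \<noteq> 0" using \<alpha> by (simp add: Phi_def)
  have "\<exists>\<gamma>\<in>{\<alpha>, - \<alpha>}. \<forall>xs. xs \<noteq> [] \<and> set xs \<subseteq> insert \<gamma> Ps \<longrightarrow> sum_list xs \<noteq> 0"
  proof (rule ccontr)
    assume "\<not> ?thesis"
    then obtain xs ys where xs: "xs \<noteq> []" "set xs \<subseteq> insert \<alpha> Ps" "sum_list xs = 0"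
      and ys: "ys \<noteq> []" "set ys \<subseteq> insert (- \<alpha>) Ps" "sum_list ys = 0" by auto
    have nP: "\<alpha> \<notin> Ps" "- \<alpha> \<notin> Ps" using no by auto
    from sum_list_insert[OF xs(2) nP(1)] obtain us a where
      us': "set us \<subseteq> Ps \<and> (a = 0 \<longrightarrow> us = xs) \<and> (\<forall>x. sum_list xs x = sum_list us x + of_nat a * \<alpha> x)" by (elim exE)
    hence us: "set us \<subseteq> Ps" "a = 0 \<longrightarrow> us = xs" "\<And>x. sum_list xs x = sum_list us x + of_nat a * \<alpha> x" by simp_all
    from sum_list_insert[OF ys(2) nP(2)] obtain vs b where
      vs': "set vs \<subseteq> Ps \<and> (b = 0 \<longrightarrow> vs = ys) \<and> (\<forall>x. sum_list ys x = sum_list vs x + of_nat b * (- \<alpha>) x)" by (elim exE)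
    hence vs: "set vs \<subseteq> Ps" "b = 0 \<longrightarrow> vs = ys" "\<And>x. sum_list ys x = sum_list vs x + of_nat b * (- \<alpha>) x" by simp_all
    have "a \<noteq> 0" using us xs Ps_zero_sum_free by blast
    have "b \<noteq> 0" using vs ys Ps_zero_sum_free by blast
    \<comment> \<open>The multiplicities balance: the terms of \<open>us\<close> sum to
      \<open>- a * \<alpha>\<close> and those of \<open>vs\<close> to
      \<open>b * \<alpha>\<close>.\<close>
    let ?ws = "concat (replicate b us) @ concat (replicate a vs)"
    have "us \<noteq> []"
    proof
      assume "us = []"
      hence "of_nat a * \<alpha> x = 0" for x using us(3)[of x] xs(3) by simp
      thus False using \<open>a \<noteq> 0\<close> a0 by (auto simp: fun_eq_iff)
    qed
    hence "?ws \<noteq> []" using \<open>b \<noteq> 0\<close> by (cases b) auto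
    moreover have "set ?ws \<subseteq> Ps" using us(1) vs(1) set_copies[of b us] set_copies[of a vs] by auto
    moreover have "sum_list ?ws x = 0" for x
    proof -
      have "sum_list us x = - (of_nat a * \<alpha> x)" "sum_list vs x = of_nat b * \<alpha> x"
        using us(3)[of x] vs(3)[of x] xs(3) ys(3) by (simp_all add: eq_neg_iff_add_eq_0)
      thus ?thesis by (simp add: sum_list_copies)
    qed
    ultimately show False using Ps_zero_sum_free[of ?ws] by (auto simp: fun_eq_iff)
  qed
  then obtain \<gamma> where \<gamma>: "\<gamma> = \<alpha> \<or> \<gamma> = - \<alpha>"
    "\<And>xs. xs \<noteq> [] \<Longrightarrow> set xs \<subseteq> insert \<gamma> Ps \<Longrightarrow> sum_list xs \<noteq> 0" by blast
  define N where "N = {sum_list xs | xs. xs \<noteq> [] \<and> set xs \<subseteq> insert \<gamma> Ps}"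
  have NS: "\<beta> \<in> N" if "\<beta> \<in> insert \<gamma> Ps" for \<beta>
    unfolding N_def using that by (intro CollectI exI[of _ "[\<beta>]"]) simp
  have Nadd: "x + y \<in> N" if xy: "x \<in> N" "y \<in> N" for x y
  proof -
    obtain xs where "xs \<noteq> []" "set xs \<subseteq> insert \<gamma> Ps" "x = sum_list xs" using xy by (auto simp: N_def)
    moreover obtain ys where "set ys \<subseteq> insert \<gamma> Ps" "y = sum_list ys" using xy by (auto simp: N_def)
    ultimately show ?thesis unfolding N_def by (intro CollectI exI[of _ "xs @ ys"]) auto
  qed
  \<comment> \<open>Taking all roots in the semigroup \<open>N\<close> makes the set closed under
    sums; adjoining \<open>\<gamma>\<close> alone to \<open>Ps\<close> need not.\<close>
  let ?S = "Phi \<inter> N"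
  let ?b = "span (h0 \<union> (\<Union>\<beta>\<in>?S. wsp (\<beta>, 0)))"
  have free: "sum_list xs \<noteq> 0" if "xs \<noteq> []" "set xs \<subseteq> ?S" for xs
  proof -
    have "sum_list xs \<in> N" using that
    proof (induction xs rule: list_nonempty_induct)
      case (cons x xs)
      have "x + sum_list xs \<in> N" by (rule Nadd) (use cons in auto)
      thus ?case by (simp only: sum_list.Cons)
    qed simp
    thus ?thesis using \<gamma>(2) by (auto simp: N_def)
  qed
  have "solvable_lie scale br ?b" "?b \<subseteq> gr 0"
    using zero_sum_free_solvable[of ?S] Nadd free by auto
  moreover have "b0 \<subseteq> ?b"
    by (rule order_trans[OF b0_span span_mono]) (use NS Ps_Phi in blast)
  ultimately have "?b = b0" by (intro b0_maximal)
  moreover have \<gamma>P: "\<gamma> \<in> Phi" using \<gamma>(1) \<alpha> Phi_minus by auto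
  hence "\<gamma> \<in> ?S" using NS by simp
  hence "wsp (\<gamma>, 0) \<subseteq> h0 \<union> (\<Union>\<beta>\<in>?S. wsp (\<beta>, 0))" by blast
  hence "wsp (\<gamma>, 0) \<subseteq> ?b" by (rule order_trans[OF _ span_superset])
  ultimately have "\<gamma> \<in> Ps" using \<gamma>P by (simp add: Ps_iff)
  thus False using \<gamma>(1) no by auto
qed

text \<open>Induction on the number of positive roots that differ from \<open>\<alpha>\<close> by a
  nonempty sum of positive roots; it drops strictly for either summand of a decomposable
  root.\<close>

lemma Ps_qplus: "\<alpha> \<in> Ps \<Longrightarrow> \<alpha> \<in> qplus Dl"
proof (induction "card {\<delta> \<in> Ps. \<exists>xs. xs \<noteq> [] \<and> set xs \<subseteq> Ps \<and> \<alpha> - \<delta> = sum_list xs}" arbitrary: \<alpha> rule: less_induct)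
  case less
  show ?case
  proof (cases "\<alpha> \<in> Dl")
    case False
    then obtain \<beta> \<gamma> where bg: "\<beta> \<in> Ps" "\<gamma> \<in> Ps" "\<alpha> = \<beta> + \<gamma>"
      using less.prems by (auto simp: Dl_def simple_roots0_def simp flip: Ps_def)
    have *: "\<beta> \<in> qplus Dl" if bg: "\<beta> \<in> Ps" "\<gamma> \<in> Ps" "\<alpha> = \<beta> + \<gamma>" for \<beta> \<gamma>
    proof (rule less.hyps[OF psubset_card_mono bg(1)])
      show "finite {\<delta> \<in> Ps. \<exists>xs. xs \<noteq> [] \<and> set xs \<subseteq> Ps \<and> \<alpha> - \<delta> = sum_list xs}"
        using finite_subset[OF Ps_Phi finite_Phi] by simp
      have "\<exists>ys. ys \<noteq> [] \<and> set ys \<subseteq> Ps \<and> \<alpha> - \<delta> = sum_list ys" if "xs \<noteq> []" "set xs \<subseteq> Ps" "\<beta> - \<delta> = sum_list xs" for \<delta> xs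
        using that bg by (intro exI[of _ "\<gamma> # xs"]) (simp add: algebra_simps flip: that(3))
      moreover have "\<beta> \<in> {\<delta> \<in> Ps. \<exists>xs. xs \<noteq> [] \<and> set xs \<subseteq> Ps \<and> \<alpha> - \<delta> = sum_list xs}"
        using bg by (auto intro!: exI[of _ "[\<gamma>]"])
      moreover have "\<beta> \<notin> {\<delta> \<in> Ps. \<exists>xs. xs \<noteq> [] \<and> set xs \<subseteq> Ps \<and> \<beta> - \<delta> = sum_list xs}"
        using Ps_zero_sum_free by force
      ultimately show "{\<delta> \<in> Ps. \<exists>xs. xs \<noteq> [] \<and> set xs \<subseteq> Ps \<and> \<beta> - \<delta> = sum_list xs}
          \<subset> {\<delta> \<in> Ps. \<exists>xs. xs \<noteq> [] \<and> set xs \<subseteq> Ps \<and> \<alpha> - \<delta> = sum_list xs}" by blast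
    qed
    show ?thesis unfolding bg(3) using *[OF bg] *[OF bg(2,1)] bg(3) by (intro qplus_add_closed) (auto simp: add.commute)
  qed (rule qplus_base)
qed

lemma qplus_antisym: "q \<in> qplus Dl \<Longrightarrow> - q \<in> qplus Dl \<Longrightarrow> q = 0"
proof -
  assume "q \<in> qplus Dl" "- q \<in> qplus Dl"
  then obtain xs ys where xs: "set xs \<subseteq> Dl" "q = sum_list xs" and ys: "set ys \<subseteq> Dl" "- q = sum_list ys"
    by (auto simp: qplus_iff_list)
  have "sum_list (xs @ ys) = 0" using xs(2) ys(2) by (metis add.right_inverse sum_list_append)
  hence "xs @ ys = []" using Ps_zero_sum_free[of "xs @ ys"] xs(1) ys(1) Dl_Ps by (metis le_supI set_append subset_trans)
  thus "q = 0" using xs(2) by simp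
qed

end

subsection \<open>From nilpotent subalgebras to antichains\<close>

lemma psum_Cons: "psum n (p # ps) = (fst p + fst (psum n ps), (snd p + snd (psum n ps)) mod n)"
  by (simp add: psum_def mod_add_right_eq)

lemma psum_remove1:
  fixes ps :: "('c::ab_group_add \<times> nat) list"
  shows "p \<in> set ps \<Longrightarrow> psum n ps = psum n (p # remove1 p ps)"
  using sum_list_map_remove1[of p ps fst] sum_list_map_remove1[of p ps snd] by (simp add: psum_def)

lemma preceq0_refl [simp]: "preceq0 S p p"
  by (simp add: preceq0_def qplus_zero)

lemma preceq0_trans: "preceq0 S p q \<Longrightarrow> preceq0 S q r \<Longrightarrow> preceq0 S p r"
  using qplus_add_closed[of "fst q - fst p" S "fst r - fst q"] by (simp add: preceq0_def)

context graded_lie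
begin

lemma psum_wadd: "psum n (p # ps) = wadd p (psum n ps)"
  by (simp add: psum_Cons wadd_def)

lemma snd_psum_lt: "snd (psum n ps) < n"
  using n_pos by (simp add: psum_def)

text \<open>Adding \<open>p\<close> twice to a pair with functional \<open>- fst p\<close> restores
  \<open>fst p\<close> and moves the degree by \<open>snd p + snd q\<close>; the same holds with
  \<open>p\<close> and \<open>q\<close> exchanged, so both chains advance together.\<close>

lemma opposite_chain:
  assumes closed: "\<And>p q. p \<in> S \<Longrightarrow> q \<in> S \<Longrightarrow> fst p \<noteq> 0 \<Longrightarrow> fst q = - fst p \<Longrightarrow> wadd p (wadd p q) \<in> S"
    and S: "p \<in> S" "q \<in> S" "fst p \<noteq> 0" "fst q = - fst p" "snd p < n" "snd q < n"
  shows "(fst p, (snd p + m * (snd p + snd q)) mod n) \<in> S \<and> (fst q, (snd q + m * (snd p + snd q)) mod n) \<in> S"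
proof (induction m)
  case 0
  show ?case using S(1,2,5,6) by simp
next
  case (Suc m)
  have fp: "fst p + (fst p + fst q) = fst p" "fst q + (fst q + fst p) = fst q" "fst q \<noteq> 0" "fst p = - fst q"
    using S(3,4) by simp_all
  have eq: "wadd r (wadd r (\<nu>, (b + m * c) mod n)) = (fst r, (snd r + Suc m * c) mod n)"
    if "c = snd r + b" "fst r + (fst r + \<nu>) = fst r" for r b c \<nu>
  proof -
    have "(snd r + (snd r + (b + m * c) mod n) mod n) mod n = (snd r + (snd r + (b + m * c))) mod n"
      by (simp add: mod_simps)
    also have "snd r + (snd r + (b + m * c)) = snd r + Suc m * c" using that(1) by simp
    finally show ?thesis using that(2) by (simp add: wadd_def)
  qed
  have "wadd p (wadd p (fst q, (snd q + m * (snd p + snd q)) mod n)) \<in> S"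
    by (rule closed[OF S(1) conjunct2[OF Suc] S(3)]) (simp only: fst_conv S(4))
  moreover have "wadd q (wadd q (fst p, (snd p + m * (snd p + snd q)) mod n)) \<in> S"
    by (rule closed[OF S(2) conjunct1[OF Suc] fp(3)]) (simp only: fst_conv fp(4)[symmetric])
  ultimately show ?case
    using eq[OF _ fp(1), of "snd p + snd q" "snd q"] eq[OF _ fp(2), of "snd p + snd q" "snd p"] by simp
qed

end

context borel_lie
begin

lemma preceq0_antisym: "preceq0 Dl p q \<Longrightarrow> preceq0 Dl q p \<Longrightarrow> p = q"
  using qplus_antisym[of "fst q - fst p"] by (simp add: preceq0_def prod_eq_iff)

lemma exists_minimal:
  assumes "finite S" "p \<in> S"
  shows "\<exists>a\<in>minimal_elems Dl S. preceq0 Dl a p"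
  using assms(2)
proof (induction "card {q \<in> S. preceq0 Dl q p}" arbitrary: p rule: less_induct)
  case less
  show ?case
  proof (cases "p \<in> minimal_elems Dl S")
    case False
    then obtain q where q: "q \<in> S" "preceq0 Dl q p" "q \<noteq> p" using less.prems by (auto simp: minimal_elems_def)
    have "card {r \<in> S. preceq0 Dl r q} < card {r \<in> S. preceq0 Dl r p}"
    proof (rule psubset_card_mono)
      have "p \<notin> {r \<in> S. preceq0 Dl r q}" using q preceq0_antisym by blast
      moreover have "p \<in> {r \<in> S. preceq0 Dl r p}" using less.prems by simp
      moreover have "{r \<in> S. preceq0 Dl r q} \<subseteq> {r \<in> S. preceq0 Dl r p}" using q(2) preceq0_trans by blast
      ultimately show "{r \<in> S. preceq0 Dl r q} \<subset> {r \<in> S. preceq0 Dl r p}" by blast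
    qed (use assms in simp)
    then obtain a where "a \<in> minimal_elems Dl S" "preceq0 Dl a q" using less.hyps q(1) by blast
    thus ?thesis using q(2) preceq0_trans by blast
  qed (use preceq0_refl in blast)
qed

lemma Ps_lat: "\<beta> \<in> Ps \<Longrightarrow> lat \<beta>"
  using lat_weight[of "(\<beta>, 0)"] PhiD Ps_Phi by auto

lemma Ps_sum_qplus: "set ys \<subseteq> Ps \<Longrightarrow> sum_list ys \<in> qplus Dl"
  by (induction ys) (auto intro: qplus_zero qplus_add_closed Ps_qplus)

lemma qplus_Ps: "q \<in> qplus Dl \<Longrightarrow> \<exists>ys. set ys \<subseteq> Ps \<and> q = sum_list ys"
  using Dl_Ps unfolding qplus_iff_list by blast

lemma exists_pos_summand:
  assumes "\<And>\<phi>. \<phi> \<in> set xs \<Longrightarrow> lat \<phi>" "lat \<psi>" "ip (sum_list xs) \<psi> > 0"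
  shows "\<exists>\<phi>\<in>set xs. ip \<phi> \<psi> > 0"
proof (rule ccontr)
  assume "\<not> ?thesis"
  hence "\<forall>\<phi>\<in>set xs. ip \<phi> \<psi> \<le> 0" by force
  hence "(\<Sum>\<phi>\<leftarrow>xs. ip \<phi> \<psi>) \<le> 0" by (intro sum_list_nonpos) auto
  thus False using assms ip_sum_list_left[of xs \<psi>] by simp
qed

end

section \<open>Weights of a nilpotent graded subalgebra\<close>

locale nilp_subalg = borel_lie scale Basis br h n gr h0 b0
  for scale :: "complex \<Rightarrow> 'b \<Rightarrow> 'b::ab_group_add" (infixr "*s" 75) and Basis
    and br :: "'b \<Rightarrow> 'b \<Rightarrow> 'b" and h n gr h0 b0 +
  fixes k :: nat and I :: "'b set"
  assumes kn: "kn_pg_b0_subalg scale br n gr b0 k I"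
begin

lemma I_br: "x \<in> I \<Longrightarrow> y \<in> I \<Longrightarrow> br x y \<in> I"
  and I_b0: "x \<in> b0 \<Longrightarrow> y \<in> I \<Longrightarrow> br x y \<in> I"
  and I_nilp: "length xs = k \<Longrightarrow> set xs \<subseteq> I \<Longrightarrow> y \<in> I \<Longrightarrow> itbr br xs y = 0"
  and I_graded: "x \<in> I \<Longrightarrow> \<exists>f. (\<forall>j\<in>{1..<n}. f j \<in> I \<inter> gr j) \<and> x = (\<Sum>j\<in>{1..<n}. f j)"
  using kn by (auto simp: kn_pg_b0_subalg_def lie_subalg_def)

text \<open>The graded components of an element of \<open>I\<close> have degrees 1 to
  \<open>n - 1\<close>, so uniqueness of the decomposition excludes a nonzero element of degree
  0.\<close>

lemma I_gr0: "x \<in> I \<Longrightarrow> x \<in> gr 0 \<Longrightarrow> x = 0"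
proof -
  assume x: "x \<in> I" "x \<in> gr 0"
  obtain f where f: "\<forall>j\<in>{1..<n}. f j \<in> I \<inter> gr j" "x = (\<Sum>j\<in>{1..<n}. f j)" using I_graded[OF x(1)] by blast
  let ?f = "\<lambda>j. if j = 0 then 0 else f j"
  have "{..<n} = insert 0 {1..<n}" using n_pos by auto
  hence "(\<Sum>j<n. ?f j) = (\<Sum>j\<in>{1..<n}. ?f j)" by simp
  also have "\<dots> = x" unfolding f(2) by (rule sum.cong) auto
  finally have "?f 0 = (if 0 = (0::nat) then x else 0)"
    using f(1) subspace_0[OF subspace_gr[OF n_pos]]
    by (intro gr_component_eq[OF n_pos x(2)]) (auto simp: n_pos)
  thus ?thesis by simp
qed

definition Gw :: "(('b \<Rightarrow> complex) \<times> nat) set" where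
  "Gw = {p \<in> Wt. \<exists>v\<in>I \<inter> wsp p. v \<noteq> 0}"

lemma grwt_eq: "grwt scale br n gr h0 I = Gw"
  unfolding grwt_def is_weight_iff Gw_def Wt_def by auto

lemma Gw_Wt: "p \<in> Gw \<Longrightarrow> p \<in> Wt" and Gw_vec: "p \<in> Gw \<Longrightarrow> \<exists>v\<in>I. v \<in> wsp p \<and> v \<noteq> 0"
  by (auto simp: Gw_def)

lemma finite_Gw: "finite Gw"
  by (rule finite_subset[OF _ D.finite_I]) (use Gw_Wt in blast)

lemma Gw_lat: "p \<in> Gw \<Longrightarrow> lat (fst p)"
  using Gw_Wt lat_weight by blast

lemma Gw_degree: "p \<in> Gw \<Longrightarrow> snd p \<noteq> 0"
proof
  assume "p \<in> Gw" "snd p = 0"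
  then obtain v where "v \<in> I" "v \<in> gr 0" "v \<noteq> 0" by (auto simp: Gw_def wsp_def)
  thus False using I_gr0 by blast
qed

lemma Gw_I: "p \<in> Wt \<Longrightarrow> v \<in> I \<Longrightarrow> v \<in> wsp p \<Longrightarrow> v \<noteq> 0 \<Longrightarrow> p \<in> Gw"
  by (auto simp: Gw_def)

lemma Gw_br:
  assumes "p \<in> Gw" "q \<in> Wt" "x \<in> I" "x \<in> wsp p" "y \<in> I" "y \<in> wsp q" "br x y \<noteq> 0"
  shows "wadd p q \<in> Gw"
  using assms br_Wt[OF Gw_Wt[OF assms(1)] assms(2,4,6,7)] br_wsp[OF Wt_lt[OF Gw_Wt[OF assms(1)]] Wt_lt[OF assms(2)] assms(4,6)]
  by (intro Gw_I[of _ "br x y"] I_br)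

lemma Gw_raise:
  assumes "\<beta> \<in> Ps" "(\<mu>, j) \<in> Gw" "ip \<mu> \<beta> < 0"
  shows "(\<mu> + \<beta>, j) \<in> Gw"
proof -
  have bW: "(\<beta>, 0) \<in> Wt" "\<beta> \<noteq> 0" and bb: "wsp (\<beta>, 0) \<subseteq> b0" using assms(1) by (auto simp: Ps_iff Phi_def)
  obtain e where e: "e \<in> wsp (\<beta>, 0)" "e \<noteq> 0" using Wt_vec[OF bW(1)] by blast
  obtain v where v: "v \<in> I" "v \<in> wsp (\<mu>, j)" "v \<noteq> 0" using Gw_vec[OF assms(2)] by blast
  have W: "(\<mu>, j) \<in> Wt" by (rule Gw_Wt[OF assms(2)])
  have nz: "br e v \<noteq> 0" by (rule raise_nonzero[OF bW(1) _ e W v(2,3)]) (use bW assms(3) in simp_all)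
  have eq: "wadd (\<beta>, 0) (\<mu>, j) = (\<mu> + \<beta>, j)" using Wt_lt[OF W] by (simp add: wadd_def add.commute)
  have "(\<mu> + \<beta>, j) \<in> Wt" using br_Wt[OF bW(1) W e(1) v(2) nz] eq by simp
  moreover have "br e v \<in> wsp (\<mu> + \<beta>, j)" using br_wsp[OF Wt_lt[OF bW(1)] Wt_lt[OF W] e(1) v(2)] eq by simp
  moreover have "br e v \<in> I" using e(1) bb v(1) by (intro I_b0) auto
  ultimately show ?thesis using nz by (intro Gw_I)
qed

text \<open>The chain with \<open>m = n - 1\<close> yields weight vectors of \<open>I\<close> of opposite degrees, whose bracket is
  a nonzero element of \<open>I \<inter> gr 0\<close>.\<close>
lemma Gw_no_opposite:
  assumes "p \<in> Gw" "q \<in> Gw" "fst p \<noteq> 0"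
  shows "fst p + fst q \<noteq> 0"
proof
  assume "fst p + fst q = 0"
  hence opp: "fst q = - fst p" by (simp add: eq_neg_iff_add_eq_0 add.commute)
  let ?c = "snd p + snd q"
  have "(fst p, (snd p + (n - 1) * ?c) mod n) \<in> Gw \<and> (fst q, (snd q + (n - 1) * ?c) mod n) \<in> Gw"
  proof (rule opposite_chain)
    fix p q assume pq: "p \<in> Gw" "q \<in> Gw" "fst p \<noteq> 0" "fst q = - fst p"
    obtain x where x: "x \<in> I" "x \<in> wsp p" "x \<noteq> 0" using Gw_vec[OF pq(1)] by blast
    obtain y where y: "y \<in> I" "y \<in> wsp q" "y \<noteq> 0" using Gw_vec[OF pq(2)] by blast
    note nz = raise_opposite[OF Gw_Wt[OF pq(1)] pq(3) x(2,3) Gw_Wt[OF pq(2)] y(2,3) pq(4)]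
    have "wadd p q \<in> Gw" by (rule Gw_br[OF pq(1) Gw_Wt[OF pq(2)] x(1,2) y(1,2) nz(1)])
    moreover have "br x y \<in> wsp (wadd p q)" by (intro br_wsp Wt_lt Gw_Wt pq x y)
    ultimately show "wadd p (wadd p q) \<in> Gw"
      using Gw_br[OF pq(1) Gw_Wt x(1,2) I_br[OF x(1) y(1)] _ nz(2)] by blast
  qed (use assms opp Wt_lt Gw_Wt in auto)
  hence q': "(fst q, (snd q + (n - 1) * ?c) mod n) \<in> Gw" (is "?q \<in> _") by blast
  obtain x where x: "x \<in> I" "x \<in> wsp p" "x \<noteq> 0" using Gw_vec[OF assms(1)] by blast
  obtain y where y: "y \<in> I" "y \<in> wsp ?q" "y \<noteq> 0" using Gw_vec[OF q'] by blast
  have "br x y \<noteq> 0"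
    by (rule raise_opposite[OF Gw_Wt[OF assms(1)] assms(3) x(2,3) Gw_Wt[OF q'] y(2,3)]) (simp add: opp)
  hence "wadd p ?q \<in> Gw" by (rule Gw_br[OF assms(1) Gw_Wt[OF q'] x(1,2) y(1,2)])
  moreover have "snd (wadd p ?q) = 0"
  proof -
    have "snd p + (snd q + (n - 1) * ?c) = n * ?c" using n_pos by (cases n) simp_all
    thus ?thesis by (simp add: wadd_def mod_add_right_eq)
  qed
  ultimately show False using Gw_degree by blast
qed

lemma Gw_sum_nonzero:
  assumes "ps \<noteq> []" "set ps \<subseteq> Gw" "\<And>p. p \<in> set ps \<Longrightarrow> fst p \<noteq> 0"
  shows "(\<Sum>p\<leftarrow>ps. fst p) \<noteq> 0"
proof (rule zero_sum_free[of "{p \<in> Gw. fst p \<noteq> 0}"])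
  fix p q assume pq: "p \<in> {p \<in> Gw. fst p \<noteq> 0}" "q \<in> {p \<in> Gw. fst p \<noteq> 0}"
  show "fst p + fst q \<noteq> 0" using pq Gw_no_opposite by blast
  show "wadd p q \<in> {p \<in> Gw. fst p \<noteq> 0}" if W: "wadd p q \<in> Wt" "fst p + fst q \<noteq> 0"
  proof -
    obtain x where x: "x \<in> I" "x \<in> wsp p" "x \<noteq> 0" using Gw_vec pq by blast
    obtain y where y: "y \<in> I" "y \<in> wsp q" "y \<noteq> 0" using Gw_vec pq by blast
    have "br x y \<noteq> 0" by (rule br_nonzero[OF _ _ x(2,3) _ _ y(2,3) W(1)]) (use pq Gw_Wt in auto)
    hence "wadd p q \<in> Gw" using Gw_br[of p q x y] pq x y Gw_Wt by blast
    thus ?thesis using W(2) by simp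
  qed
qed (use assms Gw_Wt in auto)

text \<open>As long as \<open>\<alpha>\<close> is nonzero, some \<open>\<beta>\<close> in the list
  has negative product with it, and raising by \<open>\<beta>\<close> shortens the list; the last
  weight before 0 is a negative root.\<close>

lemma climb:
  assumes "set ys \<subseteq> Ps" "(\<alpha>, j) \<in> Gw" "\<alpha> = - sum_list ys" "\<alpha> \<noteq> 0"
  shows "\<exists>\<beta>\<in>Ps. (- \<beta>, j) \<in> Gw"
  using assms
proof (induction "length ys" arbitrary: ys \<alpha> rule: less_induct)
  case less
  have lat: "lat \<alpha>" using Gw_lat[OF less.prems(2)] by simp
  have laty: "lat \<phi>" if "\<phi> \<in> set ys" for \<phi> using that less.prems(1) Ps_lat by blast
  have "sum_list ys = - \<alpha>" using less.prems(3) by simp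
  hence "ip (sum_list ys) (- \<alpha>) > 0" using ip_pos[of "- \<alpha>"] less.prems(4) lat_minus[OF lat] by simp
  then obtain \<beta> where b: "\<beta> \<in> set ys" "ip \<beta> (- \<alpha>) > 0"
    using exists_pos_summand[OF laty lat_minus[OF lat]] by blast
  have bP: "\<beta> \<in> Ps" using b less.prems(1) by blast
  have "ip \<alpha> \<beta> < 0" using b(2) ip_minus_right[OF lat laty[OF b(1)]] ip_sym[OF lat laty[OF b(1)]] by simp
  hence G: "(\<alpha> + \<beta>, j) \<in> Gw" by (rule Gw_raise[OF bP less.prems(2)])
  show ?case
  proof (cases "\<alpha> + \<beta> = 0")
    case True
    hence "\<alpha> = - \<beta>" by (simp add: eq_neg_iff_add_eq_0)
    thus ?thesis using less.prems(2) bP by blast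
  next
    case False
    have "length (remove1 \<beta> ys) < length ys"
      using length_pos_if_in_set[OF b(1)] b(1) by (simp add: length_remove1)
    moreover have "\<alpha> + \<beta> = - sum_list (remove1 \<beta> ys)"
      using sum_list_map_remove1[OF b(1), of "\<lambda>x. x"] less.prems(3) by simp
    moreover have "set (remove1 \<beta> ys) \<subseteq> Ps" using less.prems(1) set_remove1_subset by fastforce
    ultimately show ?thesis using less.hyps[of "remove1 \<beta> ys" "\<alpha> + \<beta>"] G False by blast
  qed
qed

text \<open>If the functional 0 occurred, a minimal weight below it would climb to some
  \<open>- \<beta>\<close>, and raising twice by a root vector of \<open>\<beta>\<close> would cross
  to \<open>\<beta>\<close> in the same degree, an opposite pair of weights of
  \<open>I\<close>.\<close>

lemma Gw_nonzero:
  assumes "minimal_elems Dl Gw \<subseteq> Sigma_plus scale br n gr h0" "p \<in> Gw"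
  shows "fst p \<noteq> 0"
proof
  assume 0: "fst p = 0"
  obtain a where a: "a \<in> minimal_elems Dl Gw" "preceq0 Dl a p" using exists_minimal[OF finite_Gw assms(2)] by blast
  have a0: "fst a \<noteq> 0" using a(1) assms(1) by (auto simp: Sigma_plus_def)
  obtain ys where ys: "set ys \<subseteq> Ps" "- fst a = sum_list ys"
    using a(2) 0 qplus_Ps[of "- fst a"] by (auto simp: preceq0_def)
  have "fst a = - sum_list ys" using ys(2) by (metis minus_minus)
  moreover have "(fst a, snd a) \<in> Gw" using a(1) by (simp add: minimal_elems_def)
  ultimately obtain \<beta> where b: "\<beta> \<in> Ps" "(- \<beta>, snd a) \<in> Gw" using climb[OF ys(1)] a0 by blast
  have bW: "(\<beta>, 0) \<in> Wt" "\<beta> \<noteq> 0" and bb: "wsp (\<beta>, 0) \<subseteq> b0" using b(1) by (auto simp: Ps_iff Phi_def)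
  obtain e where e: "e \<in> wsp (\<beta>, 0)" "e \<noteq> 0" using Wt_vec[OF bW(1)] by blast
  obtain v where v: "v \<in> I" "v \<in> wsp (- \<beta>, snd a)" "v \<noteq> 0" using Gw_vec[OF b(2)] by blast
  have W: "(- \<beta>, snd a) \<in> Wt" by (rule Gw_Wt[OF b(2)])
  have e0: "fst (\<beta>, 0::nat) \<noteq> 0" "fst (- \<beta>, snd a) = - fst (\<beta>, 0::nat)" using bW by simp_all
  note nz = raise_opposite[OF bW(1) e0(1) e W v(2,3) e0(2)]
  have eq: "wadd (\<beta>, 0) (wadd (\<beta>, 0) (- \<beta>, snd a)) = (\<beta>, snd a)" using Wt_lt[OF W] by (simp add: wadd_def)
  have 1: "br e v \<in> wsp (wadd (\<beta>, 0) (- \<beta>, snd a))" by (intro br_wsp Wt_lt bW W e v)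
  have 2: "wadd (\<beta>, 0) (- \<beta>, snd a) \<in> Wt" by (rule br_Wt[OF bW(1) W e(1) v(2) nz(1)])
  have "(\<beta>, snd a) \<in> Wt" using br_Wt[OF bW(1) 2 e(1) 1 nz(2)] eq by simp
  moreover have "br e (br e v) \<in> wsp (\<beta>, snd a)" using br_wsp[OF Wt_lt[OF bW(1)] Wt_lt[OF 2] e(1) 1] eq by simp
  moreover have "br e (br e v) \<in> I" using e(1) bb v(1) by (intro I_b0) auto
  ultimately have "(\<beta>, snd a) \<in> Gw" using nz(2) by (intro Gw_I)
  thus False using Gw_no_opposite[OF _ b(2), of "(\<beta>, snd a)"] bW(2) by simp
qed

text \<open>By positive definiteness some positive root \<open>\<beta>\<close> in the difference has positive product with it;
  then \<open>\<beta>\<close> can be subtracted from the target \<open>lam\<close> or added to one of the summands.\<close>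
lemma push_up:
  assumes "set ps \<subseteq> Gw" "(lam, j) \<in> Wt" "j = snd (psum n ps)" "set ys \<subseteq> Ps" "lam - fst (psum n ps) = sum_list ys"
  shows "\<exists>qs \<nu>. length qs = length ps \<and> set qs \<subseteq> Gw \<and> psum n qs = (\<nu>, j) \<and> (\<nu>, j) \<in> Wt \<and> lam - \<nu> \<in> qplus Dl"
  using assms
proof (induction "length ys" arbitrary: ys ps lam rule: less_induct)
  case less
  show ?case
  proof (cases "ys = []")
    case True
    hence "psum n ps = (lam, j)" using less.prems by (simp add: prod_eq_iff)
    thus ?thesis using less.prems qplus_zero[of Dl] by (intro exI[of _ ps] exI[of _ lam]) simp
  next
    case False
    have laty: "lat \<phi>" if "\<phi> \<in> set ys" for \<phi> using that less.prems(4) Ps_lat by blast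
    have latk: "lat (sum_list ys)" by (rule lat_sum_list) (rule laty)
    have "sum_list ys \<noteq> 0" by (rule Ps_zero_sum_free[OF False less.prems(4)])
    then obtain \<beta> where b: "\<beta> \<in> set ys" "ip \<beta> (sum_list ys) > 0"
      using exists_pos_summand[OF laty latk ip_pos[OF latk]] by blast
    have bP: "\<beta> \<in> Ps" and latb: "lat \<beta>" using b laty less.prems(4) by auto
    have bW: "(\<beta>, 0) \<in> Wt" "\<beta> \<noteq> 0" using bP by (auto simp: Ps_iff Phi_def)
    let ?ys = "remove1 \<beta> ys"
    have len: "length ?ys < length ys"
      using length_pos_if_in_set[OF b(1)] b(1) by (simp add: length_remove1)
    have sy: "sum_list ys = \<beta> + sum_list ?ys" using sum_list_map_remove1[OF b(1), of "\<lambda>x. x"] by simp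
    have setys: "set ?ys \<subseteq> Ps" using less.prems(4) set_remove1_subset by fastforce
    have jn: "j < n" using Wt_lt[OF less.prems(2)] by simp
    show ?thesis
    proof (cases "ip lam \<beta> > 0")
      case True
      have "wadd (wneg (\<beta>, 0)) (lam, j) \<in> Wt" by (rule lower_Wt[OF bW(1) _ less.prems(2)]) (use True bW in simp_all)
      hence W: "(lam - \<beta>, j) \<in> Wt" using jn by (simp add: wadd_def wneg_def)
      have "lam - \<beta> - fst (psum n ps) = sum_list ?ys" using less.prems(5) sy by (simp add: algebra_simps)
      then obtain qs \<nu> where "length qs = length ps" "set qs \<subseteq> Gw" "psum n qs = (\<nu>, j)" "(\<nu>, j) \<in> Wt" and q: "lam - \<beta> - \<nu> \<in> qplus Dl"
        using less.hyps[OF len less.prems(1) W less.prems(3) setys] by blast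
      moreover have "lam - \<nu> \<in> qplus Dl"
        using qplus_add_closed[OF Ps_qplus[OF bP] q] by (simp add: algebra_simps)
      ultimately show ?thesis by blast
    next
      case False
      have latps: "lat \<phi>" if "\<phi> \<in> set (map fst ps)" for \<phi> using that less.prems(1) Gw_lat by auto
      have latS: "lat (fst (psum n ps))" unfolding psum_def fst_conv by (rule lat_sum_list) (rule latps)
      have "lam = sum_list ys + fst (psum n ps)" using less.prems(5) by (metis diff_add_cancel)
      hence "ip lam \<beta> = ip (sum_list ys) \<beta> + ip (fst (psum n ps)) \<beta>" by (simp only: ip_add_left[OF latk latS latb])
      \<comment> \<open>\<open>\<beta>\<close> has positive product with the difference but not with
        \<open>lam\<close>, so its product with the sum of the \<open>ps\<close> is
        negative.\<close>
      hence "ip (fst (psum n ps)) \<beta> < 0" using False b(2) ip_sym[OF latb latk] by simp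
      hence "ip (sum_list (map fst ps)) (- \<beta>) > 0"
        using latS by (simp add: psum_def ip_minus_right[OF latb])
      then obtain \<mu> where "\<mu> \<in> set (map fst ps)" "ip \<mu> (- \<beta>) > 0"
        using exists_pos_summand[OF latps lat_minus[OF latb]] by blast
      then obtain p where p: "p \<in> set ps" "ip (fst p) (- \<beta>) > 0" by auto
      hence "ip (fst p) \<beta> < 0" using ip_minus_right[OF latb, of "fst p"] latps by simp
      hence pG: "(fst p + \<beta>, snd p) \<in> Gw" using Gw_raise[OF bP, of "fst p" "snd p"] p(1) less.prems(1) by auto
      let ?ps = "(fst p + \<beta>, snd p) # remove1 p ps"
      have eq: "psum n ?ps = (fst (psum n ps) + \<beta>, snd (psum n ps))"
        unfolding psum_remove1[OF p(1)] psum_Cons by (simp add: algebra_simps)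
      have set': "set ?ps \<subseteq> Gw" using pG less.prems(1) set_remove1_subset by fastforce
      have j': "j = snd (psum n ?ps)" using less.prems(3) eq by simp
      have "lam - fst (psum n ?ps) = sum_list ?ys"
        using less.prems(5) sy eq by (simp add: algebra_simps)
      moreover have "length ?ps = length ps" using p(1) length_pos_if_in_set[OF p(1)] by (simp add: length_remove1)
      ultimately show ?thesis using less.hyps[OF len set' less.prems(2) j' setys] by simp
    qed
  qed
qed

text \<open>The outermost factor is a summand with positive product with the total: by
  \<open>lower_Wt\<close> the sum of the others is then still a weight, and
  \<open>br_nonzero\<close> applies because no partial sum has functional 0.\<close>

lemma iterated_bracket:
  assumes "ps \<noteq> []" "set ps \<subseteq> Gw" "\<And>p. p \<in> Gw \<Longrightarrow> fst p \<noteq> 0" "psum n ps \<in> Wt"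
  shows "\<exists>xs y. length ps = Suc (length xs) \<and> set xs \<subseteq> I \<and> y \<in> I \<and> itbr br xs y \<noteq> 0 \<and> itbr br xs y \<in> I \<inter> wsp (psum n ps)"
  using assms(1,2,4)
proof (induction "length ps" arbitrary: ps rule: less_induct)
  case less
  have latps: "lat \<phi>" if "\<phi> \<in> set (map fst ps)" for \<phi> using that less.prems(2) Gw_lat by auto
  have nz: "fst (psum n qs) \<noteq> 0" if "qs \<noteq> []" "set qs \<subseteq> Gw" for qs
    using Gw_sum_nonzero[OF that] that assms(3) by (auto simp: psum_def)
  have latS: "lat (fst (psum n ps))" unfolding psum_def fst_conv by (rule lat_sum_list) (rule latps)
  have "ip (sum_list (map fst ps)) (fst (psum n ps)) > 0"
    using ip_pos[OF latS nz[OF less.prems(1,2)]] by (simp add: psum_def)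
  then obtain \<mu> where "\<mu> \<in> set (map fst ps)" "ip \<mu> (fst (psum n ps)) > 0"
    using exists_pos_summand[OF latps latS] by blast
  then obtain p where p: "p \<in> set ps" "ip (fst p) (fst (psum n ps)) > 0" by auto
  have pG: "p \<in> Gw" using p less.prems by blast
  obtain x where x: "x \<in> I" "x \<in> wsp p" "x \<noteq> 0" using Gw_vec[OF pG] by blast
  let ?qs = "remove1 p ps"
  have eq: "psum n ps = wadd p (psum n ?qs)" using psum_remove1[OF p(1)] psum_wadd by metis
  have len: "length ps = Suc (length ?qs)"
    using length_pos_if_in_set[OF p(1)] p(1) by (simp add: length_remove1)
  show ?case
  proof (cases "?qs = []")
    case True
    hence "psum n ps = wadd p (0, 0)" using eq by (simp add: psum_def)
    hence "psum n ps = p" using wadd_0[OF Wt_lt[OF Gw_Wt[OF pG]]] by (simp add: wadd_commute)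
    thus ?thesis using x len True by (intro exI[of _ "[]"] exI[of _ x]) simp
  next
    case False
    have qsG: "set ?qs \<subseteq> Gw" using less.prems(2) set_remove1_subset by fastforce
    have "wadd (wneg p) (psum n ps) \<in> Wt"
      by (rule lower_Wt[OF Gw_Wt[OF pG] assms(3)[OF pG] less.prems(3)])
        (use p ip_sym[OF latS Gw_lat[OF pG]] in simp)
    hence qW: "psum n ?qs \<in> Wt"
      unfolding eq by (simp add: wadd_wneg_cancel Wt_lt[OF Gw_Wt[OF pG]] snd_psum_lt)
    obtain xs y where xs: "length ?qs = Suc (length xs)" "set xs \<subseteq> I" "y \<in> I" "itbr br xs y \<noteq> 0" "itbr br xs y \<in> I \<inter> wsp (psum n ?qs)"
      using less.hyps[OF _ False qsG qW] len by auto
    have "wadd p (psum n ?qs) \<in> Wt" using less.prems(3) eq by simp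
    hence "br x (itbr br xs y) \<noteq> 0"
      using br_nonzero[OF Gw_Wt[OF pG] assms(3)[OF pG] x(2,3) qW nz[OF False qsG] _ xs(4)] xs(5) by blast
    moreover have "br x (itbr br xs y) \<in> I \<inter> wsp (psum n ps)"
      using br_wsp[OF Wt_lt[OF Gw_Wt[OF pG]] snd_psum_lt x(2), of "itbr br xs y" ?qs] I_br[OF x(1)] xs(5) eq by auto
    ultimately show ?thesis using xs x len by (intro exI[of _ "x # xs"] exI[of _ y]) auto
  qed
qed

text \<open>All three parts come from \<open>key\<close>, which realizes a relation of this kind by
  a nonzero bracket in \<open>I\<close>. The upper bounds are arbitrary weights; highest weights and
  highest roots are special cases.\<close>

theorem nilp_subalg_antichain:
  assumes A: "A = minimal_elems Dl (grwt scale br n gr h0 I)" "A \<subseteq> Sigma_plus scale br n gr h0"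
  shows "length xs = k + 1 \<Longrightarrow> set xs \<subseteq> A \<Longrightarrow> (lam, snd (psum n xs)) \<in> Wt
      \<Longrightarrow> \<not> preceq0 Dl (psum n xs) (lam, snd (psum n xs))"
    and "xs \<noteq> [] \<Longrightarrow> set xs \<subseteq> A \<Longrightarrow> snd (psum n xs) = 0 \<Longrightarrow> (\<theta>, 0) \<in> Wt
      \<Longrightarrow> \<not> preceq0 Dl (psum n xs) (\<theta>, 0)"
    and "p1 \<in> A \<Longrightarrow> p2 \<in> A \<Longrightarrow> (\<nu>, snd (psum n [p1, p2])) \<in> Wt
      \<Longrightarrow> preceq0 Dl (psum n [p1, p2]) (\<nu>, snd (psum n [p1, p2]))
      \<Longrightarrow> \<exists>\<alpha>. (\<alpha>, snd (psum n [p1, p2])) \<in> A \<and> preceq0 Dl (\<alpha>, snd (psum n [p1, p2])) (\<nu>, snd (psum n [p1, p2]))"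
proof -
  have Gnz: "fst p \<noteq> 0" if "p \<in> Gw" for p using Gw_nonzero[OF _ that] A by (simp add: grwt_eq)
  have AG: "A \<subseteq> Gw" using A(1) by (auto simp: grwt_eq minimal_elems_def)
  have key: "\<exists>ys y \<nu>. length xs = Suc (length ys) \<and> set ys \<subseteq> I \<and> y \<in> I \<and> itbr br ys y \<noteq> 0
      \<and> itbr br ys y \<in> I \<inter> wsp (\<nu>, snd (psum n xs)) \<and> (\<nu>, snd (psum n xs)) \<in> Wt \<and> lam - \<nu> \<in> qplus Dl"
    if xs: "xs \<noteq> []" "set xs \<subseteq> A" "(lam, snd (psum n xs)) \<in> Wt" "preceq0 Dl (psum n xs) (lam, snd (psum n xs))" for xs lam
  proof -
    obtain zs where zs: "set zs \<subseteq> Ps" "lam - fst (psum n xs) = sum_list zs"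
      using qplus_Ps xs(4) by (auto simp: preceq0_def)
    obtain qs \<nu> where qs: "length qs = length xs" "set qs \<subseteq> Gw" "psum n qs = (\<nu>, snd (psum n xs))"
      "(\<nu>, snd (psum n xs)) \<in> Wt" "lam - \<nu> \<in> qplus Dl"
      using push_up[OF order_trans[OF xs(2) AG] xs(3) refl zs] by blast
    have "qs \<noteq> []" using qs(1) xs(1) by auto
    then obtain ys y where "length qs = Suc (length ys)" "set ys \<subseteq> I" "y \<in> I" "itbr br ys y \<noteq> 0" "itbr br ys y \<in> I \<inter> wsp (psum n qs)"
      using iterated_bracket[of qs] qs Gnz by auto
    thus ?thesis using qs by (intro exI[of _ ys] exI[of _ y] exI[of _ \<nu>]) simp
  qed
  show "\<not> preceq0 Dl (psum n xs) (lam, snd (psum n xs))"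
    if xs: "length xs = k + 1" "set xs \<subseteq> A" "(lam, snd (psum n xs)) \<in> Wt"
  proof
    assume "preceq0 Dl (psum n xs) (lam, snd (psum n xs))"
    moreover have "xs \<noteq> []" using that(1) by auto
    ultimately obtain ys y where "length xs = Suc (length ys)" "set ys \<subseteq> I" "y \<in> I" "itbr br ys y \<noteq> 0"
      using key xs(2,3) by blast
    \<comment> \<open>\<open>k + 1\<close> summands make \<open>k\<close> nested brackets applied to
      one vector.\<close>
    thus False using I_nilp xs(1) by simp
  qed
  show "\<not> preceq0 Dl (psum n xs) (\<theta>, 0)"
    if xs: "xs \<noteq> []" "set xs \<subseteq> A" "snd (psum n xs) = 0" "(\<theta>, 0) \<in> Wt"
  proof
    assume "preceq0 Dl (psum n xs) (\<theta>, 0)"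
    then obtain ys y \<nu> where "itbr br ys y \<noteq> 0" "itbr br ys y \<in> I \<inter> wsp (\<nu>, 0)"
      using key[OF xs(1,2), of \<theta>] xs(3,4) by auto
    thus False using I_gr0 by (auto simp: wsp_def)
  qed
  show "\<exists>\<alpha>. (\<alpha>, snd (psum n [p1, p2])) \<in> A \<and> preceq0 Dl (\<alpha>, snd (psum n [p1, p2])) (\<nu>, snd (psum n [p1, p2]))"
    if p: "p1 \<in> A" "p2 \<in> A" "(\<nu>, snd (psum n [p1, p2])) \<in> Wt" "preceq0 Dl (psum n [p1, p2]) (\<nu>, snd (psum n [p1, p2]))"
  proof -
    let ?j = "snd (psum n [p1, p2])"
    obtain ys y \<nu>' where "itbr br ys y \<noteq> 0" "itbr br ys y \<in> I \<inter> wsp (\<nu>', ?j)" and W: "(\<nu>', ?j) \<in> Wt" "\<nu> - \<nu>' \<in> qplus Dl"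
      using key[of "[p1, p2]" \<nu>] p by auto
    hence "(\<nu>', ?j) \<in> Gw" by (intro Gw_I) auto
    then obtain a where a: "a \<in> A" "preceq0 Dl a (\<nu>', ?j)"
      unfolding A(1) grwt_eq using exists_minimal[OF finite_Gw] by blast
    hence "a = (fst a, ?j)" by (simp add: preceq0_def prod_eq_iff)
    moreover have "preceq0 Dl (\<nu>', ?j) (\<nu>, ?j)" using W(2) by (simp add: preceq0_def)
    hence "preceq0 Dl a (\<nu>, ?j)" by (rule preceq0_trans[OF a(2)])
    ultimately show ?thesis using a(1) by (intro exI[of _ "fst a"]) simp
  qed
qed

end

subsection \<open>Highest weights and highest roots\<close>

text \<open>\<open>T x\<close> records the pairings of \<open>x\<close> with a basis of
  \<open>J\<close>. Nondegeneracy makes \<open>T\<close> injective on \<open>J\<close>, hence onto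
  \<open>J\<close> by dimension, and any \<open>b\<close> in \<open>J\<close> with
  \<open>T b = T a\<close> is the orthogonal projection of \<open>a\<close>.\<close>

lemma (in lie_alg) kf_complement:
  assumes J: "subspace J" and nd: "\<And>x. x \<in> J \<Longrightarrow> (\<And>y. y \<in> J \<Longrightarrow> kf x y = 0) \<Longrightarrow> x = 0"
  shows "\<exists>b\<in>J. \<forall>x\<in>J. kf (a - b) x = 0"
proof -
  obtain B where B: "B \<subseteq> J" "independent B" "J \<subseteq> span B" "card B = dim J"
    using basis_exists[of J] by metis
  have finB: "finite B" using B finiteI_independent by auto
  define T where "T x = (\<Sum>b\<in>B. kf x b *s b)" for x
  have linT: "lin T"
    by (rule linI) (simp_all add: T_def kf_add_left kf_scale_left scale_left_distrib sum.distrib scale_sum_right)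
  have TJ: "T x \<in> J" for x
    unfolding T_def by (rule subspace_sum[OF J]) (use B J in \<open>auto intro: subspace_scale\<close>)
  have T0: "kf x y = 0" if "T x = 0" "y \<in> J" for x y
  proof -
    have "kf x b = 0" if "b \<in> B" for b
      using independentD[OF B(2) finB order_refl, of "kf x" b] \<open>T x = 0\<close> that by (simp add: T_def)
    moreover have "subspace {y. kf x y = 0}" by (simp add: subspace_def kf_add_right kf_scale_right)
    ultimately have "span B \<subseteq> {y. kf x y = 0}" by (intro span_minimal) auto
    thus ?thesis using B(3) that(2) by blast
  qed
  have inj: "x = 0" if "x \<in> J" "T x = 0" for x using nd T0 that by blast
  have "inj_on T B"
  proof (rule inj_onI)
    fix x y assume xy: "x \<in> B" "y \<in> B" "T x = T y"
    have "x - y \<in> J" using xy B(1) by (intro subspace_diff[OF J]) auto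
    moreover have "T (x - y) = 0" using xy(3) by (simp add: lin_diff[OF linT])
    ultimately have "x - y = 0" by (rule inj)
    thus "x = y" by simp
  qed
  note card = card_image[OF this]
  have "independent (T ` B)"
  proof (rule independent_if_scalars_zero)
    fix g x assume 0: "(\<Sum>x\<in>T ` B. g x *s x) = 0" and x: "x \<in> T ` B"
    have "(\<Sum>b\<in>B. g (T b) *s T b) = 0" using 0 by (simp add: sum.reindex[OF \<open>inj_on T B\<close>])
    hence "T (\<Sum>b\<in>B. g (T b) *s b) = 0" by (simp add: lin_sum[OF linT] lin_scale[OF linT])
    moreover have "(\<Sum>b\<in>B. g (T b) *s b) \<in> J"
      by (rule subspace_sum[OF J], rule subspace_scale[OF J]) (use B(1) in blast)
    ultimately have "(\<Sum>b\<in>B. g (T b) *s b) = 0" using inj by blast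
    thus "g x = 0" using independentD[OF B(2) finB order_refl, of "\<lambda>b. g (T b)"] x by auto
  qed (use finB in simp)
  hence "J \<subseteq> span (T ` B)" using TJ card B(4) by (intro card_ge_dim_independent) auto
  also have "\<dots> \<subseteq> T ` J" by (rule span_minimal[OF _ lin_subspace_image[OF linT J]]) (use B in blast)
  finally obtain b where b: "b \<in> J" "T a = T b" using TJ[of a] by blast
  hence "T (a - b) = 0" by (simp add: lin_diff[OF linT])
  thus ?thesis using T0 b(1) by blast
qed

context graded_lie
begin

section \<open>The Casimir-type form of the degree-zero part\<close>

definition pi0 :: "'b \<Rightarrow> 'b" where
  "pi0 x = (\<Sum>p\<in>{p \<in> Wt. snd p = 0}. D.prj p x)"

lemma lin_pi0: "lin pi0"
  unfolding pi0_def by (intro lin_fun_sum D.lin_prj)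

lemma pi0_wsp: "p \<in> Wt \<Longrightarrow> w \<in> wsp p \<Longrightarrow> pi0 w = (if snd p = 0 then w else 0)"
  using D.finite_I by (simp add: pi0_def D.prj_W)

lemma gr_span: "j < n \<Longrightarrow> gr j \<subseteq> span (\<Union>\<mu>\<in>{\<mu>. (\<mu>, j) \<in> Wt}. wsp (\<mu>, j))"
proof -
  assume j: "j < n"
  have "gr j \<subseteq> span (\<Union>\<mu>\<in>{\<mu>. (\<mu>, j) \<in> Wt}. gr j \<inter> wsp (\<mu>, j))"
    by (rule gr_wsp_span[OF j subspace_gr[OF j] order_refl]) (use gr0_br[OF j] h0_gr in blast)
  thus ?thesis by (simp add: wsp_def Int_absorb1 inf.absorb2 inf_left_idem)
qed

lemma pi0_gr:
  assumes "j < n" "x \<in> gr j"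
  shows "pi0 x = (if j = 0 then x else 0)"
proof -
  have x: "x \<in> span (\<Union>\<mu>\<in>{\<mu>. (\<mu>, j) \<in> Wt}. wsp (\<mu>, j))" using gr_span[OF assms(1)] assms(2) by blast
  have "lin (\<lambda>x. if j = 0 then x else 0)" by (simp add: lin_iff)
  from lin_eq_on_span[OF lin_pi0 this _ x] show ?thesis using pi0_wsp by fastforce
qed

lemma pi0_in: "pi0 x \<in> gr 0"
  unfolding pi0_def
proof (rule subspace_sum[OF subspace_gr[OF n_pos]])
  fix p assume "p \<in> {p \<in> Wt. snd p = 0}"
  thus "D.prj p x \<in> gr 0" using D.prj_in[of p x] by (auto simp: wsp_def)
qed

lemma pi0_commute: "a \<in> gr 0 \<Longrightarrow> pi0 (br a x) = br a (pi0 x)"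
proof (rule D.eq_on_W[of "\<lambda>x. pi0 (br a x)" "\<lambda>x. br a (pi0 x)"])
  assume a: "a \<in> gr 0"
  fix p w assume p: "p \<in> Wt" "w \<in> wsp p"
  have "br a w \<in> gr (snd p)" using gr0_br[OF Wt_lt[OF p(1)] a] p(2) by (simp add: wsp_def)
  thus "pi0 (br a w) = br a (pi0 w)" using pi0_gr[OF Wt_lt[OF p(1)]] pi0_wsp[OF p] by simp
qed (rule lin_fun_comp[OF lin_pi0 lin_br], rule lin_fun_comp[OF lin_br lin_pi0])

text \<open>This form replaces the Casimir operator of \<open>gr 0\<close>: it vanishes on invariant vectors, while
  on a module generated by a maximal vector it is a nonzero multiple of the Killing form.\<close>
definition tau :: "'b \<Rightarrow> 'b \<Rightarrow> complex" where
  "tau z y = tr (\<lambda>x. pi0 (br y (br z x)))"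

lemma tau_add_left: "tau (z + z') y = tau z y + tau z' y"
  and tau_scale_left: "tau (c *s z) y = c * tau z y"
  and tau_add_right: "tau z (y + y') = tau z y + tau z y'"
  and tau_scale_right: "tau z (c *s y) = c * tau z y"
  by (simp_all add: tau_def br_add_left br_add_right br_scale_left br_scale_right
      lin_add[OF lin_pi0] lin_scale[OF lin_pi0] tr_add tr_scale)

text \<open>For \<open>a\<close> in \<open>gr 0\<close> the projection \<open>pi0\<close> commutes
  with \<open>br a\<close>, so cyclicity of the trace works as for the Killing form.\<close>

lemma tau_invariant:
  assumes "a \<in> gr 0"
  shows "tau (br a z) y = - tau z (br a y)"
proof -
  have "tr (\<lambda>x. br a (pi0 (br y (br z x)))) = tr (\<lambda>x. pi0 (br y (br z (br a x))))"
    by (rule tr_comm[OF lin_br lin_fun_comp[OF lin_pi0 lin_fun_comp[OF lin_br lin_br]]])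
  hence "tr (\<lambda>x. pi0 (br y (br z (br a x)))) = tr (\<lambda>x. pi0 (br a (br y (br z x))))"
    by (simp add: pi0_commute[OF assms])
  thus ?thesis
    by (simp add: tau_def br_br br_diff_right lin_diff[OF lin_pi0] tr_diff)
qed

text \<open>Cyclicity moves \<open>pi0\<close> to the innermost position, where \<open>z\<close> is
  bracketed with elements of \<open>gr 0\<close> only.\<close>

lemma tau_invariant_vector:
  assumes "\<And>a. a \<in> gr 0 \<Longrightarrow> br a z = 0"
  shows "tau z y = 0"
proof -
  have "tau z y = tr (\<lambda>x. br y (br z (pi0 x)))"
    unfolding tau_def by (rule tr_comm[OF lin_pi0 lin_fun_comp[OF lin_br lin_br]])
  moreover have "br z (pi0 x) = 0" for x using assms[OF pi0_in, of x] br_skew[of z "pi0 x"] by simp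
  ultimately show ?thesis by (simp add: tr_0)
qed

lemma ip_scaled_dual:
  assumes "t \<in> h0" "\<And>x. x \<in> h0 \<Longrightarrow> kf t x = K * \<phi> x" "lat \<phi>" "lat \<psi>"
  shows "\<psi> t = K * of_real (ip \<phi> \<psi>)"
proof -
  obtain r s where r: "dual r \<phi>" and s: "dual s \<psi>" using assms(3,4) by (auto simp: lat_def)
  hence h: "r \<in> h0" "s \<in> h0" by (auto simp: dual_def)
  have "\<psi> t = kf s t" using s assms(1) by (simp add: dual_def)
  also have "\<dots> = K * \<phi> s" using assms(2)[OF h(2)] kf_sym[of s t] by simp
  also have "\<phi> s = kf r s" using r h by (simp add: dual_def)
  finally show ?thesis using ip_dual[OF r s] by simp
qed

lemma wvec_unique:
  assumes "w \<in> wvec \<mu>" "w \<in> wvec \<nu>" "w \<noteq> 0" "nrm \<mu>" "nrm \<nu>"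
  shows "\<mu> = \<nu>"
proof
  fix x
  show "\<mu> x = \<nu> x"
  proof (cases "x \<in> h0")
    case True
    hence "br x w = \<mu> x *s w" "br x w = \<nu> x *s w" using assms(1,2) unfolding wvec_def by blast+
    thus ?thesis using assms(3) by simp
  qed (use assms in \<open>simp add: nrm_def\<close>)
qed

end

context borel_lie
begin

lemma gr0_span: "gr 0 \<subseteq> span (h0 \<union> (\<Union>\<beta>\<in>Ps. wsp (\<beta>, 0)) \<union> (\<Union>\<beta>\<in>Ps. wsp (- \<beta>, 0)))" (is "_ \<subseteq> span ?S")
proof -
  have "(\<Union>\<mu>\<in>{\<mu>. (\<mu>, 0) \<in> Wt}. wsp (\<mu>, 0)) \<subseteq> ?S"
  proof
    fix x assume "x \<in> (\<Union>\<mu>\<in>{\<mu>. (\<mu>, 0) \<in> Wt}. wsp (\<mu>, 0))"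
    then obtain \<mu> where m: "(\<mu>, 0) \<in> Wt" "x \<in> wsp (\<mu>, 0)" by blast
    show "x \<in> ?S"
    proof (cases "\<mu> = 0")
      case True
      thus ?thesis using m wsp_zero by simp
    next
      case False
      hence "\<mu> \<in> Ps \<or> - \<mu> \<in> Ps" using m by (intro Phi_Ps) (simp add: Phi_def)
      thus ?thesis
      proof
        assume "- \<mu> \<in> Ps"
        moreover have "x \<in> wsp (- (- \<mu>), 0)" using m(2) by simp
        ultimately show ?thesis by blast
      qed (use m in blast)
    qed
  qed
  thus ?thesis using gr_span[OF n_pos] span_mono by blast
qed

lemma Ps_wt: "\<beta> \<in> Ps \<Longrightarrow> (\<beta>, 0) \<in> Wt \<and> \<beta> \<noteq> 0 \<and> (- \<beta>, 0) \<in> Wt \<and> nrm \<beta>"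
  using Ps_Phi PhiD[of \<beta>] PhiD[OF Phi_minus, of \<beta>] Wt_nrm[of "(\<beta>, 0)"] by auto

lemma wadd_0_left: "j < n \<Longrightarrow> wadd (\<alpha>, 0) (\<mu>, j) = (\<alpha> + \<mu>, j)"
  by (simp add: wadd_def)

definition maxv :: "('b \<Rightarrow> complex) \<times> nat \<Rightarrow> 'b \<Rightarrow> bool" where
  "maxv p v \<longleftrightarrow> p \<in> Wt \<and> v \<in> wsp p \<and> v \<noteq> 0 \<and> (\<forall>\<beta>\<in>Ps. \<forall>e\<in>wsp (\<beta>, 0). br e v = 0)"

lemma maxv_dominant: "maxv p v \<Longrightarrow> \<beta> \<in> Ps \<Longrightarrow> ip (fst p) \<beta> \<ge> 0"
proof (rule ccontr)
  assume p: "maxv p v" and b: "\<beta> \<in> Ps" and "\<not> ip (fst p) \<beta> \<ge> 0"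
  hence neg: "ip (fst p) (fst (\<beta>, 0 :: nat)) < 0" by simp
  have bW: "(\<beta>, 0) \<in> Wt" "fst (\<beta>, 0 :: nat) \<noteq> 0" using Ps_wt[OF b] by auto
  obtain e where e: "e \<in> wsp (\<beta>, 0)" "e \<noteq> 0" using Wt_vec[OF bW(1)] by blast
  have "br e v \<noteq> 0" using p by (intro raise_nonzero[OF bW e _ _ _ neg]) (auto simp: maxv_def)
  thus False using p b e by (auto simp: maxv_def)
qed

text \<open>This is stronger than being killed by positive root vectors: by
  \<open>br_nonzero\<close> the bracket could not vanish if the raised weight existed.\<close>

lemma maxv_no_raise: "maxv p v \<Longrightarrow> fst p \<noteq> 0 \<Longrightarrow> \<beta> \<in> Ps \<Longrightarrow> wadd (\<beta>, 0) p \<notin> Wt"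
proof
  assume p: "maxv p v" "fst p \<noteq> 0" and b: "\<beta> \<in> Ps" and W: "wadd (\<beta>, 0) p \<in> Wt"
  have bW: "(\<beta>, 0) \<in> Wt" "fst (\<beta>, 0 :: nat) \<noteq> 0" using Ps_wt[OF b] by auto
  obtain e where e: "e \<in> wsp (\<beta>, 0)" "e \<noteq> 0" using Wt_vec[OF bW(1)] by blast
  have "br e v \<noteq> 0" using p by (intro br_nonzero[OF bW e _ _ _ _ W]) (auto simp: maxv_def)
  thus False using p b e by (auto simp: maxv_def)
qed

text \<open>Block by block: \<open>pi0\<close> kills nonzero degrees, the block of \<open>h0\<close>
  is a rank-one map, positive root vectors are killed by \<open>br v\<close>, and on a negative root
  space \<open>br y\<close> vanishes, leaving minus the scalar action of
  \<open>br v y\<close>.\<close>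

lemma tau_maxv_diag:
  assumes v: "maxv p v" "fst p \<noteq> 0" and y: "y \<in> wsp (wneg p)" and q: "q \<in> Wt"
  defines "F \<equiv> \<lambda>x. pi0 (br y (br v x))"
  shows "tr (\<lambda>x. D.prj q (F (D.prj q x))) = kf v y * of_real (if snd q \<noteq> 0 then 0
     else if fst q = 0 then ip (fst p) (fst p)
     else if fst q \<in> Ps then 0 else real (dim (wsp q)) * ip (fst p) (- fst q))"
proof -
  have p: "p \<in> Wt" "v \<in> wsp p" "v \<noteq> 0" "snd p < n" using v Wt_lt by (auto simp: maxv_def)
  have stay: "br y (br v w) \<in> wsp q" if "w \<in> wsp q" for w
  proof -
    have "br y (br v w) \<in> wsp (wadd (wneg p) (wadd p q))"
      by (intro br_wsp wneg_lt wadd_lt p y that Wt_lt[OF q])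
    thus ?thesis by (simp add: wadd_wneg_cancel p Wt_lt[OF q])
  qed
  have prjq: "D.prj q x \<in> wsp q" for x by (rule D.prj_in[OF q])
  let ?t = "br v y"
  have t: "?t \<in> h0" by (rule br_opposite_h0[OF p(4,2) y])
  have kt: "kf ?t x = kf v y * fst p x" if "x \<in> h0" for x by (rule kf_br_h0[OF y that])
  have yv: "br y v = - ?t" by (rule br_skew)
  consider "snd q \<noteq> 0" | "snd q = 0" "fst q = 0" | "snd q = 0" "fst q \<in> Ps" "fst q \<noteq> 0" | "snd q = 0" "fst q \<noteq> 0" "fst q \<notin> Ps"
    by blast
  thus ?thesis
  proof cases
    case 1
    hence "F (D.prj q x) = 0" for x unfolding F_def using pi0_wsp[OF q stay[OF prjq]] by simp
    thus ?thesis using 1 by (simp add: lin_0[OF D.lin_prj] tr_0)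
  next
    case 2
    hence q0: "q = (0, 0)" by (simp add: prod_eq_iff)
    have h: "D.prj q x \<in> h0" for x using prjq[of x] q0 wsp_zero by simp
    have "D.prj q (F (D.prj q x)) = fst p (D.prj q x) *s ?t" for x
    proof -
      have "br v (D.prj q x) = - (fst p (D.prj q x) *s v)"
        using br_skew[of v "D.prj q x"] wsp_h0[OF h p(2)] by simp
      hence "br y (br v (D.prj q x)) = fst p (D.prj q x) *s ?t"
        by (simp add: br_minus_right br_scale_right yv)
      moreover have "pi0 (br y (br v (D.prj q x))) = br y (br v (D.prj q x))"
        using pi0_wsp[OF q stay[OF prjq]] 2 by simp
      moreover have "D.prj q (br y (br v (D.prj q x))) = br y (br v (D.prj q x))"
        using D.prj_W[OF q stay[OF prjq], of q] by simp
      ultimately show ?thesis by (simp add: F_def)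
    qed
    hence "tr (\<lambda>x. D.prj q (F (D.prj q x))) = tr (\<lambda>x. fst p (D.prj q x) *s ?t)" by simp
    also have "\<dots> = fst p (D.prj q ?t)"
      by (rule tr_rank1) (simp_all add: lin_add[OF D.lin_prj] lin_scale[OF D.lin_prj] weight_add[OF p(1) h h] weight_scale[OF p(1) h])
    also have "D.prj q ?t = ?t" using D.prj_W[OF q, of ?t q] t q0 wsp_zero by simp
    also have "fst p ?t = kf v y * of_real (ip (fst p) (fst p))"
      by (rule ip_scaled_dual[OF t kt lat_weight[OF p(1)] lat_weight[OF p(1)]])
    finally show ?thesis using 2 by simp
  next
    case 3
    have "br v (D.prj q x) = 0" for x
    proof -
      have "D.prj q x \<in> wsp (fst q, 0)" using prjq[of x] 3(1) by (metis prod.collapse)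
      hence "br (D.prj q x) v = 0" using v(1) 3(2) unfolding maxv_def by blast
      thus ?thesis using br_skew[of v "D.prj q x"] by simp
    qed
    thus ?thesis using 3 by (simp add: F_def lin_0[OF lin_pi0] lin_0[OF D.lin_prj] tr_0)
  next
    case 4
    have "(fst q, 0) \<in> Wt" using q 4(1) by (metis prod.collapse)
    hence g: "- fst q \<in> Ps" using Phi_Ps[of "fst q"] 4 by (simp add: Phi_def)
    have "F (D.prj q x) = (kf v y * of_real (ip (fst p) (- fst q))) *s D.prj q x" for x
    proof -
      let ?w = "D.prj q x"
      \<comment> \<open>Otherwise the negative of its weight, which is \<open>p\<close> raised by
        the positive root \<open>- fst q\<close>, would be a weight.\<close>
      have "br y ?w = 0"
      proof (rule ccontr)
        assume "br y ?w \<noteq> 0"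
        hence "wadd (wneg p) q \<in> Wt" by (intro br_Wt[OF wneg_Wt[OF p(1)] q y prjq])
        hence "wneg (wadd (wneg p) q) \<in> Wt" by (rule wneg_Wt)
        moreover have "wneg (wadd (wneg p) q) = wadd (- fst q, 0) p"
        proof -
          have "wadd (wadd (wneg p) q) (wadd (- fst q, 0) p) = wadd (wadd p (wneg p)) (wadd q (- fst q, 0))"
            by (metis wadd_assoc wadd_commute)
          also have "wadd q (- fst q, 0) = (0, 0)" using 4(1) by (simp add: wadd_def)
          also have "wadd (wadd p (wneg p)) (0, 0) = (0, 0)" using n_pos by (simp add: wadd_wneg p wadd_0)
          finally have "wadd (wadd (wneg p) q) (wadd (- fst q, 0) p) = (0, 0)" .
          thus ?thesis using wadd_zero_iff[OF wadd_lt wadd_lt] by simp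
        qed
        ultimately show False using maxv_no_raise[OF v g] by simp
      qed
      hence "br y (br v ?w) = br (- ?t) ?w" using leibniz[of y v ?w] yv by simp
      also have "\<dots> = (- fst q ?t) *s ?w" using wsp_h0[OF t prjq] by (simp add: br_minus_left)
      also have "(- fst q) ?t = kf v y * of_real (ip (fst p) (- fst q))"
        by (rule ip_scaled_dual[OF t kt lat_weight[OF p(1)] lat_minus[OF lat_weight[OF q]]])
      hence "- fst q ?t = kf v y * of_real (ip (fst p) (- fst q))" by simp
      finally have "br y (br v ?w) = (kf v y * of_real (ip (fst p) (- fst q))) *s ?w" .
      thus ?thesis unfolding F_def using pi0_wsp[OF q stay[OF prjq], of x] 4(1) by simp
    qed
    hence "D.prj q (F (D.prj q x)) = (kf v y * of_real (ip (fst p) (- fst q))) *s D.prj q x" for x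
      by (simp add: lin_scale[OF D.lin_prj] D.prj_prj)
    thus ?thesis using 4 by (simp add: tr_scale D.tr_prj[OF q])
  qed
qed

text \<open>The constant is the sum of the block contributions. The block of \<open>h0\<close>
  contributes the positive number \<open>ip (fst p) (fst p)\<close>, and dominance makes the others
  nonnegative.\<close>

lemma tau_maxv:
  assumes v: "maxv p v" "fst p \<noteq> 0"
  shows "\<exists>C. C \<noteq> 0 \<and> (\<forall>y. tau v y = C * kf v y)"
proof -
  have p: "p \<in> Wt" "v \<in> wsp p" "v \<noteq> 0" "snd p < n" using v Wt_lt by (auto simp: maxv_def)
  define c where "c q = (if snd q \<noteq> 0 then 0 else if fst q = 0 then ip (fst p) (fst p)
     else if fst q \<in> Ps then 0 else real (dim (wsp q)) * ip (fst p) (- fst q))" for q :: "('b \<Rightarrow> complex) \<times> nat"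
  define C where "C = (\<Sum>q\<in>Wt. c q)"
  have eq: "tau v y = of_real C * kf v y" if "q \<in> Wt" "y \<in> wsp q" for q y
  proof (cases "wadd p q = (0, 0)")
    case True
    hence y: "y \<in> wsp (wneg p)" using wadd_zero_iff[OF p(4) Wt_lt[OF that(1)]] that(2) by simp
    have "tau v y = (\<Sum>r\<in>Wt. tr (\<lambda>x. D.prj r (pi0 (br y (br v (D.prj r x))))))"
      unfolding tau_def by (rule D.tr_diagonal[OF lin_fun_comp[OF lin_pi0 lin_fun_comp[OF lin_br lin_br]]])
    also have "\<dots> = (\<Sum>r\<in>Wt. kf v y * of_real (c r))"
      unfolding c_def by (rule sum.cong[OF refl tau_maxv_diag[OF v y]])
    finally show ?thesis by (simp add: C_def sum_distrib_left mult.commute)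
  next
    case False
    have "tau v y = 0"
      unfolding tau_def
    proof (rule D.tr_off_diagonal[OF lin_fun_comp[OF lin_pi0 lin_fun_comp[OF lin_br lin_br]]])
      fix r w assume r: "r \<in> Wt" "w \<in> wsp r"
      show "D.prj r (pi0 (br y (br v w))) = 0"
      proof (cases "br y (br v w) = 0")
        case nz: False
        have 1: "br v w \<in> wsp (wadd p r)" "br y (br v w) \<in> wsp (wadd q (wadd p r))"
          by (intro br_wsp wadd_lt Wt_lt p that r)+
        have "wadd p r \<in> Wt" using nz by (intro br_Wt[OF p(1) r(1) p(2) r(2)]) auto
        hence 2: "wadd q (wadd p r) \<in> Wt" using nz 1(1) by (intro br_Wt[OF that(1) _ that(2)]) auto
        have "r \<noteq> wadd (wadd q p) r"
          using False wadd_eq_right[OF Wt_lt[OF r(1)], of "wadd q p"] n_pos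
          by (auto simp: wadd_def prod_eq_iff add.commute)
        thus ?thesis using D.prj_W[OF 2 1(2), of r] pi0_wsp[OF 2 1(2)]
          by (auto simp: wadd_assoc lin_0[OF D.lin_prj])
      qed (simp add: lin_0[OF D.lin_prj] lin_0[OF lin_pi0])
    qed
    moreover have "kf v y = 0" using kf_wsp[OF p(1) that(1) p(2) that(2) False] .
    ultimately show ?thesis by simp
  qed
  have "tau v y = of_real C * kf v y" for y
    using D.span_W[of y]
  proof (induction rule: span_induct_alt)
    case base
    show ?case using tau_scale_right[of v 0 0] by simp
  next
    case (step a x y)
    then obtain q where "q \<in> Wt" "x \<in> wsp q" by blast
    thus ?case using step eq[of q x] by (simp add: tau_add_right tau_scale_right kf_add_right kf_scale_right algebra_simps)
  qed
  moreover have "C > 0"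
  proof -
    have latp: "lat (fst p)" by (rule lat_weight[OF p(1)])
    have nn: "c q \<ge> 0" if q: "q \<in> Wt" for q
    proof (cases "snd q = 0 \<and> fst q \<noteq> 0 \<and> fst q \<notin> Ps")
      case True
      have "(fst q, 0) \<in> Wt" using q True by (metis prod.collapse)
      hence "- fst q \<in> Ps" using Phi_Ps[of "fst q"] True by (simp add: Phi_def)
      hence "ip (fst p) (- fst q) \<ge> 0" by (rule maxv_dominant[OF v(1)])
      thus ?thesis using True by (simp add: c_def)
    next
      case False
      thus ?thesis using ip_pos[OF latp v(2)] by (auto simp: c_def)
    qed
    obtain x where x: "fst p x \<noteq> 0" using v(2) by (auto simp: fun_eq_iff)
    hence xh: "x \<in> h0" using Wt_nrm[OF p(1)] by (auto simp: nrm_def)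
    have "x \<noteq> 0" using x weight_scale[OF p(1) xh, of 0] by auto
    hence "(0, 0) \<in> Wt" using xh n_pos by (intro WtI[of _ x]) (auto simp: nrm_def wsp_zero)
    hence "c (0, 0) \<le> C" unfolding C_def by (rule member_le_sum) (use nn D.finite_I in auto)
    moreover have "c (0, 0) > 0" using ip_pos[OF latp v(2)] by (simp add: c_def)
    ultimately show ?thesis by linarith
  qed
  ultimately show ?thesis by (intro exI[of _ "of_real C"]) auto
qed

section \<open>The module generated by a maximal vector\<close>

inductive_set low :: "'b \<Rightarrow> 'b set" for v where
  low_base: "v \<in> low v"
| low_step: "w \<in> low v \<Longrightarrow> \<beta> \<in> Ps \<Longrightarrow> f \<in> wsp (- \<beta>, 0) \<Longrightarrow> br f w \<in> low v"

lemma low_wsp: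
  assumes "w \<in> low v" "v \<in> wsp (\<mu>, j)" "j < n"
  shows "\<exists>ys. set ys \<subseteq> Ps \<and> w \<in> wsp (\<mu> - sum_list ys, j)"
  using assms(1)
proof induction
  case low_base
  show ?case using assms(2) by (intro exI[of _ "[]"]) simp
next
  case (low_step w \<beta> f)
  then obtain ys where ys: "set ys \<subseteq> Ps" "w \<in> wsp (\<mu> - sum_list ys, j)" by blast
  have "br f w \<in> wsp (wadd (- \<beta>, 0) (\<mu> - sum_list ys, j))"
    using assms(3) n_pos low_step ys by (intro br_wsp) auto
  moreover have "wadd (- \<beta>, 0) (\<mu> - sum_list ys, j) = (\<mu> - sum_list (\<beta> # ys), j)"
    using assms(3) by (auto simp: wadd_0_left fun_eq_iff)
  ultimately have "br f w \<in> wsp (\<mu> - sum_list (\<beta> # ys), j)" by metis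
  moreover have "set (\<beta> # ys) \<subseteq> Ps" using ys(1) low_step(2) by simp
  ultimately show ?case by blast
qed

lemma low_span_f: "x \<in> wsp (- \<beta>, 0) \<Longrightarrow> \<beta> \<in> Ps \<Longrightarrow> m \<in> span (low v) \<Longrightarrow> br x m \<in> span (low v)"
proof -
  assume x: "x \<in> wsp (- \<beta>, 0)" "\<beta> \<in> Ps" "m \<in> span (low v)"
  have "span (low v) \<subseteq> {m. br x m \<in> span (low v)}"
    using x low_step by (intro span_minimal lin_subspace_vimage[OF lin_br] subspace_span) (auto intro: span_base)
  thus ?thesis using x(3) by blast
qed

lemma low_span_h:
  assumes "v \<in> wsp (\<mu>, j)" "j < n" "w \<in> low v" "x \<in> h0"
  shows "br x w \<in> span (low v)"
  using low_wsp[OF assms(3,1,2)] wsp_h0[OF assms(4)] span_scale[OF span_base[OF assms(3)]] by fastforce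

text \<open>Commute \<open>e\<close> past the last lowering operator: \<open>br e f\<close> lies in
  \<open>h0\<close> or in a positive or negative root space. In the positive case the induction
  hypothesis is used for another root, hence \<open>\<beta>\<close> and \<open>e\<close> are
  generalized.\<close>

lemma low_span_e:
  assumes v: "maxv (\<mu>, j) v" and "w \<in> low v" "\<beta> \<in> Ps" "e \<in> wsp (\<beta>, 0)"
  shows "br e w \<in> span (low v)"
  using assms(2-4)
proof (induction arbitrary: \<beta> e)
  case low_base
  thus ?case using v by (simp add: maxv_def span_zero)
next
  case (low_step w \<gamma> f)
  have v': "v \<in> wsp (\<mu>, j)" "j < n" using v Wt_lt[of "(\<mu>, j)"] by (auto simp: maxv_def)
  have "br e w \<in> span (low v)" using low_step.IH low_step.prems by blast
  hence "br f (br e w) \<in> span (low v)" by (rule low_span_f[OF low_step.hyps(3,2)])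
  moreover have "br (br e f) w \<in> span (low v)"
  proof (cases "br e f = 0")
    case False
    have W: "(\<beta>, 0) \<in> Wt" "(- \<gamma>, 0) \<in> Wt" using Ps_wt low_step by blast+
    have ef: "br e f \<in> wsp (\<beta> - \<gamma>, 0)"
      using br_wsp[OF Wt_lt[OF W(1)] Wt_lt[OF W(2)] low_step.prems(2) low_step.hyps(3)] by (simp add: wadd_00)
    have in': "(\<beta> - \<gamma>, 0) \<in> Wt" using br_Wt[OF W low_step.prems(2) low_step.hyps(3) False] by (simp add: wadd_00)
    show ?thesis
    proof (cases "\<beta> = \<gamma>")
      case True
      hence "br e f \<in> h0" using ef wsp_zero by simp
      thus ?thesis by (rule low_span_h[OF v' low_step.hyps(1)])
    next
      case False
      hence "\<beta> - \<gamma> \<in> Ps \<or> - (\<beta> - \<gamma>) \<in> Ps" using in' by (intro Phi_Ps) (simp add: Phi_def)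
      thus ?thesis
      proof
        assume "\<beta> - \<gamma> \<in> Ps"
        thus ?thesis using low_step.IH ef by blast
      next
        assume "- (\<beta> - \<gamma>) \<in> Ps"
        moreover have "br e f \<in> wsp (- (- (\<beta> - \<gamma>)), 0)" using ef by simp
        ultimately show ?thesis using low_span_f span_base[OF low_step.hyps(1)] by blast
      qed
    qed
  qed (simp add: span_zero)
  ultimately show ?case using leibniz[of e f w] by (simp add: span_add)
qed

lemma low_span_gr0:
  assumes "maxv (\<mu>, j) v" "x \<in> gr 0" "m \<in> span (low v)"
  shows "br x m \<in> span (low v)"
proof (rule br_span[OF _ assms(3) subspace_span])
  show "x \<in> span (h0 \<union> (\<Union>\<beta>\<in>Ps. wsp (\<beta>, 0)) \<union> (\<Union>\<beta>\<in>Ps. wsp (- \<beta>, 0)))" using gr0_span assms(2) by blast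
  have v': "v \<in> wsp (\<mu>, j)" "j < n" using assms(1) Wt_lt[of "(\<mu>, j)"] by (auto simp: maxv_def)
  fix x w assume "x \<in> h0 \<union> (\<Union>\<beta>\<in>Ps. wsp (\<beta>, 0)) \<union> (\<Union>\<beta>\<in>Ps. wsp (- \<beta>, 0))" and w: "w \<in> low v"
  thus "br x w \<in> span (low v)"
    using low_span_h[OF v' w] low_span_e[OF assms(1) w] low_span_f[OF _ _ span_base[OF w]] by blast
qed

lemma low_gr:
  assumes "v \<in> wsp (\<mu>, j)" "j < n"
  shows "span (low v) \<subseteq> gr j"
  by (rule span_minimal[OF _ subspace_gr[OF assms(2)]]) (use low_wsp[OF _ assms] in \<open>fastforce simp: wsp_def\<close>)

lemma nrm_diff: "nrm \<mu> \<Longrightarrow> set ys \<subseteq> Ps \<Longrightarrow> nrm (\<mu> - sum_list ys)"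
proof (induction ys)
  case (Cons \<beta> ys)
  have "nrm \<beta>" using Cons Ps_wt by simp
  thus ?case using Cons by (auto simp: nrm_def)
qed simp

text \<open>The projection to the weight of \<open>m\<close> cannot kill all generators, and the
  generators are weight vectors themselves.\<close>

lemma low_weight:
  assumes v: "v \<in> wsp (\<mu>, j)" "(\<mu>, j) \<in> Wt" and m: "m \<in> span (low v)" "m \<in> wsp (\<nu>, j)" "m \<noteq> 0" "nrm \<nu>"
  shows "\<exists>w\<in>low v. w \<noteq> 0 \<and> w \<in> wsp (\<nu>, j) \<and> \<mu> - \<nu> \<in> qplus Dl"
proof -
  have j: "j < n" using Wt_lt[OF v(2)] by simp
  have W: "(\<nu>, j) \<in> Wt" using m j by (intro WtI[of _ m]) auto
  have "\<exists>w\<in>low v. D.prj (\<nu>, j) w \<noteq> 0"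
  proof (rule ccontr)
    assume "\<not> ?thesis"
    hence "span (low v) \<subseteq> {w. D.prj (\<nu>, j) w \<in> {0}}"
      by (intro span_minimal lin_subspace_vimage[OF D.lin_prj]) auto
    hence "D.prj (\<nu>, j) m = 0" using m(1) by blast
    thus False using D.prj_W[OF W m(2), of "(\<nu>, j)"] m(3) by simp
  qed
  then obtain w where w: "w \<in> low v" "D.prj (\<nu>, j) w \<noteq> 0" by blast
  hence w0: "w \<noteq> 0" using lin_0[OF D.lin_prj] by auto
  obtain ys where ys: "set ys \<subseteq> Ps" "w \<in> wsp (\<mu> - sum_list ys, j)" using low_wsp[OF w(1) v(1) j] by blast
  have "nrm (\<mu> - sum_list ys)" using nrm_diff[OF _ ys(1)] Wt_nrm[OF v(2)] by simp
  hence W': "(\<mu> - sum_list ys, j) \<in> Wt" using ys(2) w0 j by (intro WtI[of _ w]) auto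
  have e: "(\<nu>, j) = (\<mu> - sum_list ys, j)"
    using D.prj_W[OF W' ys(2), of "(\<nu>, j)"] w(2) by (metis (full_types))
  hence "\<mu> - \<nu> = sum_list ys" by simp
  hence "\<mu> - \<nu> \<in> qplus Dl" using Ps_sum_qplus[OF ys(1)] by simp
  moreover have "w \<in> wsp (\<nu>, j)" using ys(2) e by simp
  ultimately show ?thesis using w(1) w0 by blast
qed

text \<open>A numerical substitute for height: it grows whenever a positive root is added within
  \<open>Wt\<close>, so maximal weights can be chosen by a maximal number.\<close>

definition wrank :: "('b \<Rightarrow> complex) \<times> nat \<Rightarrow> nat" where
  "wrank p = card {q \<in> Wt. preceq0 Dl q p}"

lemma wrank_less:
  assumes "(\<mu> + \<beta>, j) \<in> Wt" "\<beta> \<in> Ps"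
  shows "wrank (\<mu>, j) < wrank (\<mu> + \<beta>, j)"
  unfolding wrank_def
proof (rule psubset_card_mono)
  show "finite {q \<in> Wt. preceq0 Dl q (\<mu> + \<beta>, j)}" using D.finite_I by simp
  have le: "preceq0 Dl (\<mu>, j) (\<mu> + \<beta>, j)" using Ps_qplus[OF assms(2)] by (simp add: preceq0_def)
  have "\<not> preceq0 Dl (\<mu> + \<beta>, j) (\<mu>, j)"
  proof
    assume "preceq0 Dl (\<mu> + \<beta>, j) (\<mu>, j)"
    from preceq0_antisym[OF le this] show False using Ps_wt[OF assms(2)] by simp
  qed
  moreover have "(\<mu> + \<beta>, j) \<in> {q \<in> Wt. preceq0 Dl q (\<mu> + \<beta>, j)}" using assms by simp
  moreover have "{q \<in> Wt. preceq0 Dl q (\<mu>, j)} \<subseteq> {q \<in> Wt. preceq0 Dl q (\<mu> + \<beta>, j)}"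
    using preceq0_trans[OF _ le] by blast
  ultimately show "{q \<in> Wt. preceq0 Dl q (\<mu>, j)} \<subset> {q \<in> Wt. preceq0 Dl q (\<mu> + \<beta>, j)}" by blast
qed

lemma exists_max_wrank:
  assumes "p \<in> S"
  shows "\<exists>q\<in>S. \<forall>r\<in>S. wrank r \<le> wrank q"
proof -
  have "wrank q \<le> card Wt" for q unfolding wrank_def by (rule card_mono[OF D.finite_I]) blast
  hence "\<forall>q. q \<in> S \<longrightarrow> wrank q < Suc (card Wt)" by (simp add: le_imp_less_Suc)
  thus ?thesis using ex_has_greatest_nat[of "\<lambda>q. q \<in> S" p wrank] assms by blast
qed

text \<open>Functional 0 is orthogonal to every root, so \<open>lowering_zero\<close> passes from
  positive to negative root vectors.\<close>

lemma invariant_vector: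
  assumes u: "(0, j) \<in> Wt" "u \<in> wsp (0, j)" and e: "\<And>\<beta> e. \<beta> \<in> Ps \<Longrightarrow> e \<in> wsp (\<beta>, 0) \<Longrightarrow> br e u = 0" and "x \<in> gr 0"
  shows "br x u = 0"
proof -
  have "gr 0 \<subseteq> {x. br x u \<in> {0}}"
  proof (rule order_trans[OF gr0_span], rule span_minimal[OF _ lin_subspace_vimage[OF lin_br_right subspace_single_0]], rule subsetI)
    fix x assume "x \<in> h0 \<union> (\<Union>\<beta>\<in>Ps. wsp (\<beta>, 0)) \<union> (\<Union>\<beta>\<in>Ps. wsp (- \<beta>, 0))"
    then consider "x \<in> h0" | \<beta> where "\<beta> \<in> Ps" "x \<in> wsp (\<beta>, 0)" | \<beta> where "\<beta> \<in> Ps" "x \<in> wsp (- \<beta>, 0)" by blast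
    thus "x \<in> {x. br x u \<in> {0}}"
    proof cases
      case 1
      thus ?thesis using wsp_h0[OF 1 u(2)] by simp
    next
      case (2 \<beta>)
      thus ?thesis using e by simp
    next
      case (3 \<beta>)
      have b: "(\<beta>, 0) \<in> Wt" "fst (\<beta>, 0 :: nat) \<noteq> 0" "wneg (\<beta>, 0) = (- \<beta>, 0)" "lat \<beta>"
        using Ps_wt[OF 3(1)] lat_weight[of "(\<beta>, 0)"] by (auto simp: wneg_def)
      obtain x' where x': "x' \<in> wsp (\<beta>, 0)" "x' \<noteq> 0" using Wt_vec[OF b(1)] by blast
      have "br x u = 0"
        by (rule lowering_zero[OF b(1,2) x' u(1,2)]) (use e[OF 3(1) x'(1)] b 3 in \<open>simp_all add: ip_0_left\<close>)
      thus ?thesis by simp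
    qed
  qed
  thus ?thesis using assms(4) by blast
qed

text \<open>A weight vector \<open>u\<close> of maximal rank in \<open>N\<close> is a maximal
  vector, and its weight is carried by some generator in \<open>low v\<close>; the cases follow how
  this generator arose.\<close>

lemma low_irreducible:
  assumes v: "maxv (\<mu>, j) v" "\<mu> \<noteq> 0"
    and N: "subspace N" "N \<subseteq> span (low v)" "\<And>x u. x \<in> gr 0 \<Longrightarrow> u \<in> N \<Longrightarrow> br x u \<in> N"
  shows "N = {0} \<or> N = span (low v)"
proof (rule disjCI)
  assume "N \<noteq> span (low v)"
  show "N = {0}"
  proof (rule ccontr)
    assume "N \<noteq> {0}"
    have v': "v \<in> wsp (\<mu>, j)" "(\<mu>, j) \<in> Wt" "v \<noteq> 0" "j < n" using v(1) Wt_lt[of "(\<mu>, j)"] by (auto simp: maxv_def)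
    have Ngr: "N \<subseteq> gr j" using N(2) low_gr[OF v'(1,4)] by blast
    have sp: "N \<subseteq> span (\<Union>\<kappa>\<in>{\<kappa>. (\<kappa>, j) \<in> Wt}. N \<inter> wsp (\<kappa>, j))"
      by (rule gr_wsp_span[OF v'(4) N(1) Ngr]) (use N(3) h0_gr in blast)
    define S where "S = {p \<in> Wt. snd p = j \<and> (\<exists>u\<in>N \<inter> wsp p. u \<noteq> 0)}"
    have "S \<noteq> {}"
    proof
      assume "S = {}"
      hence "(\<Union>\<kappa>\<in>{\<kappa>. (\<kappa>, j) \<in> Wt}. N \<inter> wsp (\<kappa>, j)) \<subseteq> {0}" unfolding S_def by force
      hence "N \<subseteq> {0}" using sp span_minimal[OF _ subspace_single_0] by blast
      thus False using \<open>N \<noteq> {0}\<close> subspace_0[OF N(1)] by blast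
    qed
    then obtain p0 where "p0 \<in> S" by blast
    from exists_max_wrank[OF this] obtain p where p: "p \<in> S" "\<And>r. r \<in> S \<Longrightarrow> wrank r \<le> wrank p" by blast
    obtain \<nu> where pn: "p = (\<nu>, j)" using p(1) by (cases p) (simp add: S_def)
    then obtain u where u: "(\<nu>, j) \<in> Wt" "u \<in> N" "u \<in> wsp (\<nu>, j)" "u \<noteq> 0" using p(1) by (auto simp: S_def)
    have eu: "br e u = 0" if e: "\<beta> \<in> Ps" "e \<in> wsp (\<beta>, 0)" for \<beta> e
    proof (rule ccontr)
      assume nz: "br e u \<noteq> 0"
      have bW: "(\<beta>, 0) \<in> Wt" using Ps_wt[OF e(1)] by blast
      have eq: "wadd (\<beta>, 0) (\<nu>, j) = (\<nu> + \<beta>, j)" using v'(4) by (simp add: wadd_0_left add.commute)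
      have W: "(\<nu> + \<beta>, j) \<in> Wt" using br_Wt[OF bW u(1) e(2) u(3) nz] eq by simp
      have "br e u \<in> wsp (\<nu> + \<beta>, j)" using br_wsp[OF Wt_lt[OF bW] Wt_lt[OF u(1)] e(2) u(3)] eq by simp
      moreover have "br e u \<in> N" using N(3) u(2) e(2) by (simp add: wsp_def)
      ultimately have "(\<nu> + \<beta>, j) \<in> S" using W nz by (auto simp: S_def)
      hence "wrank (\<nu> + \<beta>, j) \<le> wrank (\<nu>, j)" using p(2) pn by blast
      thus False using wrank_less[OF W e(1)] by simp
    qed
    have um: "maxv (\<nu>, j) u" using u eu by (simp add: maxv_def)
    have uM: "u \<in> span (low v)" using u(2) N(2) by blast
    obtain w where w: "w \<in> low v" "w \<noteq> 0" "w \<in> wsp (\<nu>, j)"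
      using low_weight[OF v'(1,2) uM u(3,4)] Wt_nrm[OF u(1)] by auto
    from w(1) show False
    proof cases
      \<comment> \<open>Here \<open>u\<close> has the weight of \<open>v\<close>, so
        \<open>v\<close> is a multiple of \<open>u\<close> and lies in \<open>N\<close>.\<close>
      case low_base
      have "\<nu> = \<mu>"
        using wvec_unique[of v \<nu> \<mu>] w low_base v' Wt_nrm[OF u(1)] Wt_nrm[OF v'(2)] by (auto simp: wsp_def)
      then obtain c where "v = c *s u" using multiplicity_one[OF u(1) _ u(3,4), of v] v(2) v'(1) by auto
      hence "v \<in> N" using u(2) N(1) by (simp add: subspace_scale)
      have "x \<in> N" if "x \<in> low v" for x
        using that
      proof induction
        case (low_step w \<beta> f)
        thus ?case using N(3) by (simp add: wsp_def)
      qed (rule \<open>v \<in> N\<close>)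
      hence "span (low v) \<subseteq> N" by (intro span_minimal[OF _ N(1)]) blast
      thus False using \<open>N \<noteq> span (low v)\<close> N(2) by blast
    next
      \<comment> \<open>The generator was lowered from a nonzero weight vector \<open>w'\<close>, so
        \<open>\<nu> + \<beta>\<close> is a weight, which \<open>maxv_no_raise\<close> refutes
        unless \<open>\<nu> = 0\<close>.\<close>
      case (low_step w' \<beta> f)
      have w': "w' \<noteq> 0" using w(2) low_step by auto
      obtain ys where ys: "set ys \<subseteq> Ps" "w' \<in> wsp (\<mu> - sum_list ys, j)" using low_wsp[OF low_step(2) v'(1,4)] by blast
      have nrm': "nrm (\<mu> - sum_list ys)" using nrm_diff[OF _ ys(1)] Wt_nrm[OF v'(2)] by simp
      have W': "(\<mu> - sum_list ys, j) \<in> Wt" using ys(2) w' v'(4) nrm' by (intro WtI[of _ w']) auto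
      have bW: "(\<beta>, 0) \<in> Wt" "\<beta> \<noteq> 0" "(- \<beta>, 0) \<in> Wt" using Ps_wt[OF low_step(3)] by auto
      have "br f w' \<in> wsp (wadd (- \<beta>, 0) (\<mu> - sum_list ys, j))"
        by (rule br_wsp[OF Wt_lt[OF bW(3)] Wt_lt[OF W'] low_step(4) ys(2)])
      hence "w \<in> wvec (- \<beta> + (\<mu> - sum_list ys))" using low_step(1) by (simp add: wsp_def wadd_def)
      moreover have "nrm (- \<beta> + (\<mu> - sum_list ys))" using nrm' Ps_wt[OF low_step(3)] by (auto simp: nrm_def)
      ultimately have "- \<beta> + (\<mu> - sum_list ys) = \<nu>"
        using wvec_unique w(2,3) Wt_nrm[OF u(1)] by (auto simp: wsp_def)
      hence "\<beta> + \<nu> = \<mu> - sum_list ys" by auto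
      hence up: "wadd (\<beta>, 0) (\<nu>, j) \<in> Wt" using W' v'(4) by (simp add: wadd_0_left)
      show False
      proof (cases "\<nu> = 0")
        case False
        thus False using maxv_no_raise[OF um _ low_step(3)] up by simp
      next
        case True
        \<comment> \<open>An invariant \<open>u\<close> makes \<open>tau u\<close> vanish, while on
          the whole module \<open>tau\<close> is the nonzero multiple \<open>C\<close> of
          \<open>kf\<close>.\<close>
        have inv: "br x u = 0" if "x \<in> gr 0" for x
          by (rule invariant_vector[of j u]) (use u eu True that in auto)
        obtain C where C: "C \<noteq> 0" "\<And>y. tau v y = C * kf v y" using tau_maxv[OF v(1)] v(2) by auto
        have "tau w y = C * kf w y" if "w \<in> low v" for w y
          using that
        proof (induction arbitrary: y)
          case (low_step w \<beta> f)
          have "f \<in> gr 0" using low_step(3) by (simp add: wsp_def)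
          thus ?case using low_step.IH[of "br f y"] by (simp add: tau_invariant kf_invariant_minus)
        qed (rule C(2))
        moreover have "subspace {w. \<forall>y. tau w y = C * kf w y}"
          using tau_scale_left[of 0 0]
          by (auto simp: subspace_def tau_add_left tau_scale_left kf_add_left kf_scale_left algebra_simps)
        ultimately have "span (low v) \<subseteq> {w. \<forall>y. tau w y = C * kf w y}" by (intro span_minimal) auto
        hence "tau u y = C * kf u y" for y using uM by blast
        hence "kf u y = 0" for y using tau_invariant_vector[OF inv] C(1) by simp
        thus False using kf_nondegenerate u(4) by blast
      qed
    qed
  qed
qed

text \<open>A weight of largest rank above \<open>\<mu>\<close> with nonzero functional could be
  raised only to functional 0; but then a second raising leads to the root \<open>\<beta>\<close>
  itself, nonzero and of larger rank.\<close>

lemma exists_maxv: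
  assumes "(\<mu>, j) \<in> Wt" "\<mu> \<noteq> 0"
  shows "\<exists>\<nu> v. maxv (\<nu>, j) v \<and> \<nu> \<noteq> 0 \<and> \<nu> - \<mu> \<in> qplus Dl"
proof -
  have j: "j < n" using Wt_lt[OF assms(1)] by simp
  define S where "S = {p \<in> Wt. fst p \<noteq> 0 \<and> snd p = j \<and> fst p - \<mu> \<in> qplus Dl}"
  have "(\<mu>, j) \<in> S" using assms by (simp add: S_def qplus_zero)
  from exists_max_wrank[OF this] obtain p where p: "p \<in> S" "\<And>r. r \<in> S \<Longrightarrow> wrank r \<le> wrank p" by blast
  obtain \<nu> where pn: "p = (\<nu>, j)" using p(1) by (cases p) (simp add: S_def)
  have nu: "(\<nu>, j) \<in> Wt" "\<nu> \<noteq> 0" "\<nu> - \<mu> \<in> qplus Dl" using p(1) pn by (auto simp: S_def)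
  obtain v where v: "v \<in> wsp (\<nu>, j)" "v \<noteq> 0" using Wt_vec[OF nu(1)] by blast
  have inS: "(\<nu> + \<beta>, j) \<notin> Wt \<or> \<nu> + \<beta> = 0" if b: "\<beta> \<in> Ps" for \<beta>
  proof (rule ccontr)
    assume a: "\<not> ?thesis"
    have "\<nu> + \<beta> - \<mu> \<in> qplus Dl" using qplus_add_closed[OF nu(3) Ps_qplus[OF b]] by (simp add: algebra_simps)
    hence "(\<nu> + \<beta>, j) \<in> S" using a by (simp add: S_def)
    thus False using p(2) pn wrank_less[of \<nu> \<beta> j] a b by force
  qed
  have "br e v = 0" if e: "\<beta> \<in> Ps" "e \<in> wsp (\<beta>, 0)" for \<beta> e
  proof (rule ccontr)
    assume nz: "br e v \<noteq> 0"
    have bW: "(\<beta>, 0) \<in> Wt" "\<beta> \<noteq> 0" using Ps_wt[OF e(1)] by auto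
    have eq: "wadd (\<beta>, 0) (\<nu>, j) = (\<nu> + \<beta>, j)" using j by (simp add: wadd_0_left add.commute)
    have W: "(\<nu> + \<beta>, j) \<in> Wt" using br_Wt[OF bW(1) nu(1) e(2) v(1) nz] eq by simp
    hence z: "\<nu> + \<beta> = 0" using inS[OF e(1)] by blast
    hence opp: "fst (\<nu>, j) = - fst (\<beta>, 0 :: nat)" by (simp add: eq_neg_iff_add_eq_0)
    have "e \<noteq> 0" using nz by auto
    hence "br e (br e v) \<noteq> 0" using bW by (intro raise_opposite[OF bW(1) _ e(2) _ nu(1) v opp]) auto
    moreover have "br e v \<in> wsp (\<nu> + \<beta>, j)" using br_wsp[OF Wt_lt[OF bW(1)] Wt_lt[OF nu(1)] e(2) v(1)] eq by simp
    ultimately have "wadd (\<beta>, 0) (\<nu> + \<beta>, j) \<in> Wt" by (intro br_Wt[OF bW(1) W e(2)])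
    hence W2: "(\<nu> + \<beta> + \<beta>, j) \<in> Wt" using j by (simp add: wadd_0_left add.commute)
    have "\<nu> + \<beta> + \<beta> - \<mu> \<in> qplus Dl"
      using qplus_add_closed[OF qplus_add_closed[OF nu(3) Ps_qplus[OF e(1)]] Ps_qplus[OF e(1)]] by (simp add: algebra_simps)
    moreover have "\<nu> + \<beta> + \<beta> \<noteq> 0" using z bW(2) by simp
    ultimately have "(\<nu> + \<beta> + \<beta>, j) \<in> S" using W2 by (simp add: S_def)
    hence "wrank (\<nu> + \<beta> + \<beta>, j) \<le> wrank (\<nu>, j)" using p(2) pn by blast
    thus False using wrank_less[OF W e(1)] wrank_less[OF W2 e(1)] by simp
  qed
  hence "maxv (\<nu>, j) v" using nu v by (simp add: maxv_def)
  thus ?thesis using nu by blast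
qed

lemma is_weight_low:
  assumes v: "maxv (\<mu>, j) v"
  shows "is_weight scale br h0 (span (low v)) \<mu>"
    and "is_weight scale br h0 (span (low v)) \<nu> \<Longrightarrow> \<mu> - \<nu> \<in> qplus Dl"
proof -
  have v': "v \<in> wsp (\<mu>, j)" "(\<mu>, j) \<in> Wt" "v \<noteq> 0" "j < n" using v Wt_lt[of "(\<mu>, j)"] by (auto simp: maxv_def)
  show "is_weight scale br h0 (span (low v)) \<mu>"
    using v' Wt_nrm[OF v'(2)] span_base[OF low_base[of v]] by (auto simp: is_weight_def nrm_def wsp_def wvec_def)
  assume "is_weight scale br h0 (span (low v)) \<nu>"
  then obtain m where m: "nrm \<nu>" "m \<in> span (low v)" "m \<noteq> 0" "m \<in> wvec \<nu>" by (auto simp: is_weight_def nrm_def wvec_def)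
  hence "m \<in> wsp (\<nu>, j)" using low_gr[OF v'(1,4)] by (auto simp: wsp_def)
  thus "\<mu> - \<nu> \<in> qplus Dl" using low_weight[OF v'(1,2) m(2) _ m(3,1)] by blast
qed

lemma maxv_highest_weight:
  assumes v: "maxv (\<mu>, j) v" "\<mu> \<noteq> 0"
  shows "highest_weight scale br gr h0 b0 j \<mu>"
proof -
  have v': "v \<in> wsp (\<mu>, j)" "v \<noteq> 0" "j < n" using v(1) Wt_lt[of "(\<mu>, j)"] by (auto simp: maxv_def)
  have "span (low v) \<noteq> {0}" using span_base[OF low_base[of v]] v'(2) by auto
  thus ?thesis
    unfolding highest_weight_def Dl_def[symmetric]
    using low_gr[OF v'(1,3)] low_span_gr0[OF v(1)] is_weight_low[OF v(1)] low_irreducible[OF v]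
    by (intro exI[of _ "span (low v)"] conjI allI impI ballI) (auto simp: subspace_span)
qed

text \<open>For functional 0 there are two cases: a vector moved by a positive root vector gives the
  weight \<open>\<beta>\<close> above 0, and one killed by all of them is invariant and spans a
  one-dimensional module.\<close>

theorem exists_highest_weight:
  assumes "(\<mu>, j) \<in> Wt"
  shows "\<exists>lam. highest_weight scale br gr h0 b0 j lam \<and> lam - \<mu> \<in> qplus Dl"
proof (cases "\<mu> = 0")
  case False
  thus ?thesis using exists_maxv[OF assms] maxv_highest_weight by blast
next
  case True
  have j: "j < n" using Wt_lt[OF assms] by simp
  obtain v where v: "v \<in> wsp (0, j)" "v \<noteq> 0" using Wt_vec[OF assms] True by blast
  have W0: "(0, j) \<in> Wt" using assms True by simp
  show ?thesis
  proof (cases "\<exists>\<beta>\<in>Ps. \<exists>e\<in>wsp (\<beta>, 0). br e v \<noteq> 0")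
    case True
    then obtain \<beta> e where e: "\<beta> \<in> Ps" "e \<in> wsp (\<beta>, 0)" "br e v \<noteq> 0" by blast
    have bW: "(\<beta>, 0) \<in> Wt" "\<beta> \<noteq> 0" using Ps_wt[OF e(1)] by auto
    have "wadd (\<beta>, 0) (0, j) \<in> Wt" by (rule br_Wt[OF bW(1) W0 e(2) v(1) e(3)])
    hence "(\<beta>, j) \<in> Wt" using j by (simp add: wadd_0_left)
    then obtain \<nu> v' where nu: "maxv (\<nu>, j) v'" "\<nu> \<noteq> 0" "\<nu> - \<beta> \<in> qplus Dl" using exists_maxv bW(2) by blast
    have "\<nu> - \<mu> \<in> qplus Dl" using qplus_add_closed[OF nu(3) Ps_qplus[OF e(1)]] \<open>\<mu> = 0\<close> by simp
    thus ?thesis using maxv_highest_weight[OF nu(1,2)] by blast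
  next
    case False
    have inv: "br x v = 0" if "x \<in> gr 0" for x
      by (rule invariant_vector[OF W0 v(1)]) (use False that in auto)
    have mem: "\<exists>c. u = c *s v" if "u \<in> span {v}" for u using that by (auto simp: span_singleton)
    have st: "br x u = 0" if xu: "x \<in> gr 0" "u \<in> span {v}" for x u
      using mem[OF xu(2)] inv[OF xu(1)] by (auto simp: br_scale_right)
    have vM: "v \<in> span {v}" by (simp add: span_base)
    have "highest_weight scale br gr h0 b0 j 0"
      unfolding highest_weight_def Dl_def[symmetric]
    proof (intro exI[of _ "span {v}"] conjI allI impI ballI)
      show "span {v} \<subseteq> gr j" by (rule span_minimal[OF _ subspace_gr[OF j]]) (use v in \<open>simp add: wsp_def\<close>)
      show "br x u \<in> span {v}" if "x \<in> gr 0" "u \<in> span {v}" for x u using st[OF that] by (simp add: span_zero)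
      show "span {v} \<noteq> {0}" using vM v(2) by blast
      show "N = {0} \<or> N = span {v}"
        if N: "subspace N \<and> N \<subseteq> span {v} \<and> (\<forall>x\<in>gr 0. \<forall>v\<in>N. br x v \<in> N)" for N
      proof (rule disjCI)
        assume "N \<noteq> span {v}"
        show "N = {0}"
        proof (rule ccontr)
          assume "N \<noteq> {0}"
          then obtain u where u: "u \<in> N" "u \<noteq> 0" using N subspace_0 by blast
          then obtain c where c: "u = c *s v" using N mem by blast
          hence "(1 / c) *s u = v" using u(2) by auto
          hence "v \<in> N" using u(1) N subspace_scale by metis
          hence "span {v} \<subseteq> N" using N by (intro span_minimal) auto
          thus False using N \<open>N \<noteq> span {v}\<close> by blast
        qed
      qed
      show "is_weight scale br h0 (span {v}) 0"
        using v vM by (auto simp: is_weight_def wsp_def wvec_def)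
      show "0 - \<nu> \<in> qplus Dl" if w: "is_weight scale br h0 (span {v}) \<nu>" for \<nu>
      proof -
        obtain u where u: "u \<in> span {v}" "u \<noteq> 0" "nrm \<nu>" "\<forall>x\<in>h0. br x u = \<nu> x *s u"
          using w by (auto simp: is_weight_def nrm_def)
        have "\<nu> x = 0" for x
        proof (cases "x \<in> h0")
          case True
          hence "\<nu> x *s u = 0" using st[OF _ u(1)] u(4) h0_gr by force
          thus ?thesis using u(2) by simp
        qed (use u(3) in \<open>simp add: nrm_def\<close>)
        hence "\<nu> = 0" by (simp add: fun_eq_iff)
        thus ?thesis by (simp add: qplus_zero)
      qed
    qed (rule subspace_span)
    thus ?thesis using \<open>\<mu> = 0\<close> qplus_zero by force
  qed
qed

text \<open>The module \<open>J\<close> generated by a maximal vector is an ideal of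
  \<open>gr 0\<close>. Each element of \<open>gr 0\<close> is one of \<open>J\<close> plus one
  orthogonal to \<open>J\<close>, which acts on \<open>J\<close> as zero; so ideals of
  \<open>J\<close> are stable under \<open>gr 0\<close>, and irreducibility gives
  simplicity.\<close>

theorem exists_highest_root:
  assumes "(\<mu>, 0) \<in> Wt" "\<mu> \<noteq> 0"
  shows "\<exists>\<theta>. highest_root scale br gr h0 b0 \<theta> \<and> \<theta> - \<mu> \<in> qplus Dl"
proof -
  obtain \<theta> v where v: "maxv (\<theta>, 0) v" "\<theta> \<noteq> 0" "\<theta> - \<mu> \<in> qplus Dl" using exists_maxv[OF assms] by blast
  have v': "v \<in> wsp (\<theta>, 0)" "(\<theta>, 0) \<in> Wt" "v \<noteq> 0" using v(1) by (auto simp: maxv_def)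
  define J where "J = span (low v)"
  have subJ: "subspace J" by (simp add: J_def)
  have Jgr: "J \<subseteq> gr 0" unfolding J_def by (rule low_gr[OF v'(1) n_pos])
  have Jst: "br x u \<in> J" if "x \<in> gr 0" "u \<in> J" for x u using low_span_gr0[OF v(1)] that by (simp add: J_def)
  have irr: "N = {0} \<or> N = J" if "subspace N" "N \<subseteq> J" "\<And>x u. x \<in> gr 0 \<Longrightarrow> u \<in> N \<Longrightarrow> br x u \<in> N" for N
    using low_irreducible[OF v(1,2) that[unfolded J_def]] by (simp add: J_def)
  have vJ: "v \<in> J" unfolding J_def by (intro span_base low_base)
  have "\<exists>f t. sl2 (\<theta>, 0) v f t" by (rule sl2_exists[OF v'(2) _ v'(1,3)]) (simp add: v(2))
  then obtain f t where s: "sl2 (\<theta>, 0) v f t" by blast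
  have f: "f \<in> wsp (wneg (\<theta>, 0))" "br v f = t" "t \<in> h0" "\<theta> t = 2" "kf v f \<noteq> 0" using s by (auto simp: sl2_def)
  have fgr: "f \<in> gr 0" using f(1) by (simp add: wsp_def wneg_def)
  \<comment> \<open>Bracketing with \<open>f\<close> carries \<open>v\<close> to \<open>t\<close>
    and \<open>t\<close> to \<open>f\<close> up to scalars, so the triple lies in \<open>J\<close>.
    This makes \<open>kf\<close> nonzero on \<open>J\<close>, and irreducibility then forces the
    radical \<open>R\<close> to be 0.\<close>
  have "t = - br f v" by (rule trans[OF f(2)[symmetric] br_skew])
  hence tJ: "t \<in> J" using subspace_neg[OF subJ Jst[OF fgr vJ]] by (simp only:)
  have "br t f = (- 2) *s f" using wsp_h0[OF f(3,1)] f(4) by simp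
  hence "br f t = 2 *s f" using br_skew[of f t] by simp
  hence "f = (1 / 2) *s br f t" by simp
  hence fJ: "f \<in> J" using Jst[OF fgr tJ] subspace_scale[OF subJ] by metis
  define R where "R = {x \<in> J. \<forall>y\<in>J. kf x y = 0}"
  have "subspace R" using subJ by (auto simp: R_def subspace_def kf_add_left kf_scale_left)
  moreover have "R \<subseteq> J" by (auto simp: R_def)
  moreover have "br x u \<in> R" if "x \<in> gr 0" "u \<in> R" for x u
    using that Jst by (simp add: R_def kf_invariant_minus)
  ultimately have "R = {0} \<or> R = J" by (rule irr)
  moreover have "v \<notin> R" using fJ f(5) by (auto simp: R_def)
  ultimately have R0: "R = {0}" using vJ by blast
  have simple: "simple_lie scale br J"
    unfolding simple_lie_def
  proof (intro conjI allI impI)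
    show "lie_subalg scale br J" using subJ Jst Jgr by (auto simp: lie_subalg_def)
    have "t \<noteq> 0" using weight_scale[OF v'(2) f(3), of 0] f(4) by auto
    thus "\<exists>x\<in>J. \<exists>y\<in>J. br x y \<noteq> 0" using vJ fJ f(2) by blast
    fix K assume "lie_ideal scale br J K"
    hence K: "subspace K" "K \<subseteq> J" "\<And>x y. x \<in> J \<Longrightarrow> y \<in> K \<Longrightarrow> br x y \<in> K" by (auto simp: lie_ideal_def)
    show "K = {0} \<or> K = J"
    proof (rule irr[OF K(1,2)])
      fix a u assume a: "a \<in> gr 0" and u: "u \<in> K"
      obtain b where b: "b \<in> J" "\<forall>x\<in>J. kf (a - b) x = 0"
        using kf_complement[OF subJ, of a] R0 by (auto simp: R_def)
      have uJ: "u \<in> J" using u K(2) by blast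
      have "a - b \<in> gr 0" using a b Jgr subspace_diff[OF subspace_gr[OF n_pos]] by blast
      hence "br (a - b) u \<in> J" by (rule Jst[OF _ uJ])
      moreover have "kf (br (a - b) u) y = 0" if "y \<in> J" for y
        using b(2) Jst[of u y] uJ Jgr that by (auto simp: kf_invariant)
      ultimately have "br (a - b) u \<in> R" by (simp add: R_def)
      hence "br a u = br b u" using R0 by (simp add: br_diff_left)
      thus "br a u \<in> K" using K(3)[OF b(1) u] by simp
    qed
  qed
  have "lie_ideal scale br (gr 0) J" using subJ Jgr Jst by (auto simp: lie_ideal_def)
  hence "highest_root scale br gr h0 b0 \<theta>"
    unfolding highest_root_def Dl_def[symmetric]
    using simple v(2) is_weight_low[OF v(1)] by (intro exI[of _ J]) (auto simp: J_def)
  thus ?thesis using v(3) by blast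
qed

subsection \<open>From antichains to nilpotent subalgebras\<close>

lemma highest_weight_Wt:
  assumes "highest_weight scale br gr h0 b0 j lam" "j < n"
  shows "(lam, j) \<in> Wt"
proof -
  obtain M where "M \<subseteq> gr j" "is_weight scale br h0 M lam"
    using assms(1) by (auto simp: highest_weight_def)
  hence "is_weight scale br h0 (gr j) lam" by (auto simp: is_weight_def)
  thus ?thesis using is_weight_Wt[OF assms(2)] by simp
qed

lemma highest_root_Wt:
  assumes "highest_root scale br gr h0 b0 \<theta>"
  shows "(\<theta>, 0) \<in> Wt"
proof -
  obtain s where "s \<subseteq> gr 0" "is_weight scale br h0 s \<theta>"
    using assms by (auto simp: highest_root_def lie_ideal_def)
  hence "is_weight scale br h0 (gr 0) \<theta>" by (auto simp: is_weight_def)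
  thus ?thesis using is_weight_Wt[OF n_pos] by simp
qed

lemma Sigma_plus_iff: "p \<in> Sigma_plus scale br n gr h0 \<longleftrightarrow> p \<in> Wt \<and> snd p \<noteq> 0 \<and> fst p \<noteq> 0"
  using is_weight_Wt[of "snd p" "fst p"] Wt_lt[of p] by (cases p) (auto simp: Sigma_plus_def)

lemma preceq0_wadd: "preceq0 Dl a p \<Longrightarrow> preceq0 Dl b q \<Longrightarrow> preceq0 Dl (wadd a b) (wadd p q)"
  using qplus_add_closed[of "fst p - fst a" Dl "fst q - fst b"]
  by (simp add: preceq0_def wadd_def algebra_simps)

lemma psum_append: "psum n (as @ bs) = wadd (psum n as) (psum n bs)"
  by (simp add: psum_def wadd_def mod_add_eq)

lemma psum_replicate: "psum n (replicate m p) = (of_nat m * fst p, (m * snd p) mod n)"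
  by (simp add: psum_def sum_list_replicate)

lemma psum_single: "snd p < n \<Longrightarrow> psum n [p] = p"
  by (simp add: psum_def prod_eq_iff)

lemma psum_replicate_mono:
  assumes "preceq0 Dl a p"
  shows "preceq0 Dl (psum n (replicate m a)) (psum n (replicate m p))"
proof (induction m)
  case (Suc m)
  thus ?case using preceq0_wadd[OF assms Suc] by (simp add: psum_wadd)
qed simp

end

section \<open>The subalgebra spanned above an antichain\<close>

locale antichain_data = borel_lie scale Basis br h n gr h0 b0
  for scale :: "complex \<Rightarrow> 'b \<Rightarrow> 'b::ab_group_add" (infixr "*s" 75) and Basis
    and br :: "'b \<Rightarrow> 'b \<Rightarrow> 'b" and h n gr h0 b0 +
  fixes k :: nat and A :: "(('b \<Rightarrow> complex) \<times> nat) set"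
  assumes anti: "antichain Dl A"
    and A_sub: "A \<subseteq> Sigma_plus scale br n gr h0"
    and cond1: "length xs = k + 1 \<Longrightarrow> set xs \<subseteq> A \<Longrightarrow> highest_weight scale br gr h0 b0 (snd (psum n xs)) lam
      \<Longrightarrow> \<not> preceq0 Dl (psum n xs) (lam, snd (psum n xs))"
    and cond2: "xs \<noteq> [] \<Longrightarrow> set xs \<subseteq> A \<Longrightarrow> snd (psum n xs) = 0 \<Longrightarrow> highest_root scale br gr h0 b0 \<theta>
      \<Longrightarrow> \<not> preceq0 Dl (psum n xs) (\<theta>, 0)"
    and cond3: "p1 \<in> A \<Longrightarrow> p2 \<in> A \<Longrightarrow> (\<nu>, snd (psum n [p1, p2])) \<in> Sigma_plus scale br n gr h0
      \<Longrightarrow> preceq0 Dl (psum n [p1, p2]) (\<nu>, snd (psum n [p1, p2]))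
      \<Longrightarrow> \<exists>\<alpha>. (\<alpha>, snd (psum n [p1, p2])) \<in> A \<and> preceq0 Dl (\<alpha>, snd (psum n [p1, p2])) (\<nu>, snd (psum n [p1, p2]))"
begin

lemma A_Wt: "a \<in> A \<Longrightarrow> a \<in> Wt \<and> snd a \<noteq> 0 \<and> fst a \<noteq> 0"
  using A_sub Sigma_plus_iff by blast

text \<open>Every weight lies below a highest weight, which extends the first condition from highest
  weights to all weights.\<close>

lemma no_long_sum:
  assumes "length xs = k + 1" "set xs \<subseteq> A" "p \<in> Wt"
  shows "\<not> preceq0 Dl (psum n xs) p"
proof
  assume le: "preceq0 Dl (psum n xs) p"
  hence s: "snd p = snd (psum n xs)" by (simp add: preceq0_def)
  have "(fst p, snd p) \<in> Wt" using assms(3) by simp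
  then obtain lam where lam: "highest_weight scale br gr h0 b0 (snd p) lam" "lam - fst p \<in> qplus Dl"
    using exists_highest_weight by blast
  have "preceq0 Dl p (lam, snd p)" using lam(2) by (simp add: preceq0_def)
  hence "preceq0 Dl (psum n xs) (lam, snd (psum n xs))" using preceq0_trans[OF le] s by simp
  thus False using cond1[OF assms(1,2)] lam(1) s by simp
qed

lemma no_root_above:
  assumes "xs \<noteq> []" "set xs \<subseteq> A" "p \<in> Wt" "snd p = 0" "fst p \<noteq> 0"
  shows "\<not> preceq0 Dl (psum n xs) p"
proof
  assume le: "preceq0 Dl (psum n xs) p"
  hence s: "snd (psum n xs) = 0" using assms(4) by (simp add: preceq0_def)
  have "(fst p, 0) \<in> Wt" using assms(3,4) by (metis prod.collapse)
  then obtain \<theta> where \<theta>: "highest_root scale br gr h0 b0 \<theta>" "\<theta> - fst p \<in> qplus Dl"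
    using exists_highest_root assms(5) by blast
  have "preceq0 Dl p (\<theta>, 0)" using \<theta>(2) assms(4) by (simp add: preceq0_def)
  thus False using preceq0_trans[OF le] cond2[OF assms(1,2) s \<theta>(1)] by blast
qed

definition S :: "(('b \<Rightarrow> complex) \<times> nat) set" where
  "S = {p \<in> Wt. snd p \<noteq> 0 \<and> fst p \<noteq> 0 \<and> (\<exists>a\<in>A. preceq0 Dl a p)}"

lemma S_Wt: "p \<in> S \<Longrightarrow> p \<in> Wt"
  by (simp add: S_def)

text \<open>Below two opposite weights, a list of \<open>k + 1\<close> elements of \<open>A\<close> balanced between the two
  minorants has its sum below a weight of the chain.\<close>
lemma S_no_opposite:
  assumes "p \<in> S" "q \<in> S"
  shows "fst p + fst q \<noteq> 0"
proof
  assume 0: "fst p + fst q = 0"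
  have opp: "fst q = - fst p" using 0 by (simp add: eq_neg_iff_add_eq_0 add.commute)
  have p: "p \<in> Wt" "fst p \<noteq> 0" and q: "q \<in> Wt" using assms by (auto simp: S_def)
  obtain a b where ab: "a \<in> A" "preceq0 Dl a p" "b \<in> A" "preceq0 Dl b q" using assms by (auto simp: S_def)
  let ?c = "snd p + snd q"
  have closed: "wadd p (wadd p q) \<in> Wt \<and> wadd p q \<in> Wt"
    if pq: "p \<in> Wt" "q \<in> Wt" "fst p \<noteq> 0" "fst q = - fst p" for p q
  proof -
    obtain x where x: "x \<in> wsp p" "x \<noteq> 0" using Wt_vec[OF pq(1)] by blast
    obtain y where y: "y \<in> wsp q" "y \<noteq> 0" using Wt_vec[OF pq(2)] by blast
    note nz = raise_opposite[OF pq(1,3) x pq(2) y pq(4)]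
    have 1: "wadd p q \<in> Wt" by (rule br_Wt[OF pq(1,2) x(1) y(1) nz(1)])
    have "br x y \<in> wsp (wadd p q)" by (intro br_wsp Wt_lt pq x y)
    thus ?thesis using br_Wt[OF pq(1) 1 x(1) _ nz(2)] 1 by blast
  qed
  have chain: "(fst p, (snd p + m * ?c) mod n) \<in> Wt \<and> (fst q, (snd q + m * ?c) mod n) \<in> Wt" for m
    by (rule opposite_chain[OF _ p(1) q p(2) opp Wt_lt[OF p(1)] Wt_lt[OF q]]) (use closed in blast)
  have zero: "(0, (Suc m * ?c) mod n) \<in> Wt" for m
  proof -
    have "wadd p (fst q, (snd q + m * ?c) mod n) \<in> Wt"
      using closed[OF p(1) conjunct2[OF chain[of m]] p(2)] opp by (simp only: fst_conv)
    moreover have "wadd p (fst q, (snd q + m * ?c) mod n) = (0, (Suc m * ?c) mod n)"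
      using 0 by (simp add: wadd_def mod_add_right_eq add.assoc)
    ultimately show ?thesis by simp
  qed
  have le: "preceq0 Dl (psum n (replicate r a @ replicate s b)) (psum n (replicate r p @ replicate s q))" for r s
    unfolding psum_append by (intro preceq0_wadd psum_replicate_mono ab)
  have q': "fst q x = - fst p x" for x using opp by simp
  \<comment> \<open>Splitting \<open>k + 1\<close> into \<open>r\<close> and \<open>m\<close> with
    \<open>r - m\<close> at most 1 makes the functionals cancel to 0 or to \<open>fst p\<close>; the
    resulting degrees are those supplied by \<open>zero\<close> and \<open>chain\<close>.\<close>
  define m where "m = (k + 1) div 2"
  define r where "r = k + 1 - m"
  have rm: "r + m = k + 1" "r = m \<or> r = Suc m" unfolding r_def m_def by presburger+
  have "psum n (replicate r p @ replicate m q) \<in> Wt"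
    using rm(2)
  proof
    assume "r = m"
    \<comment> \<open>\<open>m\<close> is positive because \<open>k + 1\<close> is; this matches the
      successor in \<open>zero\<close>.\<close>
    then obtain m' where m': "m = Suc m'" using rm(1) by (cases m) auto
    have "psum n (replicate r p @ replicate m q) = (0, (Suc m' * ?c) mod n)"
      unfolding psum_append psum_replicate \<open>r = m\<close> m'
      by (rule prod_eqI) (simp_all add: wadd_def mod_add_eq fun_eq_iff q' algebra_simps del: of_nat_Suc)
    thus ?thesis using zero by simp
  next
    assume "r = Suc m"
    have "psum n (replicate r p @ replicate m q) = (fst p, (snd p + m * ?c) mod n)"
      unfolding psum_append psum_replicate \<open>r = Suc m\<close>
      by (rule prod_eqI) (simp_all add: wadd_def mod_add_eq fun_eq_iff q' algebra_simps)
    thus ?thesis using chain by simp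
  qed
  moreover have "length (replicate r a @ replicate m b) = k + 1" using rm(1) by simp
  moreover have "set (replicate r a @ replicate m b) \<subseteq> A" using ab by auto
  ultimately show False using no_long_sum le by blast
qed

text \<open>\<open>S_no_opposite\<close> excludes functional 0, the second condition excludes degree
  0, and the third provides an element of \<open>A\<close> below the new weight.\<close>

lemma S_br:
  assumes "p \<in> S" "q \<in> S" "x \<in> wsp p" "y \<in> wsp q" "br x y \<noteq> 0"
  shows "wadd p q \<in> S"
proof -
  have W: "wadd p q \<in> Wt" by (rule br_Wt[OF S_Wt[OF assms(1)] S_Wt[OF assms(2)] assms(3-5)])
  have nz: "fst (wadd p q) \<noteq> 0" using S_no_opposite[OF assms(1,2)] by simp
  obtain a b where ab: "a \<in> A" "preceq0 Dl a p" "b \<in> A" "preceq0 Dl b q" using assms(1,2) by (auto simp: S_def)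
  have sum: "psum n [a, b] = wadd a b"
    using psum_single[of b] A_Wt[OF ab(3)] Wt_lt[of b] by (simp add: psum_wadd)
  hence le: "preceq0 Dl (psum n [a, b]) (wadd p q)" using preceq0_wadd[OF ab(2,4)] by simp
  have deg: "snd (wadd p q) \<noteq> 0"
  proof
    assume "snd (wadd p q) = 0"
    thus False using no_root_above[OF _ _ W _ nz, of "[a, b]"] le ab by simp
  qed
  have s: "snd (psum n [a, b]) = snd (wadd p q)" using le by (simp only: preceq0_def)
  have pq: "(fst (wadd p q), snd (psum n [a, b])) = wadd p q" unfolding s by (rule prod.collapse)
  have "wadd p q \<in> Sigma_plus scale br n gr h0" using W nz deg by (simp only: Sigma_plus_iff) simp
  then obtain \<alpha> where "(\<alpha>, snd (psum n [a, b])) \<in> A" "preceq0 Dl (\<alpha>, snd (psum n [a, b])) (wadd p q)"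
    using cond3[OF ab(1,3), of "fst (wadd p q)"] le unfolding pq by blast
  thus ?thesis using W nz deg unfolding S_def by blast
qed

text \<open>The element of \<open>A\<close> below \<open>p\<close> stays below, so only functional 0
  has to be excluded: raising once more would put \<open>\<beta>\<close> in \<open>S\<close>,
  opposite to \<open>fst p\<close>.\<close>

lemma S_b0:
  assumes "\<beta> \<in> Ps" "e \<in> wsp (\<beta>, 0)" "p \<in> S" "x \<in> wsp p" "br e x \<noteq> 0"
  shows "wadd (\<beta>, 0) p \<in> S"
proof -
  have bW: "(\<beta>, 0) \<in> Wt" "\<beta> \<noteq> 0" "nrm \<beta>" using Ps_wt[OF assms(1)] by auto
  have p: "p \<in> Wt" "snd p < n" "snd p \<noteq> 0" "fst p \<noteq> 0" using assms(3) Wt_lt by (auto simp: S_def)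
  obtain a where a: "a \<in> A" "preceq0 Dl a p" using assms(3) by (auto simp: S_def)
  have W: "wadd (\<beta>, 0) p \<in> Wt" by (rule br_Wt[OF bW(1) p(1) assms(2,4,5)])
  have snd': "snd (wadd (\<beta>, 0) q) = snd q" if "snd q < n" for q using that by (simp add: wadd_def)
  have le: "preceq0 Dl q (wadd (\<beta>, 0) q)" if "snd q < n" for q
    using Ps_qplus[OF assms(1)] snd'[OF that] by (simp add: preceq0_def)
  have "\<beta> + fst p \<noteq> 0"
  proof
    assume 0: "\<beta> + fst p = 0"
    hence opp: "fst p = - fst (\<beta>, 0 :: nat)" by (simp add: eq_neg_iff_add_eq_0 add.commute)
    have "e \<noteq> 0" "x \<noteq> 0" using assms(5) by auto
    hence "br e (br e x) \<noteq> 0" using bW by (intro raise_opposite[OF bW(1) _ assms(2) _ p(1) assms(4) _ opp]) auto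
    moreover have "br e x \<in> wsp (wadd (\<beta>, 0) p)" by (intro br_wsp Wt_lt bW p assms)
    ultimately have W2: "wadd (\<beta>, 0) (wadd (\<beta>, 0) p) \<in> Wt" by (intro br_Wt[OF bW(1) W assms(2)])
    have f: "fst (wadd (\<beta>, 0) (wadd (\<beta>, 0) p)) = \<beta>" using 0 by simp
    have "preceq0 Dl a (wadd (\<beta>, 0) (wadd (\<beta>, 0) p))"
      using preceq0_trans[OF preceq0_trans[OF a(2) le[OF p(2)]] le[OF wadd_lt]] .
    hence "wadd (\<beta>, 0) (wadd (\<beta>, 0) p) \<in> S"
      using W2 a(1) f bW(2) p snd'[OF wadd_lt] snd'[OF p(2)] by (auto simp: S_def)
    thus False using S_no_opposite[OF _ assms(3)] f 0 by metis
  qed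
  thus ?thesis using W a p preceq0_trans[OF a(2) le[OF p(2)]] snd'[OF p(2)] by (auto simp: S_def)
qed

definition IA :: "'b set" where
  "IA = span (\<Union>p\<in>S. wsp p)"

lemma wsp_IA: "p \<in> S \<Longrightarrow> x \<in> wsp p \<Longrightarrow> x \<in> IA"
  unfolding IA_def by (rule span_base) blast

lemma IA_br: "x \<in> IA \<Longrightarrow> y \<in> IA \<Longrightarrow> br x y \<in> IA"
  unfolding IA_def
proof (rule br_span[OF _ _ subspace_span])
  fix x y assume "x \<in> (\<Union>p\<in>S. wsp p)" "y \<in> (\<Union>p\<in>S. wsp p)"
  then obtain p q where pq: "p \<in> S" "q \<in> S" "x \<in> wsp p" "y \<in> wsp q" by blast
  show "br x y \<in> span (\<Union>p\<in>S. wsp p)"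
  proof (cases "br x y = 0")
    case False
    have "br x y \<in> wsp (wadd p q)" by (intro br_wsp Wt_lt S_Wt pq)
    thus ?thesis using wsp_IA[OF S_br[OF pq False]] by (simp add: IA_def)
  qed (simp add: span_zero)
qed

lemma IA_b0: "x \<in> b0 \<Longrightarrow> y \<in> IA \<Longrightarrow> br x y \<in> IA"
proof (rule br_span[of x "h0 \<union> (\<Union>\<alpha>\<in>Ps. wsp (\<alpha>, 0))" y "\<Union>p\<in>S. wsp p"])
  show "x \<in> span (h0 \<union> (\<Union>\<alpha>\<in>Ps. wsp (\<alpha>, 0)))" if "x \<in> b0" using that b0_span by blast
  show "subspace IA" by (simp add: IA_def)
  fix x y assume x: "x \<in> h0 \<union> (\<Union>\<alpha>\<in>Ps. wsp (\<alpha>, 0))" and "y \<in> (\<Union>p\<in>S. wsp p)"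
  then obtain p where p: "p \<in> S" "y \<in> wsp p" by blast
  show "br x y \<in> IA"
    using x
  proof
    assume "x \<in> h0"
    thus ?thesis using wsp_h0[OF _ p(2)] wsp_IA[OF p] by (simp add: IA_def span_scale)
  next
    assume "x \<in> (\<Union>\<alpha>\<in>Ps. wsp (\<alpha>, 0))"
    then obtain \<beta> where b: "\<beta> \<in> Ps" "x \<in> wsp (\<beta>, 0)" by blast
    show ?thesis
    proof (cases "br x y = 0")
      case False
      have "br x y \<in> wsp (wadd (\<beta>, 0) p)"
        by (rule br_wsp[OF Wt_lt Wt_lt[OF S_Wt[OF p(1)]] b(2) p(2)]) (use Ps_wt[OF b(1)] in blast)
      thus ?thesis using wsp_IA[OF S_b0[OF b p False]] by blast
    qed (simp add: IA_def span_zero)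
  qed
qed (simp_all add: IA_def)

text \<open>The length is \<open>Suc m\<close> because \<open>m\<close> nested brackets in
  \<open>IA\<close> involve \<open>m + 1\<close> vectors, counting the innermost one; at
  \<open>m = k\<close> the level is empty.\<close>

definition S_level :: "nat \<Rightarrow> (('b \<Rightarrow> complex) \<times> nat) set" where
  "S_level m = {p \<in> S. \<exists>as. length as = Suc m \<and> set as \<subseteq> A \<and> preceq0 Dl (psum n as) p}"

lemma S_level_0: "S \<subseteq> S_level 0"
proof
  fix p assume p: "p \<in> S"
  then obtain a where a: "a \<in> A" "preceq0 Dl a p" by (auto simp: S_def)
  have "psum n [a] = a" using A_Wt[OF a(1)] Wt_lt by (intro psum_single) blast
  thus "p \<in> S_level 0" unfolding S_level_def using p a by (intro CollectI conjI exI[of _ "[a]"]) simp_all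
qed

lemma S_level_Suc:
  assumes "p \<in> S" "x \<in> wsp p" "q \<in> S_level m" "y \<in> wsp q" "br x y \<noteq> 0"
  shows "wadd p q \<in> S_level (Suc m)"
proof -
  obtain as where q: "q \<in> S" and as: "length as = Suc m" "set as \<subseteq> A" "preceq0 Dl (psum n as) q"
    using assms(3) by (auto simp: S_level_def)
  obtain a where a: "a \<in> A" "preceq0 Dl a p" using assms(1) by (auto simp: S_def)
  have "preceq0 Dl (psum n (a # as)) (wadd p q)" using preceq0_wadd[OF a(2) as(3)] by (simp add: psum_wadd)
  thus ?thesis unfolding S_level_def
    using S_br[OF assms(1) q assms(2,4,5)] as a by (intro CollectI conjI exI[of _ "a # as"]) simp_all
qed

lemma IA_itbr:
  assumes "set xs \<subseteq> IA" "y \<in> IA"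
  shows "itbr br xs y \<in> span (\<Union>p\<in>S_level (length xs). wsp p)"
  using assms(1)
proof (induction xs)
  case Nil
  have "IA \<subseteq> span (\<Union>p\<in>S_level 0. wsp p)"
    unfolding IA_def by (rule span_mono[OF UN_mono[OF S_level_0 order_refl]])
  thus ?case using assms(2) by auto
next
  case (Cons x xs)
  have "br x (itbr br xs y) \<in> span (\<Union>p\<in>S_level (Suc (length xs)). wsp p)"
  proof (rule br_span[OF _ _ subspace_span])
    show "x \<in> span (\<Union>p\<in>S. wsp p)" using Cons.prems by (simp add: IA_def)
    show "itbr br xs y \<in> span (\<Union>p\<in>S_level (length xs). wsp p)" using Cons by simp
    fix x y assume "x \<in> (\<Union>p\<in>S. wsp p)" "y \<in> (\<Union>p\<in>S_level (length xs). wsp p)"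
    then obtain p q where pq: "p \<in> S" "x \<in> wsp p" "q \<in> S_level (length xs)" "y \<in> wsp q" by blast
    show "br x y \<in> span (\<Union>p\<in>S_level (Suc (length xs)). wsp p)"
    proof (cases "br x y = 0")
      case False
      have "q \<in> S" using pq(3) by (simp add: S_level_def)
      hence "br x y \<in> wsp (wadd p q)" by (intro br_wsp Wt_lt S_Wt pq)
      thus ?thesis using S_level_Suc[OF pq False] by (intro span_base) blast
    qed (simp add: span_zero)
  qed
  thus ?case by simp
qed

lemma IA_kn: "kn_pg_b0_subalg scale br n gr b0 k IA"
  unfolding kn_pg_b0_subalg_def
proof (intro conjI allI ballI impI)
  show "lie_subalg scale br IA" using IA_br by (auto simp: lie_subalg_def IA_def)
  show "br x y \<in> IA" if "x \<in> b0" "y \<in> IA" for x y using IA_b0 that by blast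
  show "itbr br xs y = 0" if xs: "length xs = k \<and> set xs \<subseteq> IA \<and> y \<in> IA" for xs y
  proof -
    have "S_level (length xs) = {}"
      using no_long_sum S_Wt xs unfolding S_level_def by auto
    hence "itbr br xs y \<in> span (\<Union>p\<in>{}. wsp p)" using IA_itbr[of xs y] xs by metis
    thus ?thesis by (simp only: UN_empty span_empty singleton_iff)
  qed
  fix x assume "x \<in> IA"
  thus "\<exists>f. (\<forall>j\<in>{1..<n}. f j \<in> IA \<inter> gr j) \<and> x = (\<Sum>j\<in>{1..<n}. f j)"
    unfolding IA_def
  proof (induction rule: span_induct_alt)
    case base
    show ?case using subspace_gr subspace_0 by (intro exI[of _ "\<lambda>_. 0"]) (auto simp: span_zero)
  next
    case (step c x y)
    obtain f where f: "\<forall>j\<in>{1..<n}. f j \<in> span (\<Union>p\<in>S. wsp p) \<inter> gr j" "y = (\<Sum>j\<in>{1..<n}. f j)" using step by blast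
    obtain p where p: "p \<in> S" "x \<in> wsp p" using step by blast
    have j: "snd p \<in> {1..<n}" using p(1) Wt_lt by (auto simp: S_def)
    let ?f = "\<lambda>j. (if j = snd p then c *s x else 0) + f j"
    have "c *s x + y = (\<Sum>j\<in>{1..<n}. ?f j)" using j f(2) by (simp add: sum.distrib)
    moreover have "?f j \<in> span (\<Union>p\<in>S. wsp p) \<inter> gr j" if j: "j \<in> {1..<n}" for j
    proof -
      have sub: "subspace (span (\<Union>p\<in>S. wsp p) \<inter> gr j)" using j by (intro subspace_inter subspace_span subspace_gr) auto
      have "c *s x \<in> span (\<Union>p\<in>S. wsp p) \<inter> gr (snd p)"
        using p wsp_IA[OF p] subspace_gr[OF Wt_lt[OF S_Wt[OF p(1)]]]
        by (auto simp: IA_def wsp_def intro: span_scale subspace_scale)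
      thus ?thesis using f(1) j subspace_0[OF sub] by (intro subspace_add[OF sub]) auto
    qed
    ultimately show ?case by (intro exI[of _ ?f]) blast
  qed
qed

lemma grwt_IA: "grwt scale br n gr h0 IA = S"
proof (rule set_eqI)
  fix p :: "('b \<Rightarrow> complex) \<times> nat"
  have "p \<in> grwt scale br n gr h0 IA \<longleftrightarrow> p \<in> Wt \<and> (\<exists>v\<in>IA \<inter> wsp p. v \<noteq> 0)"
    unfolding grwt_def is_weight_iff Wt_def by (cases p) auto
  also have "\<dots> \<longleftrightarrow> p \<in> S"
  proof
    assume p: "p \<in> Wt \<and> (\<exists>v\<in>IA \<inter> wsp p. v \<noteq> 0)"
    then obtain v where v: "v \<in> IA" "v \<in> wsp p" "v \<noteq> 0" by blast
    show "p \<in> S"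
    proof (rule ccontr)
      assume "p \<notin> S"
      \<comment> \<open>For \<open>p\<close> outside \<open>S\<close> the projection to
        \<open>wsp p\<close> kills every generator of \<open>IA\<close>, hence also
        \<open>v\<close>, which it would have to fix.\<close>
      have "D.prj p x = 0" if "q \<in> S" "x \<in> wsp q" for q x
        using D.prj_W[OF S_Wt[OF that(1)] that(2), of p] that(1) \<open>p \<notin> S\<close> by auto
      hence "(\<Union>q\<in>S. wsp q) \<subseteq> {x. D.prj p x \<in> {0}}" by blast
      hence "IA \<subseteq> {x. D.prj p x \<in> {0}}"
        unfolding IA_def by (rule span_minimal[OF _ lin_subspace_vimage[OF D.lin_prj subspace_single_0]])
      hence "D.prj p v = 0" using v(1) by blast
      thus False using D.prj_W[of p v p] p v by simp
    qed
  next
    assume "p \<in> S"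
    thus "p \<in> Wt \<and> (\<exists>v\<in>IA \<inter> wsp p. v \<noteq> 0)" using S_Wt Wt_vec wsp_IA by blast
  qed
  finally show "p \<in> grwt scale br n gr h0 IA \<longleftrightarrow> p \<in> S" .
qed

text \<open>Minimality of \<open>a\<close> in \<open>A\<close> uses the antichain property: below an
  element of \<open>S\<close> that is below \<open>a\<close> there is again an element of
  \<open>A\<close>, which must be \<open>a\<close>.\<close>

lemma minimal_S: "minimal_elems Dl S = A"
proof
  have AS: "A \<subseteq> S"
  proof
    fix a assume a: "a \<in> A"
    thus "a \<in> S" using A_Wt[OF a] preceq0_refl[of Dl a] unfolding S_def by blast
  qed
  show "minimal_elems Dl S \<subseteq> A"
  proof
    fix p assume p: "p \<in> minimal_elems Dl S"
    then obtain a where "a \<in> A" "preceq0 Dl a p" by (auto simp: minimal_elems_def S_def)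
    thus "p \<in> A" using p AS by (auto simp: minimal_elems_def)
  qed
  show "A \<subseteq> minimal_elems Dl S"
  proof
    fix a assume a: "a \<in> A"
    have "q = a" if q: "q \<in> S" "preceq0 Dl q a" for q
    proof -
      obtain b where b: "b \<in> A" "preceq0 Dl b q" using q(1) by (auto simp: S_def)
      have "b = a" using anti b(1) a preceq0_trans[OF b(2) q(2)] by (auto simp: antichain_def)
      thus ?thesis using preceq0_antisym q(2) b(2) by blast
    qed
    thus "a \<in> minimal_elems Dl S" using a AS by (auto simp: minimal_elems_def)
  qed
qed

theorem antichain_realized: "kn_antichain scale br n gr h0 b0 k A"
  unfolding kn_antichain_def Dl_def[symmetric]
  using IA_kn by (intro exI[of _ IA]) (simp add: grwt_IA minimal_S)

end

theorem theorem2p2: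
  fixes scale :: "complex \<Rightarrow> 'a \<Rightarrow> 'a::ab_group_add"
    and br :: "'a \<Rightarrow> 'a \<Rightarrow> 'a"
    and n :: nat and gr :: "nat \<Rightarrow> 'a set"
    and h h0 b0 :: "'a set" and k :: nat
    and A :: "(('a \<Rightarrow> complex) \<times> nat) set"
  defines "D \<equiv> simple_roots0 scale br gr h0 b0"
  assumes lie: "lie_algebra scale br"
    and fin: "finite_dim scale"
    and simple: "simple_lie scale br UNIV"
    and grading: "zn_grading scale br n gr"
    and cartan: "cartan_subalg scale br UNIV h"
    and h0_def: "h0 = h \<inter> gr 0"
    and cartan0: "cartan_subalg scale br (gr 0) h0"
    and borel: "borel_subalg scale br (gr 0) b0"
    and h0b0: "h0 \<subseteq> b0"
    and anti: "antichain D A"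
    and sub: "A \<subseteq> Sigma_plus scale br n gr h0"
  shows "kn_antichain scale br n gr h0 b0 k A \<longleftrightarrow>
     (\<forall>xs. length xs = k + 1 \<and> set xs \<subseteq> A \<longrightarrow>
        (\<forall>lam. highest_weight scale br gr h0 b0 (snd (psum n xs)) lam \<longrightarrow>
           \<not> preceq0 D (psum n xs) (lam, snd (psum n xs))))
   \<and> (\<forall>xs. xs \<noteq> [] \<and> set xs \<subseteq> A \<and> snd (psum n xs) = 0 \<longrightarrow>
        (\<forall>\<theta>. highest_root scale br gr h0 b0 \<theta> \<longrightarrow> \<not> preceq0 D (psum n xs) (\<theta>, 0)))
   \<and> (\<forall>p1\<in>A. \<forall>p2\<in>A. \<forall>\<nu>.
        (\<nu>, snd (psum n [p1, p2])) \<in> Sigma_plus scale br n gr h0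
        \<and> preceq0 D (psum n [p1, p2]) (\<nu>, snd (psum n [p1, p2])) \<longrightarrow>
        (\<exists>\<alpha>. (\<alpha>, snd (psum n [p1, p2])) \<in> A \<and> preceq0 D (\<alpha>, snd (psum n [p1, p2])) (\<nu>, snd (psum n [p1, p2]))))"
    (is "_ \<longleftrightarrow> ?c1 \<and> ?c2 \<and> ?c3")
proof -
  interpret vector_space scale using lie by (simp add: lie_algebra_def)
  obtain B0 where B0: "finite B0" "span B0 = UNIV" using fin by (auto simp: finite_dim_def)
  \<comment> \<open>\<open>finite_dim\<close> provides a finite spanning set; the locales are built
    on a basis, so the set is thinned out.\<close>
  obtain B where B: "B \<subseteq> B0" "independent B" "B0 \<subseteq> span B" using maximal_independent_subset[of B0] by metis
  have finB: "finite B" using B(1) B0(1) by (rule finite_subset)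
  have spanB: "span B = UNIV" using B(3) B0(2) span_minimal[OF _ subspace_span, of B0 B] by auto
  interpret borel_lie scale B br h n gr h0 b0
    by unfold_locales (use finB spanB B(2) lie simple grading cartan h0_def cartan0 borel h0b0 in auto)
  have D: "D = Dl" by (simp add: D_def Dl_def)
  show ?thesis
  proof
    assume "kn_antichain scale br n gr h0 b0 k A"
    then obtain I where I: "kn_pg_b0_subalg scale br n gr b0 k I" "A = minimal_elems Dl (grwt scale br n gr h0 I)"
      unfolding kn_antichain_def Dl_def by blast
    interpret nilp_subalg scale B br h n gr h0 b0 k I by unfold_locales (rule I(1))
    note * = nilp_subalg_antichain[OF I(2) sub]
    have ?c1 using *(1) highest_weight_Wt[OF _ snd_psum_lt] unfolding D by blast
    moreover have ?c2 using *(2) highest_root_Wt unfolding D by blast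
    moreover have ?c3 using *(3) Sigma_plus_iff unfolding D by blast
    ultimately show "?c1 \<and> ?c2 \<and> ?c3" by blast
  next
    assume c: "?c1 \<and> ?c2 \<and> ?c3"
    interpret antichain_data scale B br h n gr h0 b0 k A
    proof
      show "antichain Dl A" using anti D by simp
      show "A \<subseteq> Sigma_plus scale br n gr h0" by (rule sub)
    qed (use c D in blast)+
    show "kn_antichain scale br n gr h0 b0 k A" by (rule antichain_realized)
  qed
qed

end
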